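(* Let $X>0$, $n\ge1$, and let $a_0,a_1$ be $X$-periodic $\mathbb{C}^{n\times n}$-valued functions in $L^2_{\rm per}([0,X])$. For $\sigma\in[0,2\pi)$ set $A_1(\sigma,x)=a_1(x)+2i\sigma I$, $A_0(\sigma,x)=a_0(x)-\sigma^2 I+i\sigma a_1(x)$, and consider the Bloch operator $L_\sigma U=\partial_x^2U+\partial_x(A_1U)+A_0U$ on $L^2_{\rm per}([0,X];\mathbb{C}^n)$. For $\lambda\in\mathbb{C}$ let $K(\sigma,\lambda)=\partial_x(\partial_x^2-1)^{-1}A_1(\sigma,\cdot)+(\partial_x^2-1)^{-1}(A_0(\sigma,\cdot)+(1-\lambda)I)$ (a Hilbert–Schmidt operator on $L^2_{\rm per}([0,X];\mathbb{C}^n)$) and define $$D_\sigma(\lambda):={\det}_2\big(I+K(\sigma,\lambda)\big).$$ Then $D_\sigma(\lambda)$ is complex-analytic in $\lambda\in\mathbb{C}$ and continuous in $\sigma$. Moreover, for each fixed $\sigma\in[0,2\pi)$, the zeros of $D_\sigma$ coincide with the eigenvalues of $L_\sigma$ on $L^2_{\rm per}([0,X];\mathbb{C}^n)$, and the order of each zero equals the algebraic multiplicity of the corresponding eigenvalue.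
   Context: $\partial_x(A_1U)$ means the derivative of the product. The multipliers $(\partial_x^2-1)^{-1}$, $\partial_x(\partial_x^2-1)^{-1}$ act diagonally on Fourier modes $e^{2\pi ikx/X}$. The 2-modified Fredholm determinant: on a finite-dimensional space, ${\det}_2(I-A)=\det(I-A)e^{\operatorname{tr}A}$; for a Hilbert–Schmidt operator $A$ on a separable Hilbert space $\mathcal{H}$, ${\det}_2(I-A)=\lim_{J\to\infty}{\det}_2(I-P_JAP_J|_{\mathcal{H}_J})$ for any increasing sequence of finite-dimensional subspaces $\mathcal{H}_J$ with dense union and orthogonal projections $P_J$ onto them (equivalently $\prod_k(1-\alpha_k)e^{\alpha_k}$ over the eigenvalues $\alpha_k$ of $A$). Here ${\det}_2(I+K)$ means ${\det}_2(I-(-K))$. *)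

theory Defs
  imports "HOL-Analysis.Analysis" "HOL-Complex_Analysis.Complex_Analysis" "HOL-Library.Function_Algebras"
begin

definition L2per :: "real \<Rightarrow> (real \<Rightarrow> 'a::real_normed_vector) \<Rightarrow> bool" where
  "L2per X f \<longleftrightarrow> (\<forall>x. f (x + X) = f x) \<and> f \<in> borel_measurable lebesgue
      \<and> (\<lambda>x. (norm (f x))\<^sup>2) integrable_on {0..X}"

definition fcoef :: "real \<Rightarrow> (real \<Rightarrow> complex) \<Rightarrow> int \<Rightarrow> complex" where
  "fcoef X g k = integral {0..X} (\<lambda>x. exp (- \<i> * complex_of_real (2 * pi * of_int k * x / X)) * g x)
                   / complex_of_real X"

definition mfcoef :: "real \<Rightarrow> (real \<Rightarrow> complex^'n^'n) \<Rightarrow> int \<Rightarrow> complex^'n^'n" where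
  "mfcoef X a k = (\<chi> i j. fcoef X (\<lambda>x. a x $ i $ j) k)"

definition wnum :: "real \<Rightarrow> int \<Rightarrow> complex" where
  "wnum X k = complex_of_real (2 * pi * of_int k / X)"

definition A1hat :: "real \<Rightarrow> (real \<Rightarrow> complex^'n^'n) \<Rightarrow> real \<Rightarrow> int \<Rightarrow> complex^'n^'n" where
  "A1hat X a1 \<sigma> j = mfcoef X a1 j + (if j = 0 then mat (2 * \<i> * complex_of_real \<sigma>) else 0)"

definition A0hat :: "real \<Rightarrow> (real \<Rightarrow> complex^'n^'n) \<Rightarrow> (real \<Rightarrow> complex^'n^'n) \<Rightarrow> real \<Rightarrow> int \<Rightarrow> complex^'n^'n" where
  "A0hat X a0 a1 \<sigma> j = mfcoef X a0 j + (if j = 0 then mat (- (complex_of_real \<sigma>)\<^sup>2) else 0)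
       + (\<chi> i l. \<i> * complex_of_real \<sigma> * mfcoef X a1 j $ i $ l)"

text \<open>L^2_per([0,X];C^n), represented unitarily by Fourier coefficient sequences in l^2(Z;C^n).\<close>
definition l2seq :: "(int \<Rightarrow> complex^'n) \<Rightarrow> bool" where
  "l2seq U \<longleftrightarrow> (\<lambda>k. (norm (U k))\<^sup>2) summable_on UNIV"

text \<open>Fourier coefficients of a product (multiplication operator = convolution).\<close>
definition conv :: "(int \<Rightarrow> complex^'n^'n) \<Rightarrow> (int \<Rightarrow> complex^'n) \<Rightarrow> int \<Rightarrow> complex^'n" where
  "conv A U k = (\<Sum>\<^sub>\<infinity>m. A (k - m) *v U m)"

text \<open>The Bloch operator L_sigma U = U'' + (A_1 U)' + A_0 U on Fourier coefficients.\<close>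
definition Lsig :: "real \<Rightarrow> (real \<Rightarrow> complex^'n^'n) \<Rightarrow> (real \<Rightarrow> complex^'n^'n) \<Rightarrow> real
     \<Rightarrow> (int \<Rightarrow> complex^'n) \<Rightarrow> int \<Rightarrow> complex^'n" where
  "Lsig X a0 a1 \<sigma> U k = (- (wnum X k)\<^sup>2) *s U k
      + (\<i> * wnum X k) *s conv (A1hat X a1 \<sigma>) U k + conv (A0hat X a0 a1 \<sigma>) U k"

definition Ldom :: "real \<Rightarrow> (real \<Rightarrow> complex^'n^'n) \<Rightarrow> (real \<Rightarrow> complex^'n^'n) \<Rightarrow> real
     \<Rightarrow> (int \<Rightarrow> complex^'n) set" where
  "Ldom X a0 a1 \<sigma> = {U. l2seq U \<and> l2seq (Lsig X a0 a1 \<sigma> U)}"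

definition is_eigenvalue :: "real \<Rightarrow> (real \<Rightarrow> complex^'n^'n) \<Rightarrow> (real \<Rightarrow> complex^'n^'n) \<Rightarrow> real
     \<Rightarrow> complex \<Rightarrow> bool" where
  "is_eigenvalue X a0 a1 \<sigma> z \<longleftrightarrow> (\<exists>U\<in>Ldom X a0 a1 \<sigma>. U \<noteq> 0 \<and> Lsig X a0 a1 \<sigma> U = (\<lambda>k. z *s U k))"

definition shifted :: "real \<Rightarrow> (real \<Rightarrow> complex^'n^'n) \<Rightarrow> (real \<Rightarrow> complex^'n^'n) \<Rightarrow> real
     \<Rightarrow> complex \<Rightarrow> (int \<Rightarrow> complex^'n) \<Rightarrow> (int \<Rightarrow> complex^'n)" where
  "shifted X a0 a1 \<sigma> z U = (\<lambda>k. Lsig X a0 a1 \<sigma> U k - z *s U k)"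

definition gen_eigenspace :: "real \<Rightarrow> (real \<Rightarrow> complex^'n^'n) \<Rightarrow> (real \<Rightarrow> complex^'n^'n) \<Rightarrow> real
     \<Rightarrow> complex \<Rightarrow> (int \<Rightarrow> complex^'n) set" where
  "gen_eigenspace X a0 a1 \<sigma> z = {U. \<exists>m. (\<forall>j<m. (shifted X a0 a1 \<sigma> z ^^ j) U \<in> Ldom X a0 a1 \<sigma>)
       \<and> (shifted X a0 a1 \<sigma> z ^^ m) U = 0}"

definition cscale :: "complex \<Rightarrow> (int \<Rightarrow> complex^'n) \<Rightarrow> (int \<Rightarrow> complex^'n)" where
  "cscale c U = (\<lambda>k. c *s U k)"

definition alg_mult :: "real \<Rightarrow> (real \<Rightarrow> complex^'n^'n) \<Rightarrow> (real \<Rightarrow> complex^'n^'n) \<Rightarrow> real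
     \<Rightarrow> complex \<Rightarrow> nat" where
  "alg_mult X a0 a1 \<sigma> z = vector_space.dim cscale (gen_eigenspace X a0 a1 \<sigma> z)"

text \<open>Matrix of K(sigma,lambda) in the Fourier basis, indices (k, alpha).\<close>
definition Kmat :: "real \<Rightarrow> (real \<Rightarrow> complex^'n^'n) \<Rightarrow> (real \<Rightarrow> complex^'n^'n) \<Rightarrow> real \<Rightarrow> complex
     \<Rightarrow> int \<times> 'n \<Rightarrow> int \<times> 'n \<Rightarrow> complex" where
  "Kmat X a0 a1 \<sigma> z = (\<lambda>(k, \<alpha>) (m, \<beta>).
      (- 1 / (1 + (wnum X k)\<^sup>2)) *
      (\<i> * wnum X k * A1hat X a1 \<sigma> (k - m) $ \<alpha> $ \<beta> + A0hat X a0 a1 \<sigma> (k - m) $ \<alpha> $ \<beta>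
        + (if k = m \<and> \<alpha> = \<beta> then 1 - z else 0)))"

definition fdet :: "'i set \<Rightarrow> ('i \<Rightarrow> 'i \<Rightarrow> complex) \<Rightarrow> complex" where
  "fdet S M = (\<Sum>p | p permutes S. of_int (sign p) * (\<Prod>i\<in>S. M i (p i)))"

definition fdet2 :: "'i set \<Rightarrow> ('i \<Rightarrow> 'i \<Rightarrow> complex) \<Rightarrow> complex" where
  "fdet2 S M = fdet S (\<lambda>i j. (if i = j then 1 else 0) + M i j) * exp (- (\<Sum>i\<in>S. M i i))"

definition Dtrunc :: "real \<Rightarrow> (real \<Rightarrow> complex^'n^'n) \<Rightarrow> (real \<Rightarrow> complex^'n^'n) \<Rightarrow> real \<Rightarrow> complex
     \<Rightarrow> nat \<Rightarrow> complex" where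
  "Dtrunc X a0 a1 \<sigma> z J = fdet2 ({- int J..int J} \<times> (UNIV :: 'n set)) (Kmat X a0 a1 \<sigma> z)"

definition Dsig :: "real \<Rightarrow> (real \<Rightarrow> complex^'n^'n) \<Rightarrow> (real \<Rightarrow> complex^'n^'n) \<Rightarrow> real \<Rightarrow> complex \<Rightarrow> complex" where
  "Dsig X a0 a1 \<sigma> z = lim (Dtrunc X a0 a1 \<sigma> z)"

end

theory Submission
  imports Defs "Jordan_Normal_Form.Determinant"
begin

text \<open>
  In the Fourier basis D is the limit of the 2-modified determinants of finite sections. Hadamard's
  inequality gives Carleman's bound for them, Cauchy's estimate turns it into a Lipschitz bound in the
  Hilbert--Schmidt norm, and convergence, analyticity in the spectral parameter and continuity in
  sigma follow. Compactness shows that det2 (1 + K) vanishes iff 1 + K has a kernel, and in Fourier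
  variables 1 + K(z) is (up to sign) the operator L - z divided by the positive weights 1 + (2 pi k / X)^2.

  For the multiplicities, write K(z + mu) = A + mu G with G diagonal and T = L - z. A maximal chain
  e_0, e_1, ... with T e_j in the span of e_i for i < j spans the generalised kernel of T. Each e_j
  splits off a factor mu from det2 (1 + K(z + mu)) by a rank one correction, and by maximality of
  the chain the operator that is left has no kernel at mu = 0.
\<close>

hide_const (open) Finite_Cartesian_Product.mat Finite_Cartesian_Product.vec Determinants.det
no_notation Finite_Cartesian_Product.vec_nth (infixl "$" 90)

section \<open>Determinants over finite index sets\<close>

text \<open>The derivative term of K decays only like 1/k along the modes, so K is in general not of
  trace class: plain determinants and traces of the sections cannot be controlled separately, and
  every estimate must be uniform in the size of the section and use the Hilbert--Schmidt norm alone.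
  A relation between infinite families, such as (1 + A) u = 0, holds on a finite section only up to
  a residual. The matrix or the vector is therefore changed so that the relation becomes exact on
  the section, the finite determinant identity is applied, and \<open>fdet2_perturb\<close> absorbs
  the change in the limit. For the multiplicities, nothing guarantees beforehand that the
  generalised kernel has finite dimension. This comes out of the determinant itself: a chain of
  length d forces a zero of order at least d, while the determinant is not identically zero, because
  1 + K(z + mu) has no kernel for a suitable real mu >= 0. Besides its factor mu, each rank one
  correction contributes only the exponential of an affine function of mu, which adds no
  zeros.\<close>

text \<open>Conjugation with the enumeration \<open>h\<close> matches the permutations of
  \<open>S\<close> with those of \<open>{0..<n}\<close> and preserves their signs, so the two
  Leibniz sums agree term by term. This opens the matrix library to determinants over arbitrary
  finite index sets.\<close>

lemma fdet_eq_det: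
  fixes M :: "'i \<Rightarrow> 'i \<Rightarrow> complex"
  assumes "bij_betw h {0..<n} S"
  shows "fdet S M = det (mat n n (\<lambda>(i,j). M (h i) (h j)))"
proof -
  let ?T = "{0..<n}"
  have inj: "inj_on h ?T" and S: "h ` ?T = S" using assms by (auto simp: bij_betw_def)
  let ?g = "inv_into ?T h"
  have g: "bij_betw ?g S ?T" using assms by (rule bij_betw_inv_into)
  have "fdet S M = (\<Sum>p | p permutes ?T. of_int (sign p) * (\<Prod>i\<in>?T. M (h i) (h (p i))))"
    unfolding fdet_def
  proof (rule sum.reindex_bij_witness[where j = "map_permutation S ?g" and i = "map_permutation ?T h"])
    fix p assume p: "p \<in> {p. p permutes S}"
    show "map_permutation ?T h (map_permutation S ?g p) = p"
      by (rule map_permutation_compose_inv[OF g]) (use p S in \<open>auto intro: f_inv_into_f\<close>)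
    show "map_permutation S ?g p \<in> {p. p permutes ?T}"
      using map_permutation_permutes[OF g] p by auto
    have 1: "sign (map_permutation S ?g p) = sign p"
      by (rule sign_map_permutation) (use g p bij_betw_finite[OF g] in \<open>auto simp: bij_betw_def\<close>)
    have 2: "h (map_permutation S ?g p i) = p (h i)" if "i \<in> ?T" for i
    proof -
      have hi: "h i \<in> S" using S that by auto
      have "map_permutation S ?g p (?g (h i)) = ?g (p (h i))"
        by (rule map_permutation_apply) (use g hi in \<open>auto simp: bij_betw_def\<close>)
      moreover have "?g (h i) = i" using inj that by auto
      moreover have "p (h i) \<in> S" using p hi by (simp add: permutes_in_image)
      ultimately show ?thesis using S by (simp add: f_inv_into_f)
    qed
    have "(\<Prod>i\<in>?T. M (h i) (h (map_permutation S ?g p i))) = (\<Prod>i\<in>?T. M (h i) (p (h i)))"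
      using 2 by (intro prod.cong) auto
    also have "\<dots> = (\<Prod>i\<in>S. M i (p i))"
      by (rule prod.reindex_bij_betw[OF assms])
    finally show "of_int (sign (map_permutation S ?g p)) * (\<Prod>i\<in>?T. M (h i) (h (map_permutation S ?g p i)))
        = of_int (sign p) * (\<Prod>i\<in>S. M i (p i))" using 1 by simp
  next
    fix p assume p: "p \<in> {p. p permutes ?T}"
    show "map_permutation S ?g (map_permutation ?T h p) = p"
      by (rule map_permutation_compose_inv[OF assms]) (use p inj in auto)
    show "map_permutation ?T h p \<in> {p. p permutes S}"
      using map_permutation_permutes[OF assms] p by auto
  qed
  also have "\<dots> = det (mat n n (\<lambda>(i,j). M (h i) (h j)))"
    unfolding det_def by (auto intro!: sum.cong prod.cong simp: permutes_in_image)
  finally show ?thesis .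
qed

lemma fdet_cong:
  assumes "\<And>i j. i \<in> S \<Longrightarrow> j \<in> S \<Longrightarrow> M i j = N i j"
  shows "fdet S M = fdet S N"
  unfolding fdet_def using assms by (intro sum.cong prod.cong arg_cong2[of _ _ _ _ "(*)"]) (auto simp: permutes_in_image)

lemma ex_enum:
  assumes "finite S"
  obtains h where "bij_betw h {0..<card S} S"
  using ex_bij_betw_nat_finite[OF assms] by blast

lemma fdet_mult:
  assumes "finite S"
  shows "fdet S (\<lambda>i j. \<Sum>k\<in>S. M i k * N k j) = fdet S M * fdet S N"
proof -
  obtain h where h: "bij_betw h {0..<card S} S" using assms by (rule ex_enum)
  let ?n = "card S"
  let ?m = "\<lambda>M. mat ?n ?n (\<lambda>(i,j). M (h i) (h j)) :: complex mat"
  have "?m (\<lambda>i j. \<Sum>k\<in>S. M i k * N k j) = ?m M * ?m N"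
    by (rule eq_matI) (auto simp: scalar_prod_def sum.reindex_bij_betw[OF h, symmetric])
  then show ?thesis
    unfolding fdet_eq_det[OF h] by (simp add: det_mult[of _ ?n])
qed

lemma fdet_one: "finite S \<Longrightarrow> fdet S (\<lambda>i j. if i = j then 1 else 0) = 1"
proof -
  assume f: "finite S"
  obtain h where h: "bij_betw h {0..<card S} S" using f by (rule ex_enum)
  let ?n = "card S"
  have "mat ?n ?n (\<lambda>(i,j). if h i = h j then 1 else 0 :: complex) = 1\<^sub>m ?n"
    using h by (intro eq_matI) (auto simp: bij_betw_def inj_on_def)
  then show ?thesis unfolding fdet_eq_det[OF h] by simp
qed

text \<open>The matrix determinant lemma, obtained from Sylvester's identity det (I + F P) = det (J
  + P F) for a column F and a row P.\<close>

lemma fdet_rank_one: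
  assumes "finite S"
  shows "fdet S (\<lambda>i j. (if i = j then 1 else 0) + f i * \<phi> j) = 1 + (\<Sum>i\<in>S. \<phi> i * f i)"
proof -
  obtain h where h: "bij_betw h {0..<card S} S" using assms by (rule ex_enum)
  define n where "n = card S"
  define F where "F = mat n 1 (\<lambda>(i,_). f (h i))"
  define P where "P = mat 1 n (\<lambda>(_,j). \<phi> (h j))"
  have F: "F \<in> carrier_mat n 1" and P: "P \<in> carrier_mat 1 n" by (auto simp: F_def P_def)
  define I where "I = (1\<^sub>m n :: complex mat)"
  define J where "J = (1\<^sub>m 1 :: complex mat)"
  have I: "I \<in> carrier_mat n n" and J: "J \<in> carrier_mat 1 1" by (auto simp: I_def J_def)
  \<comment> \<open>\<open>?L\<close> and \<open>?L'\<close> are block unitriangular, and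
    \<open>?L * (?M * ?L')\<close> is block triangular with diagonal blocks \<open>I\<close> and
    \<open>J + P * F\<close>, while \<open>?M\<close> has the diagonal blocks
    \<open>I + F * P\<close> and \<open>J\<close>.\<close>
  let ?M = "four_block_mat (I + F * P) F (0\<^sub>m 1 n) J"
  let ?L = "four_block_mat I (0\<^sub>m n 1) P J"
  let ?L' = "four_block_mat I (0\<^sub>m n 1) (- P) J"
  have FP: "F * P \<in> carrier_mat n n" and PF: "P * F \<in> carrier_mat 1 1" using F P by auto
  have "?M * ?L' = four_block_mat ((I + F * P) * I + F * (- P)) ((I + F * P) * 0\<^sub>m n 1 + F * J)
      (0\<^sub>m 1 n * I + J * (- P)) (0\<^sub>m 1 n * 0\<^sub>m n 1 + J * J)"
    by (rule mult_four_block_mat) (use F P I J FP in auto)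
  also have "(I + F * P) * I + F * (- P) = I"
    using F P FP by (auto simp: I_def)
  also have "(I + F * P) * 0\<^sub>m n 1 + F * J = F" using F FP by (auto simp: I_def J_def)
  also have "0\<^sub>m 1 n * I + J * (- P) = - P" using P by (auto simp: I_def J_def)
  also have "0\<^sub>m 1 n * 0\<^sub>m n 1 + J * J = J" by (auto simp: J_def)
  finally have 1: "?M * ?L' = four_block_mat I F (- P) J" .
  have "?L * four_block_mat I F (- P) J = four_block_mat (I * I + 0\<^sub>m n 1 * (-P)) (I * F + 0\<^sub>m n 1 * J)
     (P * I + J * (- P)) (P * F + J * J)"
    by (rule mult_four_block_mat) (use F P I J FP in auto)
  also have "I * I + 0\<^sub>m n 1 * (-P) = I" using P by (auto simp: I_def)
  also have "I * F + 0\<^sub>m n 1 * J = F" using F by (auto simp: I_def J_def)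
  also have "P * I + J * (- P) = 0\<^sub>m 1 n" using P by (auto simp: I_def J_def)
  also have "P * F + J * J = J + P * F" using PF by (simp add: J_def comm_add_mat[of _ 1 1])
  finally have 2: "?L * (?M * ?L') = four_block_mat I F (0\<^sub>m 1 n) (J + P * F)" using 1 by simp
  have dL: "det ?L = 1"
    by (subst det_four_block_mat_upper_right_zero[of _ n _ 1]) (use P I J in \<open>auto simp: I_def J_def\<close>)
  have dL': "det ?L' = 1"
    by (subst det_four_block_mat_upper_right_zero[of _ n _ 1]) (use P I J in \<open>auto simp: I_def J_def\<close>)
  have dM: "det ?M = det (I + F * P)"
    by (subst det_four_block_mat_lower_left_zero[of _ n _ 1]) (use F P I J FP in \<open>auto simp: I_def J_def\<close>)
  have dR: "det (four_block_mat I F (0\<^sub>m 1 n) (J + P * F)) = det (J + P * F)"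
    by (subst det_four_block_mat_lower_left_zero[of _ n _ 1]) (use F P I J PF in \<open>auto simp: I_def J_def\<close>)
  have c: "?L \<in> carrier_mat (n+1) (n+1)" "?M \<in> carrier_mat (n+1) (n+1)" "?L' \<in> carrier_mat (n+1) (n+1)"
    using F P I J FP by (auto intro!: four_block_carrier_mat)
  have "det (?L * (?M * ?L')) = det ?L * (det ?M * det ?L')"
    using c by (simp add: det_mult[of _ "n+1"])
  then have key: "det (I + F * P) = det (J + P * F)" using 2 dL dL' dM dR by simp
  have "mat n n (\<lambda>(i,j). (if h i = h j then 1 else 0) + f (h i) * \<phi> (h j)) = I + F * P"
    using h by (intro eq_matI) (auto simp: I_def F_def P_def scalar_prod_def bij_betw_def inj_on_def n_def)
  then have "fdet S (\<lambda>i j. (if i = j then 1 else 0) + f i * \<phi> j) = det (J + P * F)"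
    unfolding fdet_eq_det[OF h] key[symmetric] n_def by simp
  also have "\<dots> = (J + P * F) $$ (0,0)"
    by (rule det_single) (use PF J in auto)
  also have "\<dots> = 1 + (\<Sum>i = 0..<n. \<phi> (h i) * f (h i))"
    by (auto simp: J_def P_def F_def scalar_prod_def)
  also have "(\<Sum>i = 0..<n. \<phi> (h i) * f (h i)) = (\<Sum>i\<in>S. \<phi> i * f i)"
    unfolding n_def by (rule sum.reindex_bij_betw[OF h])
  finally show ?thesis .
qed

lemma fdet_eq_0_iff:
  assumes "finite S"
  shows "fdet S M = 0 \<longleftrightarrow> (\<exists>v. (\<exists>i\<in>S. v i \<noteq> 0) \<and> (\<forall>i\<in>S. (\<Sum>j\<in>S. M i j * v j) = 0))"
proof -
  obtain h where h: "bij_betw h {0..<card S} S" using assms by (rule ex_enum)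
  let ?n = "card S"
  let ?g = "inv_into {0..<?n} h"
  have gh: "?g (h i) = i" if "i < ?n" for i using h that by (auto simp: bij_betw_def)
  have hS: "h i \<in> S" if "i < ?n" for i using h that by (auto simp: bij_betw_def)
  have ex: "\<exists>k<?n. i = h k" if "i \<in> S" for i using h that by (metis atLeastLessThan_iff bij_betw_iff_bijections)
  let ?A = "mat ?n ?n (\<lambda>(i,j). M (h i) (h j))"
  have A: "?A \<in> carrier_mat ?n ?n" by auto
  show ?thesis unfolding fdet_eq_det[OF h] det_0_iff_vec_prod_zero_field[OF A]
  proof safe
    fix v assume v: "v \<in> carrier_vec ?n" "v \<noteq> 0\<^sub>v ?n" "?A *\<^sub>v v = 0\<^sub>v ?n"
    let ?w = "\<lambda>i. v $ (?g i)"
    obtain k where k: "k < ?n" "v $ k \<noteq> 0" using v(1,2) by (metis carrier_vecD eq_vecI index_zero_vec(1,2))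
    have "(\<Sum>j\<in>S. M i j * ?w j) = 0" if i: "i \<in> S" for i
    proof -
      obtain k where k: "k < ?n" "i = h k" using ex[OF i] by blast
      have "(\<Sum>j\<in>S. M i j * ?w j) = (\<Sum>j=0..<?n. M (h k) (h j) * v $ j)"
        unfolding sum.reindex_bij_betw[OF h, symmetric] using gh k by auto
      also have "\<dots> = (?A *\<^sub>v v) $ k" using k v(1) by (simp add: scalar_prod_def)
      finally show ?thesis using v(3) k by simp
    qed
    moreover have "\<exists>i\<in>S. ?w i \<noteq> 0" using k gh hS by (intro bexI[of _ "h k"]) auto
    ultimately show "\<exists>v. (\<exists>i\<in>S. v i \<noteq> 0) \<and> (\<forall>i\<in>S. (\<Sum>j\<in>S. M i j * v j) = 0)" by (intro exI[of _ ?w] conjI ballI)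
  next
    fix v i assume v: "\<forall>i\<in>S. (\<Sum>j\<in>S. M i j * v j) = 0" "i \<in> S" "v i \<noteq> 0"
    let ?w = "vec ?n (\<lambda>k. v (h k))"
    obtain k where k: "k < ?n" "i = h k" using ex v by blast
    have "?A *\<^sub>v ?w = 0\<^sub>v ?n"
    proof (rule eq_vecI)
      fix i assume "i < dim_vec (0\<^sub>v ?n)"
      then have i: "i < ?n" by simp
      have "(?A *\<^sub>v ?w) $ i = (\<Sum>j=0..<?n. M (h i) (h j) * v (h j))"
        using i by (simp add: scalar_prod_def)
      also have "\<dots> = (\<Sum>j\<in>S. M (h i) j * v j)" by (rule sum.reindex_bij_betw[OF h])
      finally show "(?A *\<^sub>v ?w) $ i = 0\<^sub>v ?n $ i" using i v hS by simp
    qed auto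
    moreover have "?w \<noteq> 0\<^sub>v ?n" using k v(3) by (metis index_vec index_zero_vec(1))
    ultimately show "\<exists>w. w \<in> carrier_vec ?n \<and> w \<noteq> 0\<^sub>v ?n \<and> ?A *\<^sub>v w = 0\<^sub>v ?n"
      by (intro exI[of _ ?w]) auto
  qed
qed

lemma fdet_nonzero_inverse:
  assumes "finite S" "fdet S M \<noteq> 0"
  obtains N where "\<And>i j. i \<in> S \<Longrightarrow> j \<in> S \<Longrightarrow> (\<Sum>k\<in>S. M i k * N k j) = (if i = j then 1 else 0)"
proof -
  obtain h where h: "bij_betw h {0..<card S} S" using assms(1) by (rule ex_enum)
  let ?n = "card S"
  let ?g = "inv_into {0..<?n} h"
  have gh: "?g (h i) = i" if "i < ?n" for i using h that by (auto simp: bij_betw_def)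
  have ex: "\<exists>k<?n. i = h k" if "i \<in> S" for i using h that by (metis atLeastLessThan_iff bij_betw_iff_bijections)
  let ?A = "mat ?n ?n (\<lambda>(i,j). M (h i) (h j))"
  have "?A \<in> Units (ring_mat TYPE(complex) ?n ())"
    by (rule det_non_zero_imp_unit) (use assms(2) in \<open>auto simp: fdet_eq_det[OF h]\<close>)
  then obtain B where B: "B \<in> carrier_mat ?n ?n" "?A * B = 1\<^sub>m ?n"
    unfolding Units_def ring_mat_def by auto
  show ?thesis
  proof (rule that)
    fix i j assume "i \<in> S" "j \<in> S"
    then obtain k l where k: "k < ?n" "i = h k" "l < ?n" "j = h l" using ex by meson
    have "(\<Sum>m\<in>S. M i m * B $$ (?g m, ?g j)) = (\<Sum>m=0..<?n. M (h k) (h m) * B $$ (m, l))"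
      unfolding sum.reindex_bij_betw[OF h, symmetric] using gh k by auto
    also have "\<dots> = (?A * B) $$ (k, l)" using k B(1) by (simp add: scalar_prod_def)
    also have "\<dots> = (if i = j then 1 else 0)"
      unfolding B(2) using k gh by auto (metis gh)
    finally show "(\<Sum>m\<in>S. M i m * B $$ (?g m, ?g j)) = (if i = j then 1 else 0)" .
  qed
qed

text \<open>Only permutations that fix \<open>a\<close> have a nonzero product, and these are
  exactly the permutations of \<open>S - {a}\<close>.\<close>

lemma fdet_single_row:
  assumes "finite S" "a \<in> S" "\<And>j. j \<in> S \<Longrightarrow> j \<noteq> a \<Longrightarrow> M a j = 0"
  shows "fdet S M = M a a * fdet (S - {a}) M"
proof -
  have "fdet S M = (\<Sum>p | p permutes (S - {a}). of_int (sign p) * (\<Prod>i\<in>S. M i (p i)))"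
    unfolding fdet_def
  proof (rule sum.mono_neutral_right)
    show "finite {p. p permutes S}" using assms(1) by (rule finite_permutations)
    show "{p. p permutes S - {a}} \<subseteq> {p. p permutes S}" by (auto intro: permutes_subset)
    show "\<forall>p\<in>{p. p permutes S} - {p. p permutes S - {a}}. of_int (sign p) * (\<Prod>i\<in>S. M i (p i)) = 0"
    proof
      fix p assume p: "p \<in> {p. p permutes S} - {p. p permutes S - {a}}"
      then have "p a \<noteq> a" using permutes_superset[of p S "S - {a}"] by auto
      moreover have "p a \<in> S" using p assms(2) by (simp add: permutes_in_image)
      ultimately have "M a (p a) = 0" using assms(3) by blast
      then show "of_int (sign p) * (\<Prod>i\<in>S. M i (p i)) = 0" using assms(1,2) by (auto intro: prod_zero)
    qed
  qed
  also have "\<dots> = (\<Sum>p | p permutes (S - {a}). M a a * (of_int (sign p) * (\<Prod>i\<in>S-{a}. M i (p i))))"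
  proof (intro sum.cong refl)
    fix p assume "p \<in> {p. p permutes S - {a}}"
    then have "p a = a" by (auto simp: permutes_def)
    then show "of_int (sign p) * (\<Prod>i\<in>S. M i (p i)) = M a a * (of_int (sign p) * (\<Prod>i\<in>S-{a}. M i (p i)))"
      by (simp add: prod.remove[OF assms(1,2)])
  qed
  finally show ?thesis unfolding fdet_def by (simp add: sum_distrib_left)
qed

hide_const (open) Matrix.mat Matrix.vec Determinant.det
hide_type (open) Matrix.mat Matrix.vec
no_notation vec_index (infixl "$" 100)
notation Finite_Cartesian_Product.vec_nth (infixl "$" 90)

section \<open>Hadamard, Carleman and Lipschitz estimates\<close>

lemma sum_delta_mult:
  fixes f :: "'i \<Rightarrow> complex"
  assumes "finite S" "i \<in> S"
  shows "(\<Sum>k\<in>S. (if i = k then 1 else 0) * f k) = f i"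
    and "(\<Sum>k\<in>S. f k * (if k = i then 1 else 0)) = f i"
  using assms by (simp_all add: if_distrib[of "\<lambda>x. x * _"] if_distrib[of "\<lambda>x. _ * x"] cong: if_cong)

text \<open>A complex Householder reflection, acting on rows from the right: it is unitary and maps
  the row \<open>v\<close> to a multiple of the unit vector at \<open>a\<close>.\<close>

lemma householder:
  fixes v :: "'i \<Rightarrow> complex"
  assumes "finite S" "a \<in> S"
  obtains H where "cmod (fdet S H) = 1"
    "\<And>r. (\<Sum>j\<in>S. (cmod (\<Sum>k\<in>S. r k * H k j))\<^sup>2) = (\<Sum>j\<in>S. (cmod (r j))\<^sup>2)"
    "\<And>j. j \<in> S \<Longrightarrow> j \<noteq> a \<Longrightarrow> (\<Sum>k\<in>S. v k * H k j) = 0"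
proof (cases "(\<Sum>j\<in>S. (cmod (v j))\<^sup>2) = 0")
  case True
  then have v0: "\<And>j. j \<in> S \<Longrightarrow> v j = 0" using assms(1) by (simp add: sum_nonneg_eq_0_iff)
  show ?thesis
    by (rule that[of "\<lambda>i j. if i = j then 1 else 0"])
       (use assms v0 in \<open>auto simp: fdet_one sum_delta_mult\<close>)
next
  case False
  define N where "N = (\<Sum>j\<in>S. (cmod (v j))\<^sup>2)"
  have N: "N > 0" using False by (simp add: N_def sum_nonneg less_le)
  define n where "n = sqrt N"
  have n: "n > 0" "n * n = N" using N by (auto simp: n_def)
  \<comment> \<open>The phase opposite to that of \<open>v a\<close>: then
    \<open>v a * cnj s\<close> is real and nonpositive, so no cancellation occurs in
    \<open>w\<close> and its squared length \<open>W\<close> is at least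
    \<open>2 * N > 0\<close>.\<close>
  define s where "s = (if v a = 0 then 1 else - sgn (v a))"
  have s1: "s * cnj s = 1" by (simp add: s_def complex_norm_square[symmetric] norm_sgn del: of_real_power)
  have s2: "v a * cnj s = - complex_of_real (cmod (v a))"
  proof (cases "v a = 0")
    case False
    have "v a * cnj (v a) = of_real (cmod (v a)) ^ 2" by (simp only: complex_norm_square[symmetric] of_real_power)
    then show ?thesis using False by (simp add: s_def sgn_eq power2_eq_square)
  qed auto
  define w where "w j = v j - (if j = a then of_real n * s else 0)" for j
  define R where "R = (\<Sum>j\<in>S-{a}. (cmod (v j))\<^sup>2)"
  define W where "W = (\<Sum>j\<in>S. (cmod (w j))\<^sup>2)"
  have NR: "N = (cmod (v a))\<^sup>2 + R" unfolding N_def R_def by (rule sum.remove[OF assms])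
  have waR: "(\<Sum>j\<in>S-{a}. v j * cnj (w j)) = of_real R"
    unfolding R_def of_real_sum by (intro sum.cong) (auto simp: w_def complex_norm_square simp del: of_real_power)
  have "(\<Sum>j\<in>S. v j * cnj (w j)) = v a * cnj (w a) + of_real R"
    by (simp add: sum.remove[OF assms] waR)
  also have "v a * cnj (w a) = of_real ((cmod (v a))\<^sup>2) + of_real n * of_real (cmod (v a))"
  proof -
    have "v a * cnj (w a) = v a * cnj (v a) - of_real n * (v a * cnj s)"
      by (simp add: w_def algebra_simps)
    then show ?thesis unfolding s2 by (simp add: complex_norm_square del: of_real_power)
  qed
  finally have b: "(\<Sum>j\<in>S. v j * cnj (w j)) = of_real (N + n * cmod (v a))"
    using NR by simp
  have "W = (cmod (w a))\<^sup>2 + R"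
    unfolding W_def R_def by (simp add: sum.remove[OF assms] w_def)
  moreover have "of_real ((cmod (w a))\<^sup>2) = (of_real ((cmod (v a))\<^sup>2 + 2 * n * cmod (v a) + N) :: complex)"
  proof -
    have "of_real ((cmod (w a))\<^sup>2) = w a * cnj (w a)" by (rule complex_norm_square)
    also have "\<dots> = v a * cnj (v a) - of_real n * (v a * cnj s) - of_real n * cnj (v a * cnj s) + of_real (n * n) * (s * cnj s)"
      by (simp add: w_def algebra_simps)
    also have "\<dots> = of_real ((cmod (v a))\<^sup>2 + 2 * n * cmod (v a) + N)"
      unfolding s1 s2 by (simp add: complex_norm_square n del: of_real_power)
    finally show ?thesis .
  qed
  ultimately have W: "W = 2 * (N + n * cmod (v a))"
    using NR by (simp only: of_real_eq_iff) (simp add: algebra_simps)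
  then have W0: "W > 0" using N n by (simp add: add_pos_nonneg)
  define c where "c = 2 / W"
  have cW: "c * W = 2" using W0 by (simp add: c_def)
  \<comment> \<open>The reflection in the hyperplane orthogonal to \<open>w\<close>; the factor
    \<open>c\<close> is 2 divided by the squared length of \<open>w\<close>.\<close>
  define H where "H k j = (if k = j then 1 else 0) - of_real c * cnj (w k) * w j" for k j
  have rH: "(\<Sum>k\<in>S. r k * H k j) = r j - of_real c * (\<Sum>k\<in>S. r k * cnj (w k)) * w j" if "j \<in> S" for r j
  proof -
    have "(\<Sum>k\<in>S. r k * H k j) = (\<Sum>k\<in>S. r k * (if k = j then 1 else 0)) - (\<Sum>k\<in>S. of_real c * (r k * cnj (w k)) * w j)"
      unfolding H_def by (simp add: algebra_simps sum_subtractf sum.distrib)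
    then show ?thesis using sum_delta_mult(2)[OF assms(1) that, of r] by (simp add: sum_distrib_left sum_distrib_right)
  qed
  show ?thesis
  proof (rule that)
    have "fdet S H = 1 + (\<Sum>i\<in>S. w i * (- of_real c * cnj (w i)))"
      using fdet_rank_one[OF assms(1), of "\<lambda>k. - of_real c * cnj (w k)" w] unfolding H_def by simp
    also have "(\<Sum>i\<in>S. w i * (- of_real c * cnj (w i))) = - of_real (c * W)"
      unfolding W_def by (simp add: sum_distrib_left sum_negf complex_norm_square mult_ac del: of_real_power)
    finally show "cmod (fdet S H) = 1" unfolding cW by simp
  next
    fix r :: "'i \<Rightarrow> complex"
    define b where "b = (\<Sum>k\<in>S. r k * cnj (w k))"
    have "of_real (\<Sum>j\<in>S. (cmod (\<Sum>k\<in>S. r k * H k j))\<^sup>2) = (\<Sum>j\<in>S. (r j - of_real c * b * w j) * cnj (r j - of_real c * b * w j))"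
      unfolding of_real_sum b_def by (intro sum.cong refl) (simp only: rH complex_norm_square)
    also have "\<dots> = (\<Sum>j\<in>S. r j * cnj (r j) - of_real c * cnj b * (r j * cnj (w j)) - of_real c * b * cnj (r j * cnj (w j))
        + of_real c * of_real c * b * cnj b * (w j * cnj (w j)))"
      by (intro sum.cong refl) (simp add: algebra_simps)
    also have "\<dots> = (\<Sum>j\<in>S. r j * cnj (r j)) - of_real c * cnj b * b - of_real c * b * cnj b
        + of_real c * of_real c * b * cnj b * of_real W"
      unfolding b_def W_def of_real_sum complex_norm_square
      by (simp add: sum.distrib sum_subtractf sum_distrib_left cnj_sum)
    \<comment> \<open>The cross terms and the square of the correction cancel because
      \<open>c * W = 2\<close>.\<close>
    also have "\<dots> = (\<Sum>j\<in>S. r j * cnj (r j)) + of_real c * b * cnj b * (of_real (c * W) - 2)"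
      by (simp add: algebra_simps)
    also have "\<dots> = of_real (\<Sum>j\<in>S. (cmod (r j))\<^sup>2)"
      unfolding cW of_real_sum by (simp add: complex_norm_square del: of_real_power)
    finally show "(\<Sum>j\<in>S. (cmod (\<Sum>k\<in>S. r k * H k j))\<^sup>2) = (\<Sum>j\<in>S. (cmod (r j))\<^sup>2)"
      by (simp only: of_real_eq_iff)
  next
    fix j assume j: "j \<in> S" "j \<noteq> a"
    \<comment> \<open>The coefficient of \<open>w\<close> in the image of \<open>v\<close> is 1, so
      \<open>v\<close> goes to \<open>v - w\<close>, which by construction is supported at
      \<open>a\<close>.\<close>
    have "of_real c * (of_real (N + n * cmod (v a)) :: complex) = 1"
    proof -
      have "c * (N + n * cmod (v a)) = 1" using cW unfolding W mult.left_commute[of c 2] by linarith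
      then show ?thesis by (metis of_real_1 of_real_mult)
    qed
    then show "(\<Sum>k\<in>S. v k * H k j) = 0"
      unfolding rH[OF j(1)] b using j(2) by (simp add: w_def)
  qed
qed

text \<open>Induction on the index set: the reflection adapted to row \<open>a\<close> keeps the
  modulus of the determinant and the length of every row, and leaves only the diagonal entry in row
  \<open>a\<close>, so the determinant splits off that entry.\<close>

lemma hadamard_inequality:
  assumes "finite S"
  shows "(cmod (fdet S M))\<^sup>2 \<le> (\<Prod>i\<in>S. \<Sum>j\<in>S. (cmod (M i j))\<^sup>2)"
  using assms
proof (induction S arbitrary: M rule: finite_induct)
  case empty
  then show ?case by (simp add: fdet_def)
next
  case (insert a T)
  let ?S = "insert a T"
  have fin: "finite ?S" using insert by simp
  obtain H where H: "cmod (fdet ?S H) = 1"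
    "\<And>r. (\<Sum>j\<in>?S. (cmod (\<Sum>k\<in>?S. r k * H k j))\<^sup>2) = (\<Sum>j\<in>?S. (cmod (r j))\<^sup>2)"
    "\<And>j. j \<in> ?S \<Longrightarrow> j \<noteq> a \<Longrightarrow> (\<Sum>k\<in>?S. M a k * H k j) = 0"
    using householder[OF fin, of a "M a"] by blast
  define M' where "M' i j = (\<Sum>k\<in>?S. M i k * H k j)" for i j
  have "cmod (fdet ?S M) = cmod (fdet ?S M')"
    unfolding M'_def fdet_mult[OF fin] by (simp add: norm_mult H)
  also have "fdet ?S M' = M' a a * fdet (?S - {a}) M'"
    by (rule fdet_single_row[OF fin]) (use H(3) in \<open>auto simp: M'_def\<close>)
  also have "?S - {a} = T" using insert by auto
  finally have "(cmod (fdet ?S M))\<^sup>2 = (cmod (M' a a))\<^sup>2 * (cmod (fdet T M'))\<^sup>2"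
    by (simp add: norm_mult power_mult_distrib)
  also have "\<dots> \<le> (\<Sum>j\<in>?S. (cmod (M' a j))\<^sup>2) * (\<Prod>i\<in>T. \<Sum>j\<in>?S. (cmod (M' i j))\<^sup>2)"
  proof (rule mult_mono)
    show "(cmod (M' a a))\<^sup>2 \<le> (\<Sum>j\<in>?S. (cmod (M' a j))\<^sup>2)"
      by (rule member_le_sum) (use fin in auto)
    have "(cmod (fdet T M'))\<^sup>2 \<le> (\<Prod>i\<in>T. \<Sum>j\<in>T. (cmod (M' i j))\<^sup>2)" by (rule insert.IH)
    also have "\<dots> \<le> (\<Prod>i\<in>T. \<Sum>j\<in>?S. (cmod (M' i j))\<^sup>2)"
      by (intro prod_mono conjI sum_nonneg sum_mono2) (use fin in auto)
    finally show "(cmod (fdet T M'))\<^sup>2 \<le> (\<Prod>i\<in>T. \<Sum>j\<in>?S. (cmod (M' i j))\<^sup>2)" .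
  qed (auto intro: sum_nonneg)
  also have "\<dots> = (\<Prod>i\<in>?S. \<Sum>j\<in>?S. (cmod (M' i j))\<^sup>2)"
    using insert by simp
  finally show ?case unfolding M'_def H(2) .
qed

section \<open>Regularised determinants in terms of the Frobenius norm\<close>

definition frob :: "'i set \<Rightarrow> ('i \<Rightarrow> 'i \<Rightarrow> complex) \<Rightarrow> real" where
  "frob S A = L2_set (\<lambda>(i, j). cmod (A i j)) (S \<times> S)"

lemma frob_nonneg [simp]: "frob S A \<ge> 0"
  by (simp add: frob_def)

lemma frob_square: "(frob S A)\<^sup>2 = (\<Sum>i\<in>S. \<Sum>j\<in>S. (cmod (A i j))\<^sup>2)"
  unfolding frob_def L2_set_def by (simp add: sum_nonneg sum.cartesian_product case_prod_unfold)

lemma L2_set_cmod_add: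
  "L2_set (\<lambda>i. cmod (f i + g i)) S \<le> L2_set (\<lambda>i. cmod (f i)) S + L2_set (\<lambda>i. cmod (g i)) S"
  by (rule order_trans[OF L2_set_mono L2_set_triangle_ineq]) (auto intro: norm_triangle_ineq)

lemma L2_set_cmod_scale: "L2_set (\<lambda>i. cmod (c * f i)) S = cmod c * L2_set (\<lambda>i. cmod (f i)) S"
  by (simp add: norm_mult L2_set_right_distrib)

lemma frob_add: "frob S (\<lambda>i j. A i j + B i j) \<le> frob S A + frob S B"
  unfolding frob_def using L2_set_cmod_add[of "\<lambda>(i,j). A i j" "\<lambda>(i,j). B i j" "S \<times> S"]
  by (simp add: case_prod_unfold)

lemma frob_scale: "frob S (\<lambda>i j. c * A i j) = cmod c * frob S A"
  unfolding frob_def using L2_set_cmod_scale[of c "\<lambda>(i,j). A i j" "S \<times> S"]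
  by (simp add: case_prod_unfold)

lemma fdet2_cong:
  assumes "\<And>i j. i \<in> S \<Longrightarrow> j \<in> S \<Longrightarrow> A i j = B i j"
  shows "fdet2 S A = fdet2 S B"
proof -
  have "fdet S (\<lambda>i j. (if i = j then 1 else 0) + A i j) = fdet S (\<lambda>i j. (if i = j then 1 else 0) + B i j)"
    using assms by (intro fdet_cong) auto
  then show ?thesis unfolding fdet2_def using assms by simp
qed

text \<open>Row i of 1 + A has squared length 1 + 2 Re A_ii + (squared length of row i of A), which
  is at most the exponential of the part after 1. In the product over i the diagonal terms give exp
  (2 Re tr A), exactly what the regularising factor removes, so the bound does not depend on the
  size of \<open>S\<close>.\<close>

lemma carleman_inequality:
  assumes "finite S"
  shows "cmod (fdet2 S A) \<le> exp ((frob S A)\<^sup>2 / 2)"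
proof -
  let ?M = "\<lambda>i j. (if i = j then 1 else 0) + A i j"
  have row: "(\<Sum>j\<in>S. (cmod (?M i j))\<^sup>2) = 1 + (2 * Re (A i i) + (\<Sum>j\<in>S. (cmod (A i j))\<^sup>2))" if "i \<in> S" for i
  proof -
    have 1: "(cmod (1 + A i i))\<^sup>2 = 1 + 2 * Re (A i i) + (cmod (A i i))\<^sup>2"
      by (simp add: cmod_power2) (simp add: power2_eq_square algebra_simps)
    have 2: "(\<Sum>j\<in>S-{i}. (cmod (?M i j))\<^sup>2) = (\<Sum>j\<in>S-{i}. (cmod (A i j))\<^sup>2)"
      by (intro sum.cong) auto
    show ?thesis unfolding sum.remove[OF assms that] 2 using 1 by simp
  qed
  have "(cmod (fdet S ?M))\<^sup>2 \<le> (\<Prod>i\<in>S. \<Sum>j\<in>S. (cmod (?M i j))\<^sup>2)"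
    by (rule hadamard_inequality[OF assms])
  also have "\<dots> \<le> (\<Prod>i\<in>S. exp (2 * Re (A i i) + (\<Sum>j\<in>S. (cmod (A i j))\<^sup>2)))"
    by (intro prod_mono conjI sum_nonneg) (auto simp: row intro: exp_ge_add_one_self)
  also have "\<dots> = exp (2 * Re (\<Sum>i\<in>S. A i i) + (frob S A)\<^sup>2)"
    by (simp add: exp_sum[OF assms, symmetric] sum.distrib frob_square sum_distrib_left)
  finally have 1: "(cmod (fdet S ?M))\<^sup>2 \<le> exp (2 * Re (\<Sum>i\<in>S. A i i) + (frob S A)\<^sup>2)" .
  have "(cmod (fdet2 S A))\<^sup>2 = (cmod (fdet S ?M))\<^sup>2 * exp (- 2 * Re (\<Sum>i\<in>S. A i i))"
    by (simp add: fdet2_def norm_mult power_mult_distrib exp_double[symmetric] flip: exp_of_nat_mult)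
  also have "\<dots> \<le> exp (2 * Re (\<Sum>i\<in>S. A i i) + (frob S A)\<^sup>2) * exp (- 2 * Re (\<Sum>i\<in>S. A i i))"
    using 1 by (rule mult_right_mono) simp
  also have "\<dots> = (exp ((frob S A)\<^sup>2 / 2))\<^sup>2"
    by (simp add: exp_add[symmetric] exp_double[symmetric])
  finally show ?thesis by (rule power2_le_imp_le) simp
qed

text \<open>Along the complex line through \<open>B\<close> and \<open>A\<close> the determinant is
  an entire function. Cauchy's estimate on circles of radius \<open>1/d\<close> around points of
  [0,1] bounds its derivative by \<open>d\<close> times Carleman's bound, and the mean value
  inequality does the rest.\<close>

lemma fdet2_lipschitz:
  assumes "finite S"
  shows "cmod (fdet2 S A - fdet2 S B) \<le> frob S (\<lambda>i j. A i j - B i j) * exp ((frob S A + frob S B + 1)\<^sup>2)"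
proof -
  define d where "d = frob S (\<lambda>i j. A i j - B i j)"
  define K where "K = frob S A + frob S B + 1"
  define f where "f t = fdet2 S (\<lambda>i j. B i j + t * (A i j - B i j))" for t
  have f1: "f 1 = fdet2 S A" and f0: "f 0 = fdet2 S B" by (simp_all add: f_def)
  have hol: "f holomorphic_on UNIV"
    unfolding f_def fdet2_def fdet_def by (intro holomorphic_intros)
  have K: "K \<ge> 1" by (simp add: K_def)
  show ?thesis
  proof (cases "d = 0")
    case True
    then have "\<forall>i\<in>S. \<forall>j\<in>S. A i j - B i j = 0"
      using assms by (auto simp: d_def frob_def L2_set_eq_0_iff)
    then have "fdet2 S A = fdet2 S B" by (intro fdet2_cong) simp
    then show ?thesis by simp
  next
    case False
    then have d: "d > 0" unfolding d_def using frob_nonneg less_le by metis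
    have der: "cmod (deriv f t) \<le> d * exp (K\<^sup>2)" if t: "t \<in> closed_segment 0 1" for t
    proof -
      obtain u :: real where u: "0 \<le> u" "u \<le> 1" "t = of_real u"
        using t by (auto simp: in_segment scaleR_conv_of_real)
      have "cmod ((deriv ^^ 1) f t) \<le> fact 1 * exp (K\<^sup>2) / (1/d) ^ 1"
      proof (rule Cauchy_inequality)
        show "f holomorphic_on ball t (1/d)" "continuous_on (cball t (1/d)) f"
          using hol holomorphic_on_imp_continuous_on holomorphic_on_subset by blast+
        show "0 < 1/d" using d by simp
        fix z assume z: "cmod (t - z) = 1/d"
        \<comment> \<open>A point of the circle is a convex combination of \<open>A\<close> and
          \<open>B\<close> plus a perturbation of norm \<open>cmod (z - t) * d = 1\<close>; this is
          the summand 1 in \<open>K\<close>.\<close>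
        have "frob S (\<lambda>i j. B i j + z * (A i j - B i j))
          = frob S (\<lambda>i j. (of_real u * A i j + of_real (1-u) * B i j) + (z - t) * (A i j - B i j))"
          by (rule arg_cong[of _ _ "frob S"]) (auto simp: fun_eq_iff u algebra_simps)
        also have "\<dots> \<le> (u * frob S A + (1-u) * frob S B) + cmod (z - t) * d"
          unfolding d_def
          by (rule order_trans[OF frob_add add_mono[OF order_trans[OF frob_add add_mono]]])
             (unfold frob_scale norm_of_real, use u in auto)
        also have "\<dots> \<le> K"
        proof -
          have "cmod (z - t) * d = 1" using z d by (simp add: norm_minus_commute)
          moreover have "u * frob S A \<le> frob S A" "(1-u) * frob S B \<le> frob S B"
            using u by (auto intro: mult_left_le_one_le)
          ultimately show ?thesis by (simp add: K_def)
        qed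
        finally have "(frob S (\<lambda>i j. B i j + z * (A i j - B i j)))\<^sup>2 \<le> K\<^sup>2"
          by (intro power_mono) auto
        then have "(frob S (\<lambda>i j. B i j + z * (A i j - B i j)))\<^sup>2 / 2 \<le> K\<^sup>2"
          using zero_le_power2[of K] by linarith
        then show "cmod (f z) \<le> exp (K\<^sup>2)"
          unfolding f_def using carleman_inequality[OF assms] exp_le_cancel_iff order_trans by blast
      qed
      then show ?thesis by (simp add: mult.commute)
    qed
    have "cmod (f 1 - f 0) \<le> d * exp (K\<^sup>2) * cmod (1 - 0)"
    proof (rule field_differentiable_bound)
      show "convex (closed_segment 0 (1::complex))" by (rule convex_closed_segment)
      show "(f has_field_derivative deriv f z) (at z within closed_segment 0 1)" for z
        using holomorphic_derivI[OF hol open_UNIV UNIV_I] has_field_derivative_at_within by blast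
    qed (use der in auto)
    then show ?thesis unfolding f1 f0 d_def K_def by simp
  qed
qed

text \<open>If (1 + A) p = - x, then 1 + A - x \<phi> factors as (1 + A)(1 + p \<phi>). Asking for a
  solution \<open>p\<close> instead of an inverse keeps the formula valid when 1 + A is singular.
  The last exponential is the trace of the correction.\<close>

lemma fdet2_rank_one:
  assumes "finite S" "\<And>i. i \<in> S \<Longrightarrow> p i + (\<Sum>k\<in>S. A i k * p k) = - x i"
  shows "fdet2 S (\<lambda>i j. A i j - x i * \<phi> j)
      = fdet2 S A * (1 + (\<Sum>i\<in>S. \<phi> i * p i)) * exp (\<Sum>i\<in>S. \<phi> i * x i)"
proof -
  let ?I = "\<lambda>i j. if i = j then 1 else (0::complex)"
  have "fdet S (\<lambda>i j. ?I i j + (A i j - x i * \<phi> j))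
      = fdet S (\<lambda>i j. \<Sum>k\<in>S. (?I i k + A i k) * (?I k j + p k * \<phi> j))"
  proof (rule fdet_cong)
    fix i j assume ij: "i \<in> S" "j \<in> S"
    have "(\<Sum>k\<in>S. (?I i k + A i k) * (?I k j + p k * \<phi> j))
      = (\<Sum>k\<in>S. ?I i k * (?I k j + p k * \<phi> j)) + ((\<Sum>k\<in>S. A i k * ?I k j) + (\<Sum>k\<in>S. A i k * p k) * \<phi> j)"
      by (simp add: algebra_simps sum.distrib sum_distrib_left del: mult_if_delta)
    also have "\<dots> = ?I i j + p i * \<phi> j + (A i j + (\<Sum>k\<in>S. A i k * p k) * \<phi> j)"
      using ij assms(1) by (simp only: sum_delta_mult)
    also have "\<dots> = ?I i j + (A i j + (p i + (\<Sum>k\<in>S. A i k * p k)) * \<phi> j)"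
      by (simp add: algebra_simps)
    finally show "?I i j + (A i j - x i * \<phi> j) = (\<Sum>k\<in>S. (?I i k + A i k) * (?I k j + p k * \<phi> j))"
      unfolding assms(2)[OF ij(1)] by simp
  qed
  also have "\<dots> = fdet S (\<lambda>i j. ?I i j + A i j) * (1 + (\<Sum>i\<in>S. \<phi> i * p i))"
    by (simp only: fdet_mult[OF assms(1)] fdet_rank_one[OF assms(1)])
  finally show ?thesis
    unfolding fdet2_def by (simp add: sum_subtractf exp_diff exp_minus field_simps)
qed

text \<open>Carleman's inequality applied to the inverse: with 1 + B the inverse of 1 + A, the
  product of the two regularised determinants is explicit, so an upper bound for that of
  \<open>B\<close> is a lower bound for that of \<open>A\<close>.\<close>

lemma fdet2_lower_bound:
  assumes "finite S" "c > 0"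
    and low: "\<And>v. c * L2_set (\<lambda>i. cmod (v i)) S \<le> L2_set (\<lambda>i. cmod (v i + (\<Sum>j\<in>S. A i j * v j))) S"
  shows "exp (- ((frob S A)\<^sup>2 / c) - (frob S A)\<^sup>2 / (2 * c\<^sup>2)) \<le> cmod (fdet2 S A)"
proof -
  let ?I = "\<lambda>i j. if i = j then 1 else (0::complex)"
  let ?M = "\<lambda>i j. ?I i j + A i j"
  have Mv: "(\<Sum>j\<in>S. ?M i j * v j) = v i + (\<Sum>j\<in>S. A i j * v j)" if "i \<in> S" for v i
    using sum_delta_mult(1)[OF assms(1) that, of v] by (simp only: distrib_right sum.distrib)
  have "fdet S ?M \<noteq> 0"
  proof
    assume "fdet S ?M = 0"
    then obtain v where v: "\<exists>i\<in>S. v i \<noteq> 0" "\<forall>i\<in>S. (\<Sum>j\<in>S. ?M i j * v j) = 0"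
      unfolding fdet_eq_0_iff[OF assms(1)] by blast
    have "L2_set (\<lambda>i. cmod (v i + (\<Sum>j\<in>S. A i j * v j))) S = 0"
      using v(2) Mv assms(1) by (simp add: L2_set_eq_0_iff)
    then have "L2_set (\<lambda>i. cmod (v i)) S \<le> 0" using low[of v] assms(2) by (simp add: mult_le_0_iff)
    then have "L2_set (\<lambda>i. cmod (v i)) S = 0" using L2_set_nonneg order_antisym by metis
    then show False using v(1) assms(1) by (auto simp: L2_set_eq_0_iff)
  qed
  then obtain N where N: "\<And>i j. i \<in> S \<Longrightarrow> j \<in> S \<Longrightarrow> (\<Sum>k\<in>S. ?M i k * N k j) = ?I i j"
    using fdet_nonzero_inverse[OF assms(1)] by blast
  define B where "B i j = N i j - ?I i j" for i j
  have AB: "A i j + B i j + (\<Sum>k\<in>S. A i k * B k j) = 0" if "i \<in> S" "j \<in> S" for i j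
  proof -
    have 1: "N i j + (\<Sum>k\<in>S. A i k * N k j) = ?I i j" using N[OF that] Mv[OF that(1), of "\<lambda>k. N k j"] by simp
    have 2: "(\<Sum>k\<in>S. A i k * B k j) = (\<Sum>k\<in>S. A i k * N k j) - A i j"
      unfolding B_def right_diff_distrib sum_subtractf sum_delta_mult(2)[OF assms(1) that(2)] ..
    have "A i j + B i j + (\<Sum>k\<in>S. A i k * B k j) = (N i j + (\<Sum>k\<in>S. A i k * N k j)) - ?I i j"
      unfolding 2 B_def[of i j] by simp
    then show ?thesis unfolding 1 by simp
  qed
  \<comment> \<open>A + B + A B = 0 makes the ordinary determinants cancel and turns - tr A - tr B
    into tr (A B).\<close>
  have prod: "fdet2 S A * fdet2 S B = exp (\<Sum>i\<in>S. \<Sum>k\<in>S. A i k * B k i)"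
  proof -
    have "fdet S ?M * fdet S (\<lambda>i j. ?I i j + B i j) = fdet S (\<lambda>i j. \<Sum>k\<in>S. ?M i k * (?I k j + B k j))"
      by (rule fdet_mult[OF assms(1), symmetric])
    also have "\<dots> = fdet S ?I" using N by (intro fdet_cong) (simp add: B_def)
    finally have "fdet S ?M * fdet S (\<lambda>i j. ?I i j + B i j) = 1" using assms(1) by (simp add: fdet_one)
    moreover have "fdet2 S A * fdet2 S B = (fdet S ?M * fdet S (\<lambda>i j. ?I i j + B i j))
        * exp (- (\<Sum>i\<in>S. A i i) - (\<Sum>i\<in>S. B i i))"
      by (simp add: fdet2_def exp_diff exp_minus divide_inverse)
    moreover have "(\<Sum>i\<in>S. \<Sum>k\<in>S. A i k * B k i) = - (\<Sum>i\<in>S. A i i) - (\<Sum>i\<in>S. B i i)"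
      unfolding sum_negf[symmetric] sum_subtractf[symmetric]
      by (intro sum.cong refl) (use AB in \<open>simp add: algebra_simps eq_neg_iff_add_eq_0\<close>)
    ultimately show ?thesis by (simp only: mult_1_left)
  qed
  \<comment> \<open>Column by column (1 + A) B = - A, so coercivity with constant \<open>c\<close>
    bounds each column of \<open>B\<close> by the corresponding column of \<open>A\<close> divided
    by \<open>c\<close>.\<close>
  have colB: "c\<^sup>2 * (\<Sum>i\<in>S. (cmod (B i j))\<^sup>2) \<le> (\<Sum>i\<in>S. (cmod (A i j))\<^sup>2)" if "j \<in> S" for j
  proof -
    have "L2_set (\<lambda>i. cmod (B i j + (\<Sum>k\<in>S. A i k * B k j))) S = L2_set (\<lambda>i. cmod (A i j)) S"
    proof (intro L2_set_cong refl)
      fix i assume "i \<in> S"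
      then have "B i j + (\<Sum>k\<in>S. A i k * B k j) = - A i j" using AB[OF _ that] by (simp add: eq_neg_iff_add_eq_0 algebra_simps)
      then show "cmod (B i j + (\<Sum>k\<in>S. A i k * B k j)) = cmod (A i j)" by simp
    qed
    then have "c * L2_set (\<lambda>i. cmod (B i j)) S \<le> L2_set (\<lambda>i. cmod (A i j)) S"
      using low[of "\<lambda>i. B i j"] by simp
    then have "(c * L2_set (\<lambda>i. cmod (B i j)) S)\<^sup>2 \<le> (L2_set (\<lambda>i. cmod (A i j)) S)\<^sup>2"
      using assms(2) by (intro power_mono) (auto intro: mult_nonneg_nonneg)
    then show ?thesis by (simp add: L2_set_def power_mult_distrib sum_nonneg)
  qed
  have "c\<^sup>2 * (\<Sum>j\<in>S. \<Sum>i\<in>S. (cmod (B i j))\<^sup>2) = (\<Sum>j\<in>S. c\<^sup>2 * (\<Sum>i\<in>S. (cmod (B i j))\<^sup>2))"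
    by (rule sum_distrib_left)
  also have "\<dots> \<le> (\<Sum>j\<in>S. \<Sum>i\<in>S. (cmod (A i j))\<^sup>2)"
    using colB by (intro sum_mono) auto
  finally have B2: "c\<^sup>2 * (frob S B)\<^sup>2 \<le> (frob S A)\<^sup>2"
    unfolding frob_square by (subst (1 2) sum.swap)
  then have "(c * frob S B)\<^sup>2 \<le> (frob S A)\<^sup>2" by (simp add: power_mult_distrib)
  then have B1: "c * frob S B \<le> frob S A" by (rule power2_le_imp_le) simp
  have tr: "cmod (\<Sum>i\<in>S. \<Sum>k\<in>S. A i k * B k i) \<le> (frob S A)\<^sup>2 / c"
  proof -
    have "cmod (\<Sum>i\<in>S. \<Sum>k\<in>S. A i k * B k i) \<le> (\<Sum>(i,k)\<in>S\<times>S. \<bar>cmod (A i k)\<bar> * \<bar>cmod (B k i)\<bar>)"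
      unfolding sum.cartesian_product
      by (rule order_trans[OF norm_sum]) (auto simp: norm_mult case_prod_unfold)
    also have "\<dots> \<le> L2_set (\<lambda>(i,k). cmod (A i k)) (S\<times>S) * L2_set (\<lambda>(i,k). cmod (B k i)) (S\<times>S)"
      using L2_set_mult_ineq[of "\<lambda>(i,k). cmod (A i k)" "\<lambda>(i,k). cmod (B k i)" "S\<times>S"]
      by (simp add: case_prod_unfold)
    also have "L2_set (\<lambda>(i,k). cmod (B k i)) (S\<times>S) = frob S B"
      unfolding frob_def L2_set_def
      by (intro arg_cong[of _ _ sqrt] sum.reindex_bij_witness[of _ prod.swap prod.swap]) auto
    also have "L2_set (\<lambda>(i,k). cmod (A i k)) (S\<times>S) = frob S A" by (simp add: frob_def)
    also have "frob S A * frob S B \<le> frob S A * (frob S A / c)"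
      using B1 assms(2) by (intro mult_left_mono) (auto simp: field_simps)
    finally show ?thesis by (simp add: power2_eq_square)
  qed
  have "exp (- ((frob S A)\<^sup>2 / c)) \<le> exp (Re (\<Sum>i\<in>S. \<Sum>k\<in>S. A i k * B k i))"
    using tr abs_Re_le_cmod[of "\<Sum>i\<in>S. \<Sum>k\<in>S. A i k * B k i"] by simp
  also have "\<dots> = cmod (fdet2 S A) * cmod (fdet2 S B)"
    by (simp only: norm_mult[symmetric] prod norm_exp_eq_Re)
  also have "\<dots> \<le> cmod (fdet2 S A) * exp ((frob S B)\<^sup>2 / 2)"
    by (intro mult_left_mono carleman_inequality assms) simp
  also have "\<dots> \<le> cmod (fdet2 S A) * exp ((frob S A)\<^sup>2 / (2 * c\<^sup>2))"
    using B2 assms(2) by (intro mult_left_mono) (auto simp: field_simps)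
  finally show ?thesis by (simp add: exp_diff divide_le_eq)
qed

section \<open>Square summable families\<close>

definition l2 :: "('i \<Rightarrow> complex) \<Rightarrow> bool" where
  "l2 u \<longleftrightarrow> (\<lambda>i. (cmod (u i))\<^sup>2) summable_on UNIV"

definition nrm :: "('i \<Rightarrow> complex) \<Rightarrow> real" where
  "nrm u = sqrt (\<Sum>\<^sub>\<infinity>i. (cmod (u i))\<^sup>2)"

text \<open>Bilinear, without conjugation, so that it serves both as the action of a matrix row on a
  vector and as the pairing with a functional.\<close>

definition dot :: "('i \<Rightarrow> complex) \<Rightarrow> ('i \<Rightarrow> complex) \<Rightarrow> complex" where
  "dot \<phi> u = (\<Sum>\<^sub>\<infinity>i. \<phi> i * u i)"

definition app :: "('i \<Rightarrow> 'i \<Rightarrow> complex) \<Rightarrow> ('i \<Rightarrow> complex) \<Rightarrow> 'i \<Rightarrow> complex" where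
  "app A u = (\<lambda>i. dot (A i) u)"

text \<open>A Hilbert--Schmidt matrix is treated as a square summable family over index pairs, so
  that facts about vectors and their tails carry over to matrices.\<close>

abbreviation hs :: "('i \<Rightarrow> 'i \<Rightarrow> complex) \<Rightarrow> bool" where
  "hs A \<equiv> l2 (\<lambda>(i, j). A i j)"

abbreviation hsn :: "('i \<Rightarrow> 'i \<Rightarrow> complex) \<Rightarrow> real" where
  "hsn A \<equiv> nrm (\<lambda>(i, j). A i j)"

lemma nrm_nonneg [simp]: "nrm u \<ge> 0"
  by (simp add: nrm_def infsum_nonneg)

lemma nrm_square: "(nrm u)\<^sup>2 = (\<Sum>\<^sub>\<infinity>i. (cmod (u i))\<^sup>2)"
  by (simp add: nrm_def infsum_nonneg)

lemma L2_set_le_nrm: "l2 u \<Longrightarrow> finite F \<Longrightarrow> L2_set (\<lambda>i. cmod (u i)) F \<le> nrm u"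
  unfolding l2_def nrm_def L2_set_def by (intro real_sqrt_le_mono finite_sum_le_infsum) auto

text \<open>The passage from finite to infinite: a bound that is uniform over finite index sets
  yields membership and the norm bound together, which reduces most estimates below to
  \<open>L2_set\<close>.\<close>

lemma l2_bounded:
  assumes "\<And>F. finite F \<Longrightarrow> L2_set (\<lambda>i. cmod (u i)) F \<le> C"
  shows "l2 u" "nrm u \<le> C"
proof -
  have C: "C \<ge> 0" using assms[of "{}"] by simp
  have b: "(\<Sum>i\<in>F. (cmod (u i))\<^sup>2) \<le> C\<^sup>2" if "finite F" for F
    using power_mono[OF assms[OF that] L2_set_nonneg, of 2] by (simp add: L2_set_def sum_nonneg)
  show l: "l2 u" unfolding l2_def
    by (rule nonneg_bdd_above_summable_on) (use b in \<open>auto intro!: bdd_aboveI2[where M = "C\<^sup>2"]\<close>)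
  have "(nrm u)\<^sup>2 \<le> C\<^sup>2"
    unfolding nrm_square by (rule infsum_le_finite_sums) (use l b in \<open>auto simp: l2_def\<close>)
  then show "nrm u \<le> C" using C by (rule power2_le_imp_le)
qed

lemma l2_comparison:
  assumes "l2 u" "\<And>i. cmod (v i) \<le> cmod (u i)"
  shows "l2 v" "nrm v \<le> nrm u"
proof -
  have "L2_set (\<lambda>i. cmod (v i)) F \<le> nrm u" if "finite F" for F
    by (rule order_trans[OF L2_set_mono L2_set_le_nrm[OF assms(1) that]]) (use assms in auto)
  then show "l2 v" "nrm v \<le> nrm u" using l2_bounded[of v "nrm u"] by auto
qed

lemma l2_add_aux:
  assumes "l2 u" "l2 v"
  shows "l2 (\<lambda>i. u i + v i)" "nrm (\<lambda>i. u i + v i) \<le> nrm u + nrm v"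
proof -
  have "L2_set (\<lambda>i. cmod (u i + v i)) F \<le> nrm u + nrm v" if "finite F" for F
    by (rule order_trans[OF L2_set_cmod_add add_mono]) (use assms that in \<open>auto intro: L2_set_le_nrm\<close>)
  then show "l2 (\<lambda>i. u i + v i)" "nrm (\<lambda>i. u i + v i) \<le> nrm u + nrm v"
    using l2_bounded[of "\<lambda>i. u i + v i" "nrm u + nrm v"] by auto
qed

lemmas l2_add = l2_add_aux(1) and nrm_add = l2_add_aux(2)

lemma l2_scale: "l2 u \<Longrightarrow> l2 (\<lambda>i. c * u i)"
  unfolding l2_def by (simp add: norm_mult power_mult_distrib summable_on_cmult_right)

lemma nrm_scale: "nrm (\<lambda>i. c * u i) = cmod c * nrm u"
  by (simp add: nrm_def norm_mult power_mult_distrib infsum_cmult_right' real_sqrt_mult)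

lemma l2_minus: "l2 u \<Longrightarrow> l2 (\<lambda>i. - u i)"
  by (simp add: l2_def)

lemma l2_diff: "l2 u \<Longrightarrow> l2 v \<Longrightarrow> l2 (\<lambda>i. u i - v i)"
  using l2_add[of u "\<lambda>i. - v i"] l2_minus[of v] by simp

lemma l2_finite_support:
  assumes "finite {i. u i \<noteq> 0}"
  shows "l2 u"
proof -
  have "(\<lambda>i. (cmod (u i))\<^sup>2) summable_on {i. u i \<noteq> 0}" using assms by simp
  then show ?thesis unfolding l2_def by (subst summable_on_cong_neutral[where T = "{i. u i \<noteq> 0}" and g = "\<lambda>i. (cmod (u i))\<^sup>2"]) auto
qed

lemma l2_zero [simp]: "l2 (\<lambda>i. 0)"
  by (simp add: l2_def)

lemma l2_sum: "(\<And>k. k \<in> K \<Longrightarrow> l2 (u k)) \<Longrightarrow> l2 (\<lambda>i. \<Sum>k\<in>K. u k i)"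
  by (induction K rule: infinite_finite_induct) (simp_all add: l2_add)

lemma nrm_eq_0: "l2 u \<Longrightarrow> nrm u = 0 \<longleftrightarrow> (\<forall>i. u i = 0)"
  unfolding nrm_def l2_def
  by (metis (mono_tags, lifting) UNIV_I infsum_0 nonneg_infsum_le_0D norm_eq_zero order_refl
      power_eq_0_iff real_sqrt_eq_zero_cancel_iff zero_eq_power2 zero_le_power2)

lemma l2_mult_abs:
  assumes "l2 u" "l2 v"
  shows "(\<lambda>i. cmod (u i * v i)) summable_on UNIV" "(\<Sum>\<^sub>\<infinity>i. cmod (u i * v i)) \<le> nrm u * nrm v"
proof -
  have b: "(\<Sum>i\<in>F. cmod (u i * v i)) \<le> nrm u * nrm v" if "finite F" for F
  proof -
    have "(\<Sum>i\<in>F. cmod (u i * v i)) \<le> L2_set (\<lambda>i. cmod (u i)) F * L2_set (\<lambda>i. cmod (v i)) F"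
      using L2_set_mult_ineq[of "\<lambda>i. cmod (u i)" "\<lambda>i. cmod (v i)" F] by (simp add: norm_mult)
    also have "\<dots> \<le> nrm u * nrm v"
      by (intro mult_mono L2_set_le_nrm assms that) auto
    finally show ?thesis .
  qed
  show s: "(\<lambda>i. cmod (u i * v i)) summable_on UNIV"
    by (rule nonneg_bdd_above_summable_on) (use b in \<open>auto intro!: bdd_aboveI2\<close>)
  show "(\<Sum>\<^sub>\<infinity>i. cmod (u i * v i)) \<le> nrm u * nrm v"
    by (rule infsum_le_finite_sums) (use s b in auto)
qed

lemma l2_mult_summable: "l2 u \<Longrightarrow> l2 v \<Longrightarrow> (\<lambda>i. u i * v i) summable_on UNIV"
  by (rule abs_summable_summable) (rule l2_mult_abs(1))

lemma cmod_dot_le: "l2 u \<Longrightarrow> l2 v \<Longrightarrow> cmod (dot u v) \<le> nrm u * nrm v"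
  unfolding dot_def using l2_mult_abs[of u v] norm_infsum_bound[of "\<lambda>i. u i * v i" UNIV] by linarith

lemma dot_add: "l2 \<phi> \<Longrightarrow> l2 u \<Longrightarrow> l2 v \<Longrightarrow> dot \<phi> (\<lambda>i. u i + v i) = dot \<phi> u + dot \<phi> v"
  unfolding dot_def by (simp add: distrib_left infsum_add l2_mult_summable)

lemma dot_scale: "dot \<phi> (\<lambda>i. c * u i) = c * dot \<phi> u"
  unfolding dot_def by (simp add: mult.left_commute[of _ c] infsum_cmult_right')

lemma dot_commute: "dot u v = dot v u"
  by (simp add: dot_def mult.commute)

lemma dot_minus: "dot \<phi> (\<lambda>i. - u i) = - dot \<phi> u"
  using dot_scale[of \<phi> "-1" u] by simp

lemma dot_diff: "l2 \<phi> \<Longrightarrow> l2 u \<Longrightarrow> l2 v \<Longrightarrow> dot \<phi> (\<lambda>i. u i - v i) = dot \<phi> u - dot \<phi> v"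
  using dot_add[of \<phi> u "\<lambda>i. - v i"] l2_minus[of v] by (simp add: dot_minus)

lemma dot_zero [simp]: "dot \<phi> (\<lambda>i. 0) = 0"
  by (simp add: dot_def)

lemma dot_sum:
  "l2 \<phi> \<Longrightarrow> (\<And>k. k \<in> K \<Longrightarrow> l2 (u k)) \<Longrightarrow> dot \<phi> (\<lambda>i. \<Sum>k\<in>K. u k i) = (\<Sum>k\<in>K. dot \<phi> (u k))"
  by (induction K rule: infinite_finite_induct) (simp_all add: dot_add l2_sum)

lemma dot_finite_support:
  assumes "finite F" "\<And>i. i \<notin> F \<Longrightarrow> u i = 0 \<or> v i = 0"
  shows "dot u v = (\<Sum>i\<in>F. u i * v i)"
proof -
  have "dot u v = (\<Sum>\<^sub>\<infinity>i\<in>F. u i * v i)"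
    unfolding dot_def by (rule infsum_cong_neutral) (use assms(2) in auto)
  then show ?thesis using assms(1) by simp
qed

lemma dot_delta: "dot (\<lambda>i. if i = a then c else 0) u = c * u a"
  by (subst dot_finite_support[of "{a}"]) auto

lemma hs_row: "hs A \<Longrightarrow> l2 (A i)"
proof -
  assume "hs A"
  then have "(\<lambda>p. (cmod (case p of (i, j) \<Rightarrow> A i j))\<^sup>2) summable_on (Pair i ` UNIV)"
    unfolding l2_def by (rule summable_on_subset) auto
  then show ?thesis unfolding l2_def by (subst (asm) summable_on_reindex) (auto simp: inj_on_def o_def)
qed

lemma sum_row_nrm:
  assumes "hs A" "finite F"
  shows "(\<Sum>i\<in>F. (nrm (A i))\<^sup>2) \<le> (hsn A)\<^sup>2"
proof -
  have s: "(\<lambda>(i,j). (cmod (A i j))\<^sup>2) summable_on UNIV" using assms(1) by (simp add: l2_def case_prod_unfold)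
  have "(\<Sum>i\<in>F. (nrm (A i))\<^sup>2) = (\<Sum>\<^sub>\<infinity>i\<in>F. \<Sum>\<^sub>\<infinity>j. (cmod (A i j))\<^sup>2)"
    using assms(2) by (simp add: nrm_square)
  also have "\<dots> = (\<Sum>\<^sub>\<infinity>(i,j)\<in>F \<times> UNIV. (cmod (A i j))\<^sup>2)"
    by (rule infsum_Sigma'_banach) (rule summable_on_subset[OF s], simp)
  also have "\<dots> \<le> (\<Sum>\<^sub>\<infinity>(i,j). (cmod (A i j))\<^sup>2)"
    by (rule infsum_mono2) (use s summable_on_subset[OF s] in auto)
  finally show ?thesis by (simp add: nrm_square case_prod_unfold)
qed

text \<open>Cauchy--Schwarz in each row; the squared row norms add up to at most the squared
  Hilbert--Schmidt norm, which thus dominates the operator norm.\<close>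

lemma l2_app_aux:
  assumes "hs A" "l2 u"
  shows "l2 (app A u)" "nrm (app A u) \<le> hsn A * nrm u"
proof -
  have "L2_set (\<lambda>i. cmod (app A u i)) F \<le> hsn A * nrm u" if "finite F" for F
  proof -
    have "L2_set (\<lambda>i. cmod (app A u i)) F \<le> L2_set (\<lambda>i. nrm (A i) * nrm u) F"
      unfolding app_def by (intro L2_set_mono cmod_dot_le hs_row[OF assms(1)] assms(2)) simp_all
    also have "\<dots> = L2_set (\<lambda>i. nrm (A i)) F * nrm u" by (simp add: L2_set_left_distrib)
    also have "L2_set (\<lambda>i. nrm (A i)) F \<le> sqrt ((hsn A)\<^sup>2)"
      unfolding L2_set_def by (intro real_sqrt_le_mono sum_row_nrm assms that)
    finally show ?thesis by (simp add: mult_right_mono)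
  qed
  then show "l2 (app A u)" "nrm (app A u) \<le> hsn A * nrm u"
    using l2_bounded[of "app A u"] by auto
qed

lemmas l2_app = l2_app_aux(1) and nrm_app = l2_app_aux(2)

lemma app_lin:
  assumes "hs A" "l2 u" "l2 v"
  shows "app A (\<lambda>i. u i + v i) i = app A u i + app A v i"
  unfolding app_def by (rule dot_add[OF hs_row[OF assms(1)] assms(2,3)])

lemma app_diff:
  assumes "hs A" "l2 u" "l2 v"
  shows "app A (\<lambda>i. u i - v i) i = app A u i - app A v i"
  unfolding app_def by (rule dot_diff[OF hs_row[OF assms(1)] assms(2,3)])

lemma app_scale: "app A (\<lambda>i. c * u i) i = c * app A u i"
  unfolding app_def by (rule dot_scale)

lemma app_sum:
  "hs A \<Longrightarrow> (\<And>k. k \<in> K \<Longrightarrow> l2 (u k)) \<Longrightarrow> app A (\<lambda>i. \<Sum>k\<in>K. u k i) i = (\<Sum>k\<in>K. app A (u k) i)"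
  unfolding app_def by (rule dot_sum[OF hs_row])

lemma app_add_op:
  assumes "hs A" "hs B" "l2 u"
  shows "app (\<lambda>i j. A i j + B i j) u i = app A u i + app B u i"
  using dot_add[of u "A i" "B i"] assms hs_row[OF assms(1)] hs_row[OF assms(2)] by (simp add: app_def dot_commute[of _ u])

lemma app_diag: "app (\<lambda>i j. if i = j then g i else 0) u i = g i * u i"
  using dot_delta[of i "g i" u] by (simp add: app_def eq_commute)

lemma hs_diag:
  assumes "l2 g"
  shows "hs (\<lambda>i j. if i = j then g i else 0)"
proof -
  have "(\<lambda>p. (cmod (case p of (i, j) \<Rightarrow> if i = j then g i else 0))\<^sup>2) summable_on (range (\<lambda>i. (i,i)))"
    using assms unfolding l2_def by (subst summable_on_reindex) (auto simp: inj_on_def o_def)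
  then show ?thesis unfolding l2_def by (subst summable_on_cong_neutral[where T = "range (\<lambda>i. (i,i))"]) auto
qed

lemma hs_bounded:
  assumes "\<And>F. finite F \<Longrightarrow> frob F A \<le> C"
  shows "hs A" "hsn A \<le> C"
proof -
  have "L2_set (\<lambda>p. cmod (case p of (i, j) \<Rightarrow> A i j)) F \<le> C" if F: "finite F" for F
  proof -
    \<comment> \<open>A finite set of pairs need not be a square; it is enlarged to the square over
      all indices that occur in it.\<close>
    let ?G = "fst ` F \<union> snd ` F"
    have "L2_set (\<lambda>p. cmod (case p of (i, j) \<Rightarrow> A i j)) F \<le> L2_set (\<lambda>p. cmod (case p of (i, j) \<Rightarrow> A i j)) (?G \<times> ?G)"
      unfolding L2_set_def using F by (intro real_sqrt_le_mono sum_mono2) (auto simp: image_iff, force+)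
    also have "\<dots> = frob ?G A" by (simp add: frob_def case_prod_unfold)
    also have "\<dots> \<le> C" using F by (intro assms) simp
    finally show ?thesis .
  qed
  then show "hs A" "hsn A \<le> C" using l2_bounded[of "\<lambda>(i,j). A i j" C] by auto
qed

lemma frob_le_hsn: "hs A \<Longrightarrow> finite F \<Longrightarrow> frob F A \<le> hsn A"
  using L2_set_le_nrm[of "\<lambda>(i,j). A i j" "F \<times> F"] by (simp add: frob_def case_prod_unfold)

lemma frob_outer: "frob F (\<lambda>i j. x i * \<phi> j) = L2_set (\<lambda>i. cmod (x i)) F * L2_set (\<lambda>i. cmod (\<phi> i)) F"
proof -
  have "(frob F (\<lambda>i j. x i * \<phi> j))\<^sup>2 = (L2_set (\<lambda>i. cmod (x i)) F * L2_set (\<lambda>i. cmod (\<phi> i)) F)\<^sup>2"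
    unfolding frob_square L2_set_def
    by (simp add: norm_mult power_mult_distrib sum_nonneg sum_product)
  then show ?thesis by (rule power2_eq_imp_eq) (auto intro: mult_nonneg_nonneg)
qed

lemma hs_outer:
  assumes "l2 x" "l2 \<phi>"
  shows "hs (\<lambda>i j. x i * \<phi> j)"
proof (rule hs_bounded(1)[of _ "nrm x * nrm \<phi>"])
  fix F :: "'a set" assume "finite F"
  then show "frob F (\<lambda>i j. x i * \<phi> j) \<le> nrm x * nrm \<phi>"
    unfolding frob_outer by (intro mult_mono L2_set_le_nrm assms) auto
qed

lemma hs_add: "hs A \<Longrightarrow> hs B \<Longrightarrow> hs (\<lambda>i j. A i j + B i j)"
  using l2_add[of "\<lambda>(i,j). A i j" "\<lambda>(i,j). B i j"] by (simp add: case_prod_unfold)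

lemma hs_scale: "hs A \<Longrightarrow> hs (\<lambda>i j. c * A i j)"
  using l2_scale[of "\<lambda>(i,j). A i j" c] by (simp add: case_prod_unfold)

lemma hs_minus: "hs A \<Longrightarrow> hs (\<lambda>i j. - A i j)"
  using hs_scale[of A "-1"] by simp

lemma hs_diff: "hs A \<Longrightarrow> hs B \<Longrightarrow> hs (\<lambda>i j. A i j - B i j)"
  using hs_add[of A "\<lambda>i j. - B i j"] hs_minus[of B] by simp

lemma hs_sum: "(\<And>k. k \<in> K \<Longrightarrow> hs (A k)) \<Longrightarrow> hs (\<lambda>i j. \<Sum>k\<in>K. A k i j)"
  using l2_sum[of K "\<lambda>k (i,j). A k i j"] by (simp add: case_prod_unfold)

lemma hsn_add: "hs A \<Longrightarrow> hs B \<Longrightarrow> hsn (\<lambda>i j. A i j + B i j) \<le> hsn A + hsn B"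
  using nrm_add[of "\<lambda>(i,j). A i j" "\<lambda>(i,j). B i j"] by (simp add: case_prod_unfold)

lemma hsn_scale: "hsn (\<lambda>i j. c * A i j) = cmod c * hsn A"
  using nrm_scale[of c "\<lambda>(i,j). A i j"] by (simp add: case_prod_unfold)

section \<open>The regularised determinant of a Hilbert--Schmidt matrix\<close>

text \<open>A vanishing row contributes the factor 1 to the determinant and 0 to the trace. A
  truncated matrix therefore has the same regularised determinant over every larger section.\<close>

lemma fdet2_extend:
  assumes "finite S" "T \<subseteq> S" "\<And>i j. i \<in> S - T \<Longrightarrow> j \<in> S \<Longrightarrow> A i j = 0"
  shows "fdet2 S A = fdet2 T A"
proof -
  have "fdet2 (T \<union> R) A = fdet2 T A" if "finite R" "R \<subseteq> S - T" for R
    using that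
  proof (induction R rule: finite_induct)
    case (insert a R)
    let ?U = "T \<union> insert a R"
    have fin: "finite ?U" using assms(1,2) insert by (auto intro: finite_subset)
    have a: "a \<in> S - T" "a \<notin> T \<union> R" using insert by auto
    have eq: "?U - {a} = T \<union> R" using a by auto
    have z: "A a j = 0" if "j \<in> ?U" for j using that a insert assms(2,3) by blast
    have "fdet ?U (\<lambda>i j. (if i = j then 1 else 0) + A i j)
        = (1 + A a a) * fdet (T \<union> R) (\<lambda>i j. (if i = j then 1 else 0) + A i j)"
      using fdet_single_row[OF fin, of a "\<lambda>i j. (if i = j then 1 else 0) + A i j"] z unfolding eq by auto
    moreover have "(\<Sum>i\<in>?U. A i i) = A a a + (\<Sum>i\<in>T \<union> R. A i i)"
      using sum.remove[OF fin, of a "\<lambda>i. A i i"] unfolding eq by auto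
    moreover have "A a a = 0" using z by simp
    ultimately have "fdet2 ?U A = fdet2 (T \<union> R) A" by (simp add: fdet2_def)
    then show ?case using insert by simp
  qed simp
  from this[of "S - T"] show ?thesis using assms(1,2) by (simp add: Un_absorb1)
qed

text \<open>Kept abstract because it is used twice: for the index set itself and, with the squares
  \<open>S n \<times> S n\<close>, for index pairs, where vector tails become tails of
  matrices.\<close>

locale exhaustion =
  fixes S :: "nat \<Rightarrow> 'i set"
  assumes fin: "finite (S n)"
    and mono: "m \<le> n \<Longrightarrow> S m \<subseteq> S n"
    and cover: "\<exists>n. i \<in> S n"
begin

lemma eventually_subset:
  assumes "finite F"
  shows "eventually (\<lambda>n. F \<subseteq> S n) sequentially"
proof -
  have "eventually (\<lambda>n. i \<in> S n) sequentially" for i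
    using cover[of i] mono by (force simp: eventually_sequentially)
  then have "eventually (\<lambda>n. \<forall>i\<in>F. i \<in> S n) sequentially"
    using assms by (intro eventually_ball_finite) auto
  then show ?thesis by eventually_elim auto
qed

lemma filterlim_exhaustion: "filterlim S (finite_subsets_at_top UNIV) sequentially"
  unfolding filterlim_finite_subsets_at_top using eventually_subset fin
  by (auto elim: eventually_mono)

lemma infsum_lim: "f summable_on UNIV \<Longrightarrow> (\<lambda>n. \<Sum>i\<in>S n. f i) \<longlonglongrightarrow> (\<Sum>\<^sub>\<infinity>i. f i)"
  by (rule filterlim_compose[OF infsum_tendsto filterlim_exhaustion])

lemma dot_lim: "l2 u \<Longrightarrow> l2 v \<Longrightarrow> (\<lambda>n. \<Sum>i\<in>S n. u i * v i) \<longlonglongrightarrow> dot u v"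
  unfolding dot_def by (intro infsum_lim l2_mult_summable)

definition tail :: "nat \<Rightarrow> ('i \<Rightarrow> complex) \<Rightarrow> 'i \<Rightarrow> complex" where
  "tail n u = (\<lambda>i. if i \<in> S n then 0 else u i)"

lemma l2_tail: "l2 u \<Longrightarrow> l2 (tail n u)"
  by (rule l2_comparison(1)) (auto simp: tail_def)

lemma nrm_tail_lim:
  assumes "l2 u"
  shows "(\<lambda>n. nrm (tail n u)) \<longlonglongrightarrow> 0"
proof -
  let ?f = "\<lambda>i. (cmod (u i))\<^sup>2"
  have s: "?f summable_on A" for A
    using assms unfolding l2_def by (rule summable_on_subset_banach) auto
  have "(nrm (tail n u))\<^sup>2 = (\<Sum>\<^sub>\<infinity>i. ?f i) - (\<Sum>i\<in>S n. ?f i)" for n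
  proof -
    have "(nrm (tail n u))\<^sup>2 = infsum ?f (UNIV - S n)"
      unfolding nrm_square by (rule infsum_cong_neutral) (auto simp: tail_def)
    also have "\<dots> = infsum ?f UNIV - infsum ?f (S n)" by (rule infsum_Diff) (use s in auto)
    finally show ?thesis using fin by simp
  qed
  moreover have "(\<lambda>n. (\<Sum>\<^sub>\<infinity>i. ?f i) - (\<Sum>i\<in>S n. ?f i)) \<longlonglongrightarrow> (\<Sum>\<^sub>\<infinity>i. ?f i) - (\<Sum>\<^sub>\<infinity>i. ?f i)"
    by (intro tendsto_intros infsum_lim s)
  ultimately have "(\<lambda>n. (nrm (tail n u))\<^sup>2) \<longlonglongrightarrow> 0" by simp
  then have "(\<lambda>n. sqrt ((nrm (tail n u))\<^sup>2)) \<longlonglongrightarrow> sqrt 0" by (rule tendsto_real_sqrt)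
  then show ?thesis by simp
qed

lemma dot_split: "l2 v \<Longrightarrow> l2 u \<Longrightarrow> dot v u = (\<Sum>j\<in>S n. v j * u j) + dot v (tail n u)"
proof -
  assume l: "l2 v" "l2 u"
  let ?h = "\<lambda>j. if j \<in> S n then u j else 0"
  have h: "l2 ?h" using fin by (intro l2_finite_support) (rule finite_subset[of _ "S n"], auto)
  have "(\<lambda>j. ?h j + tail n u j) = u" by (auto simp: tail_def)
  then have "dot v u = dot v ?h + dot v (tail n u)" using dot_add[OF l(1) h l2_tail[OF l(2)]] by metis
  also have "dot v ?h = (\<Sum>j\<in>S n. v j * u j)"
    by (subst dot_finite_support[of "S n"]) (use fin in auto)
  finally show ?thesis .
qed

lemma app_split: "hs A \<Longrightarrow> l2 u \<Longrightarrow> app A u i = (\<Sum>j\<in>S n. A i j * u j) + app A (tail n u) i"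
  unfolding app_def by (rule dot_split[OF hs_row])

lemma exhaustion_pairs: "exhaustion (\<lambda>n. S n \<times> S n)"
proof
  fix p :: "'i \<times> 'i"
  have "eventually (\<lambda>n. {fst p, snd p} \<subseteq> S n) sequentially" by (intro eventually_subset) simp
  then show "\<exists>n. p \<in> S n \<times> S n" unfolding eventually_sequentially by (cases p) auto
qed (use fin mono in auto)

definition htail :: "nat \<Rightarrow> ('i \<Rightarrow> 'i \<Rightarrow> complex) \<Rightarrow> 'i \<Rightarrow> 'i \<Rightarrow> complex" where
  "htail n A = (\<lambda>i j. if i \<in> S n \<and> j \<in> S n then 0 else A i j)"

lemma hs_htail:
  assumes "hs A" shows "hs (htail n A)"
  by (rule l2_comparison(1)[OF assms]) (auto simp: htail_def)

lemma hsn_htail_lim: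
  assumes "hs A"
  shows "(\<lambda>n. hsn (htail n A)) \<longlonglongrightarrow> 0"
proof -
  have "(\<lambda>(i,j). htail n A i j) = exhaustion.tail (\<lambda>n. S n \<times> S n) n (\<lambda>(i,j). A i j)" for n
    by (auto simp: htail_def exhaustion.tail_def[OF exhaustion_pairs])
  then show ?thesis using exhaustion.nrm_tail_lim[OF exhaustion_pairs assms] by simp
qed

text \<open>Sections of different size become comparable by padding the smaller one with zeros
  (\<open>B\<close>): both are then matrices over \<open>S n\<close>, their difference is
  \<open>htail m A\<close>, and the Lipschitz bound applies.\<close>

lemma fdet2_diff:
  assumes "hs A" "m \<le> n"
  shows "cmod (fdet2 (S m) A - fdet2 (S n) A) \<le> hsn (htail m A) * exp ((2 * hsn A + 1)\<^sup>2)"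
proof -
  define B where "B = (\<lambda>i j. if i \<in> S m \<and> j \<in> S m then A i j else 0)"
  have B: "hs B" "hsn B \<le> hsn A"
    using l2_comparison[OF assms(1), of "\<lambda>(i,j). B i j"] by (auto simp: B_def)
  have "fdet2 (S m) A = fdet2 (S m) B" by (intro fdet2_cong) (auto simp: B_def)
  also have "\<dots> = fdet2 (S n) B"
    by (rule fdet2_extend[symmetric]) (use fin mono assms in \<open>auto simp: B_def\<close>)
  finally have "cmod (fdet2 (S m) A - fdet2 (S n) A) = cmod (fdet2 (S n) A - fdet2 (S n) B)"
    by (simp add: norm_minus_commute)
  also have "\<dots> \<le> frob (S n) (\<lambda>i j. A i j - B i j) * exp ((frob (S n) A + frob (S n) B + 1)\<^sup>2)"
    by (rule fdet2_lipschitz[OF fin])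
  also have "(\<lambda>i j. A i j - B i j) = htail m A" by (auto simp: B_def htail_def fun_eq_iff)
  also have "frob (S n) (htail m A) * exp ((frob (S n) A + frob (S n) B + 1)\<^sup>2)
      \<le> hsn (htail m A) * exp ((2 * hsn A + 1)\<^sup>2)"
  proof (intro mult_mono frob_le_hsn hs_htail fin assms)
    have "frob (S n) A + frob (S n) B + 1 \<le> 2 * hsn A + 1"
      using frob_le_hsn[OF assms(1) fin, of n] frob_le_hsn[OF B(1) fin, of n] B(2) by linarith
    then show "exp ((frob (S n) A + frob (S n) B + 1)\<^sup>2) \<le> exp ((2 * hsn A + 1)\<^sup>2)"
      by (simp add: power_mono)
  qed auto
  finally show ?thesis .
qed

text \<open>\<open>lim\<close> has a meaning only for convergent sequences; \<open>fdet2_lim\<close>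
  provides convergence for Hilbert--Schmidt matrices.\<close>

definition det2 :: "('i \<Rightarrow> 'i \<Rightarrow> complex) \<Rightarrow> complex" where
  "det2 A = lim (\<lambda>n. fdet2 (S n) A)"

lemma fdet2_lim:
  assumes "hs A"
  shows "(\<lambda>n. fdet2 (S n) A) \<longlonglongrightarrow> det2 A"
proof -
  let ?t = "\<lambda>m. hsn (htail m A) * exp ((2 * hsn A + 1)\<^sup>2)"
  have t: "?t \<longlonglongrightarrow> 0" using hsn_htail_lim[OF assms] by (rule tendsto_mult_left_zero)
  have "Cauchy (\<lambda>n. fdet2 (S n) A)"
  proof (rule CauchyI')
    fix e :: real assume e: "e > 0"
    have "eventually (\<lambda>m. ?t m < e) sequentially" by (rule order_tendstoD(2)[OF t e])
    then obtain M where "\<And>m. m \<ge> M \<Longrightarrow> ?t m < e" unfolding eventually_sequentially by blast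
    then show "\<exists>M. \<forall>m\<ge>M. \<forall>n>m. dist (fdet2 (S m) A) (fdet2 (S n) A) < e"
      unfolding dist_norm using fdet2_diff[OF assms] by (meson less_imp_le order_le_less_trans)
  qed
  then show ?thesis unfolding det2_def by (simp add: Cauchy_convergent convergent_LIMSEQ_iff[symmetric])
qed

lemma fdet2_det2_diff:
  assumes "hs A"
  shows "cmod (fdet2 (S m) A - det2 A) \<le> hsn (htail m A) * exp ((2 * hsn A + 1)\<^sup>2)"
proof (rule LIMSEQ_le_const2)
  show "(\<lambda>n. cmod (fdet2 (S m) A - fdet2 (S n) A)) \<longlonglongrightarrow> cmod (fdet2 (S m) A - det2 A)"
    by (intro tendsto_intros fdet2_lim assms)
  show "\<exists>N. \<forall>n\<ge>N. cmod (fdet2 (S m) A - fdet2 (S n) A) \<le> hsn (htail m A) * exp ((2 * hsn A + 1)\<^sup>2)"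
    using fdet2_diff[OF assms] by blast
qed

lemma det2_lipschitz:
  assumes "hs A" "hs B"
  shows "cmod (det2 A - det2 B) \<le> hsn (\<lambda>i j. A i j - B i j) * exp ((hsn A + hsn B + 1)\<^sup>2)"
proof (rule LIMSEQ_le_const2)
  show "(\<lambda>n. cmod (fdet2 (S n) A - fdet2 (S n) B)) \<longlonglongrightarrow> cmod (det2 A - det2 B)"
    by (intro tendsto_intros fdet2_lim assms)
  have "cmod (fdet2 (S n) A - fdet2 (S n) B) \<le> hsn (\<lambda>i j. A i j - B i j) * exp ((hsn A + hsn B + 1)\<^sup>2)" for n
    by (rule order_trans[OF fdet2_lipschitz[OF fin]])
       (simp add: mult_mono power_mono add_mono frob_le_hsn fin assms hs_diff)
  then show "\<exists>N. \<forall>n\<ge>N. cmod (fdet2 (S n) A - fdet2 (S n) B) \<le> hsn (\<lambda>i j. A i j - B i j) * exp ((hsn A + hsn B + 1)\<^sup>2)"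
    by blast
qed

text \<open>The Lipschitz constant involves the varying norm of \<open>A x\<close>; the triangle
  inequality replaces it by an expression in the distance \<open>?d x\<close>, which tends to 0.
  This yields continuity in \<sigma>.\<close>

lemma det2_tendsto:
  assumes "\<And>x. hs (A x)" "hs B" "((\<lambda>x. hsn (\<lambda>i j. A x i j - B i j)) \<longlongrightarrow> 0) F"
  shows "((\<lambda>x. det2 (A x)) \<longlongrightarrow> det2 B) F"
proof -
  let ?d = "\<lambda>x. hsn (\<lambda>i j. A x i j - B i j)"
  have b: "cmod (det2 (A x) - det2 B) \<le> ?d x * exp ((?d x + 2 * hsn B + 1)\<^sup>2)" for x
  proof -
    have "hsn (A x) \<le> ?d x + hsn B"
      using hsn_add[OF hs_diff[OF assms(1)[of x] assms(2)] assms(2)] by simp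
    then have "exp ((hsn (A x) + hsn B + 1)\<^sup>2) \<le> exp ((?d x + 2 * hsn B + 1)\<^sup>2)"
      by (simp add: power_mono)
    then show ?thesis
      by (intro order_trans[OF det2_lipschitz[OF assms(1,2)]] mult_left_mono) auto
  qed
  have "((\<lambda>x. ?d x * exp ((?d x + 2 * hsn B + 1)\<^sup>2)) \<longlongrightarrow> 0 * exp ((0 + 2 * hsn B + 1)\<^sup>2)) F"
    by (intro tendsto_intros assms(3))
  then have "((\<lambda>x. ?d x * exp ((?d x + 2 * hsn B + 1)\<^sup>2)) \<longlongrightarrow> 0) F" by simp
  then have "((\<lambda>x. det2 (A x) - det2 B) \<longlongrightarrow> 0) F"
    by (rule Lim_null_comparison[rotated]) (use b in auto)
  then show ?thesis by (simp add: LIM_zero_cancel)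
qed

text \<open>The matrix may change with the section, provided that the change seen on
  \<open>S n\<close> vanishes in Frobenius norm. This is how identities with a residual on each
  section pass to the limit.\<close>

lemma fdet2_perturb:
  assumes "hs A" "(\<lambda>n. frob (S n) (\<lambda>i j. E n i j - A i j)) \<longlonglongrightarrow> 0"
  shows "(\<lambda>n. fdet2 (S n) (E n)) \<longlonglongrightarrow> det2 A"
proof -
  let ?d = "\<lambda>n. frob (S n) (\<lambda>i j. E n i j - A i j)"
  have b: "cmod (fdet2 (S n) (E n) - fdet2 (S n) A) \<le> ?d n * exp ((?d n + 2 * hsn A + 1)\<^sup>2)" for n
  proof -
    have "frob (S n) (E n) \<le> ?d n + frob (S n) A"
      using frob_add[of "S n" "\<lambda>i j. E n i j - A i j" A] by simp
    moreover have "frob (S n) A \<le> hsn A" by (intro frob_le_hsn assms fin)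
    ultimately have "exp ((frob (S n) (E n) + frob (S n) A + 1)\<^sup>2) \<le> exp ((?d n + 2 * hsn A + 1)\<^sup>2)"
      by (simp add: power_mono)
    then show ?thesis
      by (intro order_trans[OF fdet2_lipschitz[OF fin]] mult_left_mono) auto
  qed
  have "(\<lambda>n. ?d n * exp ((?d n + 2 * hsn A + 1)\<^sup>2)) \<longlonglongrightarrow> 0 * exp ((0 + 2 * hsn A + 1)\<^sup>2)"
    by (intro tendsto_intros assms(2))
  then have "(\<lambda>n. ?d n * exp ((?d n + 2 * hsn A + 1)\<^sup>2)) \<longlonglongrightarrow> 0" by simp
  then have "(\<lambda>n. fdet2 (S n) (E n) - fdet2 (S n) A) \<longlonglongrightarrow> 0"
    by (rule Lim_null_comparison[rotated]) (use b in auto)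
  from tendsto_add[OF this fdet2_lim[OF assms(1)]] show ?thesis by simp
qed

text \<open>Each finite section gives an entire function, and the tail bound of
  \<open>fdet2_det2_diff\<close> makes the convergence uniform on unit discs, so Weierstrass'
  theorem applies.\<close>

lemma det2_holomorphic:
  assumes "hs A" "hs B"
  shows "(\<lambda>z. det2 (\<lambda>i j. A i j + z * B i j)) holomorphic_on UNIV"
proof (rule holomorphic_uniform_sequence)
  show "(\<lambda>z. fdet2 (S n) (\<lambda>i j. A i j + z * B i j)) holomorphic_on UNIV" for n
    unfolding fdet2_def fdet_def by (intro holomorphic_intros)
  fix x :: complex
  \<comment> \<open>Bounds \<open>cmod z\<close> on the unit disc around \<open>x\<close>, so that
    \<open>?b n\<close> does not depend on \<open>z\<close>.\<close>
  define R where "R = cmod x + 1"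
  let ?b = "\<lambda>n. (hsn (htail n A) + R * hsn (htail n B)) * exp ((2 * (hsn A + R * hsn B) + 1)\<^sup>2)"
  have bound: "cmod (fdet2 (S n) (\<lambda>i j. A i j + z * B i j) - det2 (\<lambda>i j. A i j + z * B i j)) \<le> ?b n"
    if z: "z \<in> cball x 1" for z n
  proof -
    have zR: "cmod z \<le> R"
      using z norm_triangle_ineq2[of z x] by (simp add: R_def dist_norm norm_minus_commute)
    have h: "hs (\<lambda>i j. A i j + z * B i j)" by (intro hs_add hs_scale assms)
    have "htail n (\<lambda>i j. A i j + z * B i j) = (\<lambda>i j. htail n A i j + z * htail n B i j)"
      by (auto simp: htail_def fun_eq_iff)
    then have "hsn (htail n (\<lambda>i j. A i j + z * B i j)) \<le> hsn (htail n A) + cmod z * hsn (htail n B)"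
      using hsn_add[OF hs_htail[OF assms(1)] hs_scale[OF hs_htail[OF assms(2)]], of n z n]
      by (simp only: hsn_scale)
    also have "\<dots> \<le> hsn (htail n A) + R * hsn (htail n B)"
      using zR by (intro add_left_mono mult_right_mono) auto
    finally have 1: "hsn (htail n (\<lambda>i j. A i j + z * B i j)) \<le> hsn (htail n A) + R * hsn (htail n B)" .
    have "hsn (\<lambda>i j. A i j + z * B i j) \<le> hsn A + cmod z * hsn B"
      using hsn_add[OF assms(1) hs_scale[OF assms(2)], of z] by (simp only: hsn_scale)
    also have "\<dots> \<le> hsn A + R * hsn B"
      using zR by (intro add_left_mono mult_right_mono) auto
    finally have "exp ((2 * hsn (\<lambda>i j. A i j + z * B i j) + 1)\<^sup>2) \<le> exp ((2 * (hsn A + R * hsn B) + 1)\<^sup>2)"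
      by (simp add: power_mono)
    then show ?thesis
      by (intro order_trans[OF fdet2_det2_diff[OF h]] mult_mono[OF 1])
         (auto simp: R_def intro!: add_nonneg_nonneg mult_nonneg_nonneg)
  qed
  have "?b \<longlonglongrightarrow> (0 + R * 0) * exp ((2 * (hsn A + R * hsn B) + 1)\<^sup>2)"
    by (intro tendsto_intros hsn_htail_lim assms)
  then have b0: "?b \<longlonglongrightarrow> 0" by simp
  have "uniform_limit (cball x 1) (\<lambda>n z. fdet2 (S n) (\<lambda>i j. A i j + z * B i j))
      (\<lambda>z. det2 (\<lambda>i j. A i j + z * B i j)) sequentially"
    unfolding uniform_limit_iff
  proof (intro allI impI)
    fix e :: real assume e: "e > 0"
    have "eventually (\<lambda>n. ?b n < e) sequentially" by (rule order_tendstoD(2)[OF b0 e])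
    then show "\<forall>\<^sub>F n in sequentially. \<forall>z\<in>cball x 1.
        dist (fdet2 (S n) (\<lambda>i j. A i j + z * B i j)) (det2 (\<lambda>i j. A i j + z * B i j)) < e"
    proof (eventually_elim, intro ballI)
      fix n z assume n: "?b n < e" and z: "z \<in> cball x 1"
      show "dist (fdet2 (S n) (\<lambda>i j. A i j + z * B i j)) (det2 (\<lambda>i j. A i j + z * B i j)) < e"
        unfolding dist_norm by (rule order_le_less_trans[OF bound[OF z] n])
    qed
  qed
  then show "\<exists>d>0. cball x d \<subseteq> UNIV \<and> uniform_limit (cball x d) (\<lambda>n z. fdet2 (S n) (\<lambda>i j. A i j + z * B i j))
      (\<lambda>z. det2 (\<lambda>i j. A i j + z * B i j)) sequentially"
    by (intro exI[of _ 1]) auto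
qed auto

lemma section_residual:
  assumes "hs A" "l2 u"
  shows "L2_set (\<lambda>i. cmod (app A u i - (\<Sum>j\<in>S n. A i j * u j))) (S n) \<le> hsn A * nrm (tail n u)"
proof -
  have "L2_set (\<lambda>i. cmod (app A u i - (\<Sum>j\<in>S n. A i j * u j))) (S n) = L2_set (\<lambda>i. cmod (app A (tail n u) i)) (S n)"
    by (simp add: app_split[OF assms, of _ n])
  also have "\<dots> \<le> nrm (app A (tail n u))"
    by (intro L2_set_le_nrm l2_app l2_tail assms fin)
  also have "\<dots> \<le> hsn A * nrm (tail n u)" by (intro nrm_app l2_tail assms)
  finally show ?thesis .
qed

text \<open>The limit of \<open>fdet2_rank_one\<close>. Its hypothesis does not survive truncation,
  since \<open>app A p\<close> also sees the entries of \<open>p\<close> outside the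
  section.\<close>

lemma det2_rank_one:
  assumes A: "hs A" and p: "l2 p" and x: "l2 x" and \<phi>: "l2 \<phi>"
    and eq: "\<And>i. p i + app A p i = - x i"
  shows "det2 (\<lambda>i j. A i j - x i * \<phi> j) = det2 A * (1 + dot \<phi> p) * exp (dot \<phi> x)"
proof -
  \<comment> \<open>The vector for which the relation with \<open>p\<close> is exact on
    \<open>S n\<close>; by \<open>section_residual\<close> it differs from \<open>x\<close> there by
    at most \<open>hsn A\<close> times the tail of \<open>p\<close>.\<close>
  define xs where "xs n i = - (p i + (\<Sum>k\<in>S n. A i k * p k))" for n i
  have d: "x i - xs n i = - (app A p i - (\<Sum>k\<in>S n. A i k * p k))" for n i
  proof -
    have "x i = - (p i + app A p i)" using eq[of i] by simp
    then show ?thesis by (simp add: xs_def)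
  qed
  have res: "L2_set (\<lambda>i. cmod (x i - xs n i)) (S n) \<le> hsn A * nrm (tail n p)" for n
    unfolding d norm_minus_cancel by (rule section_residual[OF A p])
  have "(\<lambda>n. hsn A * nrm (tail n p)) \<longlonglongrightarrow> hsn A * 0" by (intro tendsto_intros nrm_tail_lim p)
  then have t0: "(\<lambda>n. hsn A * nrm (tail n p)) \<longlonglongrightarrow> 0" by simp
  have res0: "(\<lambda>n. L2_set (\<lambda>i. cmod (x i - xs n i)) (S n)) \<longlonglongrightarrow> 0"
    by (rule Lim_null_comparison[OF _ t0]) (use res in auto)
  have hsE: "hs (\<lambda>i j. A i j - x i * \<phi> j)" by (intro hs_diff hs_outer A x \<phi>)
  have bnd0: "(\<lambda>n. L2_set (\<lambda>i. cmod (x i - xs n i)) (S n) * nrm \<phi>) \<longlonglongrightarrow> 0"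
    using res0 by (rule tendsto_mult_left_zero)
  have "(\<lambda>n. fdet2 (S n) (\<lambda>i j. A i j - xs n i * \<phi> j)) \<longlonglongrightarrow> det2 (\<lambda>i j. A i j - x i * \<phi> j)"
  proof (rule fdet2_perturb[OF hsE])
    have "frob (S n) (\<lambda>i j. A i j - xs n i * \<phi> j - (A i j - x i * \<phi> j)) \<le> L2_set (\<lambda>i. cmod (x i - xs n i)) (S n) * nrm \<phi>" for n
    proof -
      have "(\<lambda>i j. A i j - xs n i * \<phi> j - (A i j - x i * \<phi> j)) = (\<lambda>i j. (x i - xs n i) * \<phi> j)"
        by (auto simp: fun_eq_iff algebra_simps)
      then show ?thesis by (simp add: frob_outer mult_left_mono L2_set_le_nrm fin \<phi>)
    qed
    then show "(\<lambda>n. frob (S n) (\<lambda>i j. A i j - xs n i * \<phi> j - (A i j - x i * \<phi> j))) \<longlonglongrightarrow> 0"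
      by (intro Lim_null_comparison[OF _ bnd0]) auto
  qed
  moreover have "(\<lambda>n. fdet2 (S n) (\<lambda>i j. A i j - xs n i * \<phi> j)) \<longlonglongrightarrow> det2 A * (1 + dot \<phi> p) * exp (dot \<phi> x)"
  proof -
    have 1: "fdet2 (S n) (\<lambda>i j. A i j - xs n i * \<phi> j)
        = fdet2 (S n) A * (1 + (\<Sum>i\<in>S n. \<phi> i * p i)) * exp (\<Sum>i\<in>S n. \<phi> i * xs n i)" for n
      by (rule fdet2_rank_one[OF fin]) (simp add: xs_def)
    have "(\<lambda>n. \<Sum>i\<in>S n. \<phi> i * (x i - xs n i)) \<longlonglongrightarrow> 0"
    proof (rule Lim_null_comparison[OF _ bnd0], intro always_eventually allI)
      fix n
      have "cmod (\<Sum>i\<in>S n. \<phi> i * (x i - xs n i)) \<le> (\<Sum>i\<in>S n. \<bar>cmod (x i - xs n i)\<bar> * \<bar>cmod (\<phi> i)\<bar>)"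
        by (rule order_trans[OF norm_sum]) (simp add: norm_mult mult.commute)
      also have "\<dots> \<le> L2_set (\<lambda>i. cmod (x i - xs n i)) (S n) * L2_set (\<lambda>i. cmod (\<phi> i)) (S n)"
        by (rule L2_set_mult_ineq)
      also have "\<dots> \<le> L2_set (\<lambda>i. cmod (x i - xs n i)) (S n) * nrm \<phi>"
        by (intro mult_left_mono L2_set_le_nrm \<phi> fin) auto
      finally show "cmod (\<Sum>i\<in>S n. \<phi> i * (x i - xs n i)) \<le> L2_set (\<lambda>i. cmod (x i - xs n i)) (S n) * nrm \<phi>" .
    qed
    from tendsto_diff[OF dot_lim[OF \<phi> x] this]
    have "(\<lambda>n. \<Sum>i\<in>S n. \<phi> i * xs n i) \<longlonglongrightarrow> dot \<phi> x"
      by (simp add: sum_subtractf[symmetric] right_diff_distrib)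
    then show ?thesis unfolding 1 by (intro tendsto_intros fdet2_lim dot_lim A p \<phi>)
  qed
  ultimately show ?thesis by (rule LIMSEQ_unique)
qed

end

section \<open>Zeros of the regularised determinant\<close>

context exhaustion
begin

text \<open>Compactness of a Hilbert--Schmidt matrix in sequential form. The columns outside
  \<open>S m\<close> have small norm and act on bounded vectors; the finitely many columns in
  \<open>S m\<close> see only coordinates that tend to 0.\<close>

lemma app_compact:
  fixes A :: "'i \<Rightarrow> 'i \<Rightarrow> complex"
  assumes A: "hs A" and x: "\<And>n. l2 (x n)" "\<And>n. nrm (x n) \<le> C" and x0: "\<And>i. (\<lambda>n. x n i) \<longlonglongrightarrow> 0"
  shows "(\<lambda>n. nrm (app A (x n))) \<longlonglongrightarrow> 0"
proof (rule LIMSEQ_I)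
  fix e :: real assume e: "e > 0"
  have C: "C \<ge> 0" using x(2)[of 0] nrm_nonneg order_trans by blast
  have "(\<lambda>m. hsn (htail m A) * C) \<longlonglongrightarrow> 0" using hsn_htail_lim[OF A] by (rule tendsto_mult_left_zero)
  from order_tendstoD(2)[OF this, of "e/2"] e obtain m where m: "hsn (htail m A) * C < e/2"
    by (auto simp: eventually_sequentially)
  define h where "h n i = (if i \<in> S m then x n i else 0)" for n i
  have hl: "l2 (h n)" for n
    using fin[of m] by (intro l2_finite_support) (rule finite_subset[of _ "S m"], auto simp: h_def)
  have "(nrm (h n))\<^sup>2 = (\<Sum>i\<in>S m. (cmod (x n i))\<^sup>2)" for n
  proof -
    have "(nrm (h n))\<^sup>2 = (\<Sum>\<^sub>\<infinity>i\<in>S m. (cmod (x n i))\<^sup>2)"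
      unfolding nrm_square by (rule infsum_cong_neutral) (auto simp: h_def)
    then show ?thesis using fin by simp
  qed
  then have nh: "nrm (h n) = sqrt (\<Sum>i\<in>S m. (cmod (x n i))\<^sup>2)" for n
    by (metis nrm_nonneg real_sqrt_unique)
  have "(\<lambda>n. hsn A * sqrt (\<Sum>i\<in>S m. (cmod (x n i))\<^sup>2)) \<longlonglongrightarrow> hsn A * sqrt (\<Sum>i\<in>S m. (cmod 0)\<^sup>2)"
    by (intro tendsto_intros x0)
  then have "(\<lambda>n. hsn A * nrm (h n)) \<longlonglongrightarrow> 0" unfolding nh by simp
  from order_tendstoD(2)[OF this, of "e/2"] e obtain N where N: "\<And>n. n \<ge> N \<Longrightarrow> hsn A * nrm (h n) < e/2"
    by (auto simp: eventually_sequentially)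
  have "nrm (app A (x n)) < e" if "n \<ge> N" for n
  proof -
    define B where "B = (\<lambda>i j. if j \<in> S m then 0 else A i j)"
    have B: "hs B" "hsn B \<le> hsn (htail m A)"
      using l2_comparison[OF hs_htail[OF A], of "\<lambda>(i,j). B i j" m] by (auto simp: B_def htail_def)
    have "app A (x n) i = app A (h n) i + app B (x n) i" for i
    proof -
      have "app A (x n) i = app A (h n) i + app A (tail m (x n)) i"
        using app_lin[OF A hl l2_tail[OF x(1)], of n m n i] by (simp add: h_def tail_def if_distrib cong: if_cong)
      moreover have "app A (tail m (x n)) i = app B (x n) i"
        unfolding app_def dot_def by (intro infsum_cong) (simp add: B_def tail_def)
      ultimately show ?thesis by simp
    qed
    then have "nrm (app A (x n)) = nrm (\<lambda>i. app A (h n) i + app B (x n) i)" by (simp add: nrm_def)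
    also have "\<dots> \<le> nrm (app A (h n)) + nrm (app B (x n))"
      by (rule nrm_add[OF l2_app[OF A hl] l2_app[OF B(1) x(1)]])
    also have "\<dots> \<le> hsn A * nrm (h n) + hsn B * nrm (x n)"
      by (intro add_mono nrm_app A B(1) hl x(1))
    also have "hsn B * nrm (x n) \<le> hsn (htail m A) * C"
      by (intro mult_mono B(2) x(2)) auto
    finally show ?thesis using N[OF that] m by linarith
  qed
  then show "\<exists>N. \<forall>n\<ge>N. norm (nrm (app A (x n)) - 0) < e" by auto
qed

text \<open>Otherwise there are vectors of norm 1 on ever larger sections whose image under 1 + A
  tends to 0. A coordinatewise limit of a subsequence lies in the kernel, hence is 0; then
  compactness sends A w to 0 in norm, and so w itself, although its norm is 1.\<close>

lemma coercive_sections: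
  assumes A: "hs A" and inj: "\<And>u. l2 u \<Longrightarrow> (\<And>i. u i + app A u i = 0) \<Longrightarrow> u = (\<lambda>i. 0)"
  shows "\<exists>c>0. \<exists>N. \<forall>n\<ge>N. \<forall>v. c * L2_set (\<lambda>i. cmod (v i)) (S n)
      \<le> L2_set (\<lambda>i. cmod (v i + (\<Sum>j\<in>S n. A i j * v j))) (S n)"
proof (rule ccontr)
  assume neg: "\<not> ?thesis"
  \<comment> \<open>The failing constant is 1/(n+1). The section index \<open>J\<close> is a
    separate parameter, since failure is only available for some index beyond
    \<open>n\<close>.\<close>
  define P where "P n J v \<longleftrightarrow> L2_set (\<lambda>i. cmod (v i + (\<Sum>j\<in>S J. A i j * v j))) (S J)
      < inverse (real (Suc n)) * L2_set (\<lambda>i. cmod (v i)) (S J)" for n J v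
  have "\<exists>J v. J \<ge> n \<and> P n J v" for n
    using neg unfolding P_def by (meson inverse_positive_iff_positive not_le of_nat_0_less_iff zero_less_Suc)
  then obtain J v where J: "\<And>n. J n \<ge> n" and P: "\<And>n. P n (J n) (v n)" by metis
  then have v: "L2_set (\<lambda>i. cmod (v n i + (\<Sum>j\<in>S (J n). A i j * v n j))) (S (J n))
      < inverse (real (Suc n)) * L2_set (\<lambda>i. cmod (v n i)) (S (J n))" for n
    unfolding P_def by blast
  define L where "L n = L2_set (\<lambda>i. cmod (v n i)) (S (J n))" for n
  have Lpos: "L n > 0" for n
  proof -
    have "0 < inverse (real (Suc n)) * L n"
      unfolding L_def by (rule order_le_less_trans[OF _ v[of n]]) simp
    then show ?thesis by (simp add: zero_less_mult_iff)
  qed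
  define w where "w n i = (if i \<in> S (J n) then of_real (inverse (L n)) * v n i else 0)" for n i
  have wl: "l2 (w n)" for n
    using fin[of "J n"] by (intro l2_finite_support) (rule finite_subset[of _ "S (J n)"], auto simp: w_def)
  have L2w: "L2_set (\<lambda>i. cmod (w n i)) (S (J n)) = 1" for n
  proof -
    have "L2_set (\<lambda>i. cmod (w n i)) (S (J n)) = L2_set (\<lambda>i. cmod (of_real (inverse (L n)) * v n i)) (S (J n))"
      by (intro L2_set_cong) (auto simp: w_def)
    also have "\<dots> = inverse (L n) * L n"
      unfolding L2_set_cmod_scale L_def[symmetric] using Lpos[of n] by (simp add: norm_inverse)
    finally show ?thesis using Lpos[of n] by simp
  qed
  have nw: "nrm (w n) \<le> 1" for n
  proof (rule l2_bounded(2))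
    fix F :: "'i set" assume F: "finite F"
    have "L2_set (\<lambda>i. cmod (w n i)) F = L2_set (\<lambda>i. cmod (w n i)) (F \<inter> S (J n))"
      unfolding L2_set_def using F by (intro arg_cong[of _ _ sqrt] sum.mono_neutral_right) (auto simp: w_def)
    also have "\<dots> \<le> L2_set (\<lambda>i. cmod (w n i)) (S (J n))"
      unfolding L2_set_def by (intro real_sqrt_le_mono sum_mono2 fin) auto
    finally show "L2_set (\<lambda>i. cmod (w n i)) F \<le> 1" using L2w by simp
  qed
  have w1: "cmod (w n i) \<le> 1" for n i
    using L2_set_le_nrm[OF wl[of n], of "{i}"] nw[of n] by simp
  have res: "L2_set (\<lambda>i. cmod (w n i + app A (w n) i)) (S (J n)) \<le> inverse (real (Suc n))" for n
  proof -
    have "w n i + app A (w n) i = of_real (inverse (L n)) * (v n i + (\<Sum>j\<in>S (J n). A i j * v n j))"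
      if i: "i \<in> S (J n)" for i
    proof -
      have "app A (w n) i = (\<Sum>j\<in>S (J n). A i j * w n j)"
        unfolding app_def by (rule dot_finite_support[OF fin]) (auto simp: w_def)
      also have "\<dots> = (\<Sum>j\<in>S (J n). of_real (inverse (L n)) * (A i j * v n j))"
        by (intro sum.cong) (auto simp: w_def)
      finally show ?thesis using i by (simp add: w_def distrib_left sum_distrib_left)
    qed
    then have "L2_set (\<lambda>i. cmod (w n i + app A (w n) i)) (S (J n))
       = L2_set (\<lambda>i. cmod (of_real (inverse (L n)) * (v n i + (\<Sum>j\<in>S (J n). A i j * v n j)))) (S (J n))"
      by (intro L2_set_cong) auto
    also have "\<dots> \<le> inverse (L n) * (inverse (real (Suc n)) * L n)"
      unfolding L2_set_cmod_scale using v[of n] Lpos[of n]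
      by (auto simp: L_def[symmetric] norm_inverse intro!: mult_left_mono less_imp_le)
    also have "\<dots> = inverse (real (Suc n))" using Lpos[of n] by (simp add: field_simps)
    finally show ?thesis .
  qed
  \<comment> \<open>A set exhausted by finite sets is countable, as the diagonal choice of a
    coordinatewise convergent subsequence requires.\<close>
  have "UNIV = (\<Union>n. S n)" using cover by auto
  then have "countable (UNIV :: 'i set)" using fin by (metis countable_UN countable_finite countableI_type)
  then obtain k where k: "strict_mono (k :: nat \<Rightarrow> nat)" "\<And>i. i \<in> (UNIV :: 'i set) \<Longrightarrow> \<exists>l. (\<lambda>n. w (k n) i) \<longlonglongrightarrow> l"
    using function_convergent_subsequence[of UNIV w 1] w1 by blast
  then obtain l where l: "\<And>i. (\<lambda>n. w (k n) i) \<longlonglongrightarrow> l i" by (metis UNIV_I)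
  have ll: "l2 l" "nrm l \<le> 1"
  proof -
    have "L2_set (\<lambda>i. cmod (l i)) F \<le> 1" if F: "finite F" for F
    proof (rule LIMSEQ_le_const2)
      show "(\<lambda>n. L2_set (\<lambda>i. cmod (w (k n) i)) F) \<longlonglongrightarrow> L2_set (\<lambda>i. cmod (l i)) F"
        unfolding L2_set_def by (intro tendsto_intros l)
      show "\<exists>N. \<forall>n\<ge>N. L2_set (\<lambda>i. cmod (w (k n) i)) F \<le> 1"
        using L2_set_le_nrm[OF wl F] nw order_trans by blast
    qed
    then show "l2 l" "nrm l \<le> 1" using l2_bounded[of l 1] by auto
  qed
  have d0: "(\<lambda>n. nrm (app A (\<lambda>i. w (k n) i - l i))) \<longlonglongrightarrow> 0"
  proof (rule app_compact[OF A, where C = 2])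
    show "l2 (\<lambda>i. w (k n) i - l i)" for n by (intro l2_diff wl ll)
    show "nrm (\<lambda>i. w (k n) i - l i) \<le> 2" for n
      using nrm_add[OF wl[of "k n"] l2_minus[OF ll(1)]] nw[of "k n"] ll(2) nrm_scale[of "-1" l] by simp
    show "(\<lambda>n. w (k n) i - l i) \<longlonglongrightarrow> 0" for i using l[of i] by (simp add: LIM_zero)
  qed
  have applim: "(\<lambda>n. app A (w (k n)) i) \<longlonglongrightarrow> app A l i" for i
  proof -
    have "cmod (app A (w (k n)) i - app A l i) \<le> nrm (app A (\<lambda>i. w (k n) i - l i))" for n
      using L2_set_le_nrm[OF l2_app[OF A l2_diff[OF wl[of "k n"] ll(1)]], of "{i}"]
      by (simp add: app_diff[OF A wl ll(1)])
    then have "(\<lambda>n. app A (w (k n)) i - app A l i) \<longlonglongrightarrow> 0"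
      by (intro Lim_null_comparison[OF _ d0]) auto
    then show ?thesis by (simp add: LIM_zero_cancel)
  qed
  have inv0: "(\<lambda>n. inverse (real (Suc (k n)))) \<longlonglongrightarrow> 0"
    using LIMSEQ_subseq_LIMSEQ[OF LIMSEQ_inverse_real_of_nat k(1)] by (simp add: o_def)
  have "l i + app A l i = 0" for i
  proof -
    \<comment> \<open>The residual is small only on the section \<open>S (J (k n))\<close>, so each
      coordinate has to enter it before the limit is taken there.\<close>
    have ev: "eventually (\<lambda>n. i \<in> S (J (k n))) sequentially"
    proof -
      obtain M where M: "i \<in> S M" using cover by blast
      have "i \<in> S (J (k n))" if "n \<ge> M" for n
      proof -
        have "M \<le> J (k n)" using that J[of "k n"] seq_suble[OF k(1), of n] by linarith
        then show ?thesis using M mono by blast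
      qed
      then show ?thesis unfolding eventually_sequentially by blast
    qed
    have "(\<lambda>n. w (k n) i + app A (w (k n)) i) \<longlonglongrightarrow> 0"
    proof (rule Lim_null_comparison[OF _ inv0])
      show "\<forall>\<^sub>F n in sequentially. cmod (w (k n) i + app A (w (k n)) i) \<le> inverse (real (Suc (k n)))"
        using ev
      proof eventually_elim
        case (elim n)
        have "cmod (w (k n) i + app A (w (k n)) i) \<le> L2_set (\<lambda>i. cmod (w (k n) i + app A (w (k n)) i)) (S (J (k n)))"
          using elim fin by (intro member_le_L2_set)
        then show ?case using res[of "k n"] by linarith
      qed
    qed
    moreover have "(\<lambda>n. w (k n) i + app A (w (k n)) i) \<longlonglongrightarrow> l i + app A l i"
      by (intro tendsto_intros l applim)
    ultimately show ?thesis using LIMSEQ_unique by blast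
  qed
  with ll have l0: "l = (\<lambda>i. 0)" by (intro inj) auto
  \<comment> \<open>On its section w is (w + A w) - A w: the first part is the residual, the second
    tends to 0 by \<open>d0\<close>, since the limit \<open>l\<close> is 0.\<close>
  have "1 \<le> inverse (real (Suc (k n))) + nrm (app A (w (k n)))" for n
  proof -
    have "1 = L2_set (\<lambda>i. cmod ((w (k n) i + app A (w (k n)) i) + - app A (w (k n)) i)) (S (J (k n)))"
      using L2w[of "k n"] by simp
    also have "\<dots> \<le> L2_set (\<lambda>i. cmod (w (k n) i + app A (w (k n)) i)) (S (J (k n)))
        + L2_set (\<lambda>i. cmod (- app A (w (k n)) i)) (S (J (k n)))"
      by (rule L2_set_cmod_add)
    also have "\<dots> \<le> inverse (real (Suc (k n))) + nrm (app A (w (k n)))"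
      unfolding norm_minus_cancel by (intro add_mono res L2_set_le_nrm l2_app A wl fin)
    finally show ?thesis .
  qed
  moreover have "(\<lambda>n. inverse (real (Suc (k n))) + nrm (app A (w (k n)))) \<longlonglongrightarrow> 0 + 0"
    using d0 unfolding l0 by (intro tendsto_add inv0) simp
  ultimately have "(1::real) \<le> 0 + 0"
    by (intro LIMSEQ_le_const) blast+
  then show False by simp
qed

text \<open>A kernel vector makes slightly corrected sections singular, and these have the same
  limit. Without a kernel, the sections are uniformly coercive and their determinants stay away from
  0.\<close>

theorem det2_eq_0_iff:
  assumes A: "hs A"
  shows "det2 A = 0 \<longleftrightarrow> (\<exists>u. l2 u \<and> u \<noteq> (\<lambda>i. 0) \<and> (\<forall>i. u i + app A u i = 0))"
proof
  assume "\<exists>u. l2 u \<and> u \<noteq> (\<lambda>i. 0) \<and> (\<forall>i. u i + app A u i = 0)"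
  then obtain u a where u: "l2 u" "u a \<noteq> 0" "\<And>i. u i + app A u i = 0" by (auto simp: fun_eq_iff)
  define q where "q n = (\<Sum>i\<in>S n. (cmod (u i))\<^sup>2)" for n
  define r where "r n i = u i + (\<Sum>j\<in>S n. A i j * u j)" for n i
  \<comment> \<open>Subtracts the residual \<open>r n\<close> in the direction of \<open>u\<close>,
    so that 1 + \<open>E n\<close> annihilates \<open>u\<close> exactly on the section. Fixing
    \<open>a\<close> with \<open>u a \<noteq> 0\<close> keeps the normalisation \<open>q n\<close>
    bounded below.\<close>
  define E where "E n i j = A i j - r n i * (cnj (u j) / of_real (q n))" for n i j
  have ev: "eventually (\<lambda>n. a \<in> S n) sequentially" using eventually_subset[of "{a}"] by simp
  have q: "q n \<ge> (cmod (u a))\<^sup>2" if "a \<in> S n" for n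
    unfolding q_def by (rule member_le_sum) (use that fin in auto)
  have "eventually (\<lambda>n. fdet2 (S n) (E n) = 0) sequentially"
    using ev
  proof eventually_elim
    case (elim n)
    have q0: "q n \<noteq> 0" using q[OF elim] u(2) by (metis not_less zero_less_norm_iff zero_less_power)
    have "(\<Sum>j\<in>S n. ((if i = j then 1 else 0) + E n i j) * u j) = 0" if i: "i \<in> S n" for i
    proof -
      have "(\<Sum>j\<in>S n. E n i j * u j) = (\<Sum>j\<in>S n. A i j * u j) - (\<Sum>j\<in>S n. r n i * (u j * cnj (u j)) / of_real (q n))"
        unfolding E_def sum_subtractf[symmetric] by (intro sum.cong refl) (simp add: algebra_simps)
      also have "(\<Sum>j\<in>S n. r n i * (u j * cnj (u j)) / of_real (q n)) = r n i * of_real (q n) / of_real (q n)"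
        unfolding q_def of_real_sum complex_norm_square sum_distrib_left sum_divide_distrib ..
      also have "\<dots> = r n i" using q0 by simp
      finally show ?thesis
        unfolding distrib_right sum.distrib sum_delta_mult(1)[OF fin i] by (simp add: r_def)
    qed
    then have "fdet (S n) (\<lambda>i j. (if i = j then 1 else 0) + E n i j) = 0"
      unfolding fdet_eq_0_iff[OF fin] using u(2) elim by blast
    then show ?case by (simp add: fdet2_def)
  qed
  then have "(\<lambda>n. fdet2 (S n) (E n)) \<longlonglongrightarrow> 0" by (rule tendsto_eventually)
  moreover have "(\<lambda>n. fdet2 (S n) (E n)) \<longlonglongrightarrow> det2 A"
  proof (rule fdet2_perturb[OF A])
    let ?C = "nrm u / (cmod (u a))\<^sup>2"
    have "(\<lambda>n. hsn A * nrm (tail n u) * ?C) \<longlonglongrightarrow> hsn A * 0 * ?C" by (intro tendsto_intros nrm_tail_lim u)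
    then have t0: "(\<lambda>n. hsn A * nrm (tail n u) * ?C) \<longlonglongrightarrow> 0" by simp
    show "(\<lambda>n. frob (S n) (\<lambda>i j. E n i j - A i j)) \<longlonglongrightarrow> 0"
    proof (rule Lim_null_comparison[OF _ t0])
      show "\<forall>\<^sub>F n in sequentially. norm (frob (S n) (\<lambda>i j. E n i j - A i j)) \<le> hsn A * nrm (tail n u) * ?C"
        using ev
      proof eventually_elim
        case (elim n)
        have "(\<lambda>i j. E n i j - A i j) = (\<lambda>i j. r n i * ((- 1 / of_real (q n)) * cnj (u j)))"
          by (auto simp: E_def fun_eq_iff)
        then have "frob (S n) (\<lambda>i j. E n i j - A i j) = L2_set (\<lambda>i. cmod (r n i)) (S n) *
            (cmod (- 1 / of_real (q n)) * L2_set (\<lambda>i. cmod (cnj (u i))) (S n))"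
          by (simp only: frob_outer L2_set_cmod_scale)
        also have "\<dots> = L2_set (\<lambda>i. cmod (r n i)) (S n) * (L2_set (\<lambda>i. cmod (u i)) (S n) / \<bar>q n\<bar>)"
          by (simp add: norm_divide)
        also have "\<dots> \<le> (hsn A * nrm (tail n u)) * ?C"
        proof (intro mult_mono)
          have "r n i = - (app A u i - (\<Sum>j\<in>S n. A i j * u j))" for i
            using u(3)[of i] by (simp add: r_def eq_neg_iff_add_eq_0)
          then have "L2_set (\<lambda>i. cmod (r n i)) (S n) = L2_set (\<lambda>i. cmod (app A u i - (\<Sum>j\<in>S n. A i j * u j))) (S n)"
            by (simp only: norm_minus_cancel)
          also have "\<dots> \<le> hsn A * nrm (tail n u)" by (rule section_residual[OF A u(1)])
          finally show "L2_set (\<lambda>i. cmod (r n i)) (S n) \<le> hsn A * nrm (tail n u)" .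
          show "L2_set (\<lambda>i. cmod (u i)) (S n) / \<bar>q n\<bar> \<le> ?C"
          proof (rule frac_le)
            show "(cmod (u a))\<^sup>2 \<le> \<bar>q n\<bar>" using q[OF elim] by linarith
          qed (use u fin L2_set_le_nrm in auto)
        qed auto
        finally show ?case by simp
      qed
    qed
  qed
  ultimately show "det2 A = 0" using LIMSEQ_unique by blast
next
  assume det0: "det2 A = 0"
  show "\<exists>u. l2 u \<and> u \<noteq> (\<lambda>i. 0) \<and> (\<forall>i. u i + app A u i = 0)"
  proof (rule ccontr)
    assume "\<not> ?thesis"
    then have "\<And>u. l2 u \<Longrightarrow> (\<And>i. u i + app A u i = 0) \<Longrightarrow> u = (\<lambda>i. 0)" by blast
    from coercive_sections[OF A this] obtain c N where c: "c > 0"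
      and low: "\<And>n v. n \<ge> N \<Longrightarrow> c * L2_set (\<lambda>i. cmod (v i)) (S n)
          \<le> L2_set (\<lambda>i. cmod (v i + (\<Sum>j\<in>S n. A i j * v j))) (S n)" by blast
    \<comment> \<open>The bound of \<open>fdet2_lower_bound\<close> with the section norm replaced
      by the full norm, hence independent of n.\<close>
    define m where "m = exp (- ((hsn A)\<^sup>2 / c) - (hsn A)\<^sup>2 / (2 * c\<^sup>2))"
    have "m \<le> cmod (fdet2 (S n) A)" if n: "n \<ge> N" for n
    proof -
      have f: "(frob (S n) A)\<^sup>2 \<le> (hsn A)\<^sup>2" by (intro power_mono frob_le_hsn A fin) simp
      have "(frob (S n) A)\<^sup>2 / c \<le> (hsn A)\<^sup>2 / c" "(frob (S n) A)\<^sup>2 / (2 * c\<^sup>2) \<le> (hsn A)\<^sup>2 / (2 * c\<^sup>2)"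
        using f c by (simp_all add: divide_right_mono)
      then have "m \<le> exp (- ((frob (S n) A)\<^sup>2 / c) - (frob (S n) A)\<^sup>2 / (2 * c\<^sup>2))"
        unfolding m_def exp_le_cancel_iff by linarith
      also have "\<dots> \<le> cmod (fdet2 (S n) A)" by (rule fdet2_lower_bound[OF fin c low[OF n]])
      finally show ?thesis .
    qed
    then have "m \<le> cmod (det2 A)"
      by (intro LIMSEQ_le_const[OF tendsto_norm[OF fdet2_lim[OF A]]]) blast
    then show False using det0 by (simp add: m_def)
  qed
qed

end

section \<open>Order of a zero and dimension of the generalised kernel\<close>

text \<open>Isolates what the multiplicity argument uses: a Hilbert--Schmidt base matrix and
  positive, square summable weights multiplying the parameter.\<close>

locale pencil = exhaustion S for S :: "nat \<Rightarrow> 'i set" +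
  fixes A :: "'i \<Rightarrow> 'i \<Rightarrow> complex" and g :: "'i \<Rightarrow> real"
  assumes hsA: "hs A" and l2g: "l2 (\<lambda>i. complex_of_real (g i))" and gpos: "g i > 0"
begin

definition G :: "'i \<Rightarrow> complex" where "G i = of_real (g i)"

definition K :: "complex \<Rightarrow> 'i \<Rightarrow> 'i \<Rightarrow> complex" where
  "K \<mu> = (\<lambda>i j. A i j + \<mu> * (if i = j then G i else 0))"

text \<open>Solves 1 + A = - G T. Since the weights may be arbitrarily small, \<open>T u\<close>
  need not be square summable for square summable \<open>u\<close>; statements about iterates
  therefore carry explicit \<open>l2\<close> conditions.\<close>

definition T :: "('i \<Rightarrow> complex) \<Rightarrow> 'i \<Rightarrow> complex" where
  "T u = (\<lambda>i. - (u i + app A u i) / G i)"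

lemma G_nonzero [simp]: "G i \<noteq> 0"
  using gpos[of i] by (simp add: G_def)

lemma hs_diag_G: "hs (\<lambda>i j. if i = j then G i else 0)"
  using l2g by (intro hs_diag) (simp add: G_def)

lemma hs_K: "hs (K \<mu>)"
  unfolding K_def by (intro hs_add hs_scale hsA hs_diag_G)

lemma l2_G: "l2 u \<Longrightarrow> l2 (\<lambda>i. G i * u i)"
  using l2_app[OF hs_diag_G, of u] by (simp add: app_diag[abs_def] app_def dot_delta eq_commute)

lemma one_plus_A: "u i + app A u i = - (G i * T u i)"
  by (simp add: T_def)

text \<open>1 + K(\<mu>) = G (\<mu> - T): since G has no zeros, a kernel vector at \<mu> is an
  eigenvector of \<open>T\<close> for \<mu>.\<close>

lemma one_plus_K:
  assumes "l2 u"
  shows "u i + app (K \<mu>) u i = G i * (\<mu> * u i - T u i)"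
proof -
  have "app (K \<mu>) u i = app A u i + app (\<lambda>i j. \<mu> * (if i = j then G i else 0)) u i"
    unfolding K_def by (rule app_add_op[OF hsA hs_scale[OF hs_diag_G] assms])
  also have "(\<lambda>i j. \<mu> * (if i = j then G i else 0)) = (\<lambda>i j. if i = j then \<mu> * G i else 0)"
    by (auto simp: fun_eq_iff)
  finally have "u i + app (K \<mu>) u i = (u i + app A u i) + \<mu> * G i * u i" by (simp add: app_diag)
  then show ?thesis unfolding one_plus_A by (simp add: algebra_simps)
qed

lemma T_sum:
  assumes "\<And>k. k \<in> L \<Longrightarrow> l2 (u k)"
  shows "T (\<lambda>i. \<Sum>k\<in>L. c k * u k i) = (\<lambda>i. \<Sum>k\<in>L. c k * T (u k) i)"
proof
  fix i
  have "app A (\<lambda>i. \<Sum>k\<in>L. c k * u k i) i = (\<Sum>k\<in>L. c k * app A (u k) i)"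
    using app_sum[OF hsA, of L "\<lambda>k i. c k * u k i" i] assms by (simp add: l2_scale app_scale)
  then have "T (\<lambda>i. \<Sum>k\<in>L. c k * u k i) i = - ((\<Sum>k\<in>L. c k * u k i) + (\<Sum>k\<in>L. c k * app A (u k) i)) / G i"
    by (simp add: T_def)
  also have "\<dots> = (\<Sum>k\<in>L. - (c k * u k i + c k * app A (u k) i) / G i)"
    by (simp only: sum.distrib[symmetric] sum_negf[symmetric] sum_divide_distrib)
  also have "\<dots> = (\<Sum>k\<in>L. c k * T (u k) i)"
    by (intro sum.cong refl) (simp add: T_def field_simps)
  finally show "T (\<lambda>i. \<Sum>k\<in>L. c k * u k i) i = (\<Sum>k\<in>L. c k * T (u k) i)" .
qed

lemma T_diff:
  assumes "l2 u" "l2 v"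
  shows "T (\<lambda>i. u i - v i) = (\<lambda>i. T u i - T v i)"
  by (auto simp: T_def fun_eq_iff app_diff[OF hsA assms] diff_divide_distrib[symmetric])

section \<open>Triangular chains with a biorthogonal system\<close>

definition spn :: "(nat \<Rightarrow> 'i \<Rightarrow> complex) \<Rightarrow> nat \<Rightarrow> ('i \<Rightarrow> complex) set" where
  "spn e d = {u. \<exists>c. u = (\<lambda>i. \<Sum>l<d. c l * e l i)}"

lemma spnI: "u = (\<lambda>i. \<Sum>l<d. c l * e l i) \<Longrightarrow> u \<in> spn e d"
  by (auto simp: spn_def)

lemma spn_zero: "(\<lambda>i. 0) \<in> spn e d"
  by (rule spnI[of _ "\<lambda>_. 0"]) simp

lemma spn_add: "u \<in> spn e d \<Longrightarrow> v \<in> spn e d \<Longrightarrow> (\<lambda>i. u i + v i) \<in> spn e d"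
proof -
  assume "u \<in> spn e d" "v \<in> spn e d"
  then obtain c c' where "u = (\<lambda>i. \<Sum>l<d. c l * e l i)" "v = (\<lambda>i. \<Sum>l<d. c' l * e l i)"
    by (auto simp: spn_def)
  then show ?thesis by (intro spnI[of _ "\<lambda>l. c l + c' l"]) (simp add: distrib_right sum.distrib)
qed

lemma spn_scale: "u \<in> spn e d \<Longrightarrow> (\<lambda>i. a * u i) \<in> spn e d"
proof -
  assume "u \<in> spn e d"
  then obtain c where "u = (\<lambda>i. \<Sum>l<d. c l * e l i)" by (auto simp: spn_def)
  then show ?thesis by (intro spnI[of _ "\<lambda>l. a * c l"]) (simp add: sum_distrib_left mult.assoc)
qed

lemma spn_diff: "u \<in> spn e d \<Longrightarrow> v \<in> spn e d \<Longrightarrow> (\<lambda>i. u i - v i) \<in> spn e d"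
  using spn_add[of u e d "\<lambda>i. - 1 * v i"] spn_scale[of v e d "- 1"] by simp

lemma spn_sum: "(\<And>k. k \<in> L \<Longrightarrow> u k \<in> spn e d) \<Longrightarrow> (\<lambda>i. \<Sum>k\<in>L. u k i) \<in> spn e d"
  by (induction L rule: infinite_finite_induct) (simp_all add: spn_zero spn_add)

lemma spn_mono:
  assumes "d \<le> d'"
  shows "spn e d \<subseteq> spn e d'"
proof
  fix u assume "u \<in> spn e d"
  then obtain c where "u = (\<lambda>i. \<Sum>l<d. c l * e l i)" by (auto simp: spn_def)
  also have "\<dots> = (\<lambda>i. \<Sum>l<d'. (if l < d then c l else 0) * e l i)"
  proof
    fix i
    show "(\<Sum>l<d. c l * e l i) = (\<Sum>l<d'. (if l < d then c l else 0) * e l i)"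
      by (rule sum.mono_neutral_cong_left) (use assms in auto)
  qed
  finally show "u \<in> spn e d'" by (rule spnI)
qed

lemma spn_basis: "l < d \<Longrightarrow> e l \<in> spn e d"
  by (rule spnI[of _ "\<lambda>k. if k = l then 1 else 0"]) (simp add: if_distrib[of "\<lambda>x. x * _"] cong: if_cong)

lemma spn_cong: "(\<And>l. l < d \<Longrightarrow> e l = e' l) \<Longrightarrow> spn e d = spn e' d"
  unfolding spn_def by (auto intro!: exI sum.cong)

text \<open>The functionals \<open>\<phi>\<close> both certify linear independence and read off
  coordinates, and they supply the row factor of the rank one corrections.\<close>

definition flag :: "nat \<Rightarrow> (nat \<Rightarrow> 'i \<Rightarrow> complex) \<Rightarrow> (nat \<Rightarrow> 'i \<Rightarrow> complex) \<Rightarrow> bool" where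
  "flag d e \<phi> \<longleftrightarrow> (\<forall>k<d. l2 (e k) \<and> l2 (\<phi> k) \<and> T (e k) \<in> spn e k)
     \<and> (\<forall>j<d. \<forall>k<d. dot (\<phi> j) (e k) = (if j = k then 1 else 0))"

lemma flagD:
  assumes "flag d e \<phi>"
  shows "k < d \<Longrightarrow> l2 (e k)" "k < d \<Longrightarrow> l2 (\<phi> k)" "k < d \<Longrightarrow> T (e k) \<in> spn e k"
    "j < d \<Longrightarrow> k < d \<Longrightarrow> dot (\<phi> j) (e k) = (if j = k then 1 else 0)"
  using assms by (auto simp: flag_def)

lemma spn_l2:
  assumes "\<And>k. k < d \<Longrightarrow> l2 (e k)" "u \<in> spn e d"
  shows "l2 u"
  using assms by (auto simp: spn_def intro!: l2_sum l2_scale)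

text \<open>\<open>T\<close> lowers the flag by one level. For \<open>n = 0\<close> the truncated
  \<open>n - 1\<close> is again 0, and the claim concerns only the zero family.\<close>

lemma T_spn:
  assumes "flag d e \<phi>" "n \<le> d" "u \<in> spn e n"
  shows "T u \<in> spn e (n - 1)"
proof -
  obtain c where c: "u = (\<lambda>i. \<Sum>l<n. c l * e l i)" using assms(3) by (auto simp: spn_def)
  have "T u = (\<lambda>i. \<Sum>l<n. c l * T (e l) i)"
    unfolding c by (rule T_sum) (use assms flagD(1) in auto)
  also have "\<dots> \<in> spn e (n - 1)"
  proof (intro spn_sum spn_scale)
    fix l assume "l \<in> {..<n}"
    then have "T (e l) \<in> spn e l" "l \<le> n - 1" using flagD(3)[OF assms(1), of l] assms(2) by auto
    then show "T (e l) \<in> spn e (n - 1)" using spn_mono by blast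
  qed
  finally show ?thesis .
qed

lemma l2_T_flag:
  assumes "flag d e \<phi>" "k < d"
  shows "l2 (T (e k))"
  by (rule spn_l2[of k e]) (use assms flagD in auto)

text \<open>Rank one corrections of K are chosen such that 1 + Q acts as the diagonal G on the flag.\<close>

definition Q :: "(nat \<Rightarrow> 'i \<Rightarrow> complex) \<Rightarrow> (nat \<Rightarrow> 'i \<Rightarrow> complex) \<Rightarrow> nat \<Rightarrow> complex \<Rightarrow> 'i \<Rightarrow> 'i \<Rightarrow> complex" where
  "Q e \<phi> n \<mu> = (\<lambda>i j. K \<mu> i j + (\<Sum>l<n. (G i * ((1 - \<mu>) * e l i + T (e l) i)) * \<phi> l j))"

lemma l2_correction:
  assumes "flag d e \<phi>" "k < d"
  shows "l2 (\<lambda>i. G i * (a * e k i + T (e k) i))"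
  by (intro l2_G l2_add l2_scale flagD(1)[OF assms] l2_T_flag[OF assms])

lemma hs_Q: "flag d e \<phi> \<Longrightarrow> n \<le> d \<Longrightarrow> hs (Q e \<phi> n \<mu>)"
  unfolding Q_def by (intro hs_add hs_K hs_sum hs_outer) (auto intro: l2_correction flagD(2))

lemma one_plus_Q:
  assumes f: "flag d e \<phi>" and n: "n \<le> d" and u: "l2 u"
  shows "u i + app (Q e \<phi> n \<mu>) u i
    = G i * (\<mu> * u i - T u i + (\<Sum>l<n. dot (\<phi> l) u * ((1 - \<mu>) * e l i + T (e l) i)))"
proof -
  let ?x = "\<lambda>l i. G i * ((1 - \<mu>) * e l i + T (e l) i)"
  have hx: "hs (\<lambda>i j. ?x l i * \<phi> l j)" if "l < n" for l
    using that n f by (intro hs_outer l2_correction[OF f] flagD(2)[OF f]) auto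
  have "app (Q e \<phi> n \<mu>) u i = app (K \<mu>) u i + app (\<lambda>i j. \<Sum>l<n. ?x l i * \<phi> l j) u i"
    unfolding Q_def by (rule app_add_op[OF hs_K hs_sum u]) (use hx in auto)
  also have "app (\<lambda>i j. \<Sum>l<n. ?x l i * \<phi> l j) u i = (\<Sum>l<n. dot (\<phi> l) u * ?x l i)"
  proof -
    have "app (\<lambda>i j. \<Sum>l<n. ?x l i * \<phi> l j) u i = dot u (\<lambda>j. \<Sum>l<n. ?x l i * \<phi> l j)"
      by (simp add: app_def dot_commute[of _ u])
    also have "\<dots> = (\<Sum>l<n. dot u (\<lambda>j. ?x l i * \<phi> l j))"
      by (rule dot_sum[OF u]) (use n flagD(2)[OF f] in \<open>auto intro!: l2_scale\<close>)
    also have "\<dots> = (\<Sum>l<n. dot (\<phi> l) u * ?x l i)"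
      by (intro sum.cong refl) (simp only: dot_scale, simp only: dot_commute[of u] mult.commute[of "dot _ u"])
    finally show ?thesis .
  qed
  finally have "u i + app (Q e \<phi> n \<mu>) u i = G i * (\<mu> * u i - T u i) + (\<Sum>l<n. dot (\<phi> l) u * ?x l i)"
    using one_plus_K[OF u, of i \<mu>] by (simp add: add.assoc[symmetric])
  also have "(\<Sum>l<n. dot (\<phi> l) u * ?x l i) = G i * (\<Sum>l<n. dot (\<phi> l) u * ((1 - \<mu>) * e l i + T (e l) i))"
    by (simp add: sum_distrib_left mult.left_commute)
  finally show ?thesis by (simp add: distrib_left)
qed

text \<open>The correction (1 - \<mu>) e_l + T e_l completes \<mu> e_l - T e_l to e_l, and
  biorthogonality attaches to it the l-th coordinate of \<open>u\<close>.\<close>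

lemma one_plus_Q_spn:
  assumes f: "flag d e \<phi>" and n: "n \<le> d" and u: "u \<in> spn e n"
  shows "u i + app (Q e \<phi> n \<mu>) u i = G i * u i"
proof -
  obtain c where c: "u = (\<lambda>i. \<Sum>l<n. c l * e l i)" using u by (auto simp: spn_def)
  have l: "l2 (e k)" if "k < n" for k using that n flagD(1)[OF f] by auto
  have ul: "l2 u" by (rule spn_l2[OF l u])
  have d: "dot (\<phi> l) u = c l" if "l < n" for l
  proof -
    have "dot (\<phi> l) u = (\<Sum>k<n. dot (\<phi> l) (\<lambda>i. c k * e k i))"
      unfolding c by (rule dot_sum) (use that n flagD[OF f] in \<open>auto intro: l2_scale\<close>)
    also have "\<dots> = (\<Sum>k<n. c k * (if l = k then 1 else 0))"
      by (intro sum.cong refl) (use that n flagD(4)[OF f, of l] in \<open>simp add: dot_scale\<close>)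
    also have "\<dots> = c l" using that by (simp add: if_distrib[of "\<lambda>x. _ * x"] cong: if_cong)
    finally show ?thesis .
  qed
  have "T u i = (\<Sum>l<n. c l * T (e l) i)" unfolding c by (subst T_sum) (use l in auto)
  moreover have "(\<Sum>l<n. dot (\<phi> l) u * ((1 - \<mu>) * e l i + T (e l) i)) = (\<Sum>l<n. c l * ((1 - \<mu>) * e l i + T (e l) i))"
    using d by (intro sum.cong) auto
  moreover have "\<dots> = (1 - \<mu>) * (\<Sum>l<n. c l * e l i) + (\<Sum>l<n. c l * T (e l) i)"
    by (simp add: distrib_left sum.distrib sum_distrib_left mult.left_commute)
  moreover have "(\<Sum>l<n. c l * e l i) = u i" using c by simp
  ultimately show ?thesis unfolding one_plus_Q[OF f n ul] by (simp add: algebra_simps)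
qed

text \<open>Each step adds one correction and divides out one factor \<mu>. The remaining exponent
  is affine in \<mu>, so the exponential factor is entire and has no zeros.\<close>

lemma det2_K_factor:
  assumes f: "flag d e \<phi>" and "n \<le> d"
  shows "\<exists>\<alpha> \<beta>. \<forall>\<mu>. det2 (K \<mu>) = \<mu> ^ n * exp (\<alpha> + \<beta> * \<mu>) * det2 (Q e \<phi> n \<mu>)"
  using assms(2)
proof (induction n)
  case 0
  then show ?case by (intro exI[of _ 0]) (simp add: Q_def)
next
  case (Suc n)
  then have n: "n < d" by simp
  from Suc obtain \<alpha> \<beta> where IH: "\<And>\<mu>. det2 (K \<mu>) = \<mu> ^ n * exp (\<alpha> + \<beta> * \<mu>) * det2 (Q e \<phi> n \<mu>)" by auto
  let ?a = "dot (\<phi> n) (\<lambda>i. G i * e n i)" and ?b = "dot (\<phi> n) (\<lambda>i. G i * T (e n) i)"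
  have step: "det2 (Q e \<phi> n \<mu>) = det2 (Q e \<phi> (Suc n) \<mu>) * \<mu> * exp ((1 - \<mu>) * ?a + ?b)" for \<mu>
  proof -
    let ?x = "\<lambda>i. G i * ((1 - \<mu>) * e n i + T (e n) i)"
    \<comment> \<open>\<open>?x = - G * ?p\<close>, and \<open>?p\<close> lies in the span of the
      first n + 1 vectors, where 1 + \<open>Q e \<phi> (Suc n) \<mu>\<close> acts as G. So
      \<open>?p\<close> solves the equation that \<open>det2_rank_one\<close> asks for, without any
      inversion.\<close>
    let ?p = "\<lambda>i. (\<mu> - 1) * e n i - T (e n) i"
    have pn: "?p \<in> spn e (Suc n)"
      using spn_basis[of n "Suc n" e] flagD(3)[OF f n] spn_mono[of n "Suc n" e] by (intro spn_diff spn_scale) auto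
    have "det2 (\<lambda>i j. Q e \<phi> (Suc n) \<mu> i j - ?x i * \<phi> n j) = det2 (Q e \<phi> (Suc n) \<mu>) * (1 + dot (\<phi> n) ?p) * exp (dot (\<phi> n) ?x)"
    proof (rule det2_rank_one)
      show "hs (Q e \<phi> (Suc n) \<mu>)" using f n by (intro hs_Q) auto
      show "l2 ?p" by (intro l2_diff l2_scale flagD(1)[OF f n] l2_T_flag[OF f n])
      show "l2 ?x" by (rule l2_correction[OF f n])
      show "l2 (\<phi> n)" by (rule flagD(2)[OF f n])
      show "?p i + app (Q e \<phi> (Suc n) \<mu>) ?p i = - ?x i" for i
        using one_plus_Q_spn[OF f Suc.prems pn, of i \<mu>] by (simp add: algebra_simps)
    qed
    also have "(\<lambda>i j. Q e \<phi> (Suc n) \<mu> i j - ?x i * \<phi> n j) = Q e \<phi> n \<mu>"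
      by (auto simp: Q_def fun_eq_iff)
    \<comment> \<open>\<phi>_n vanishes on T e_n, a combination of earlier vectors, and is 1 on e_n,
      which leaves 1 + (\<mu> - 1).\<close>
    also have "1 + dot (\<phi> n) ?p = \<mu>"
    proof -
      obtain c where c: "T (e n) = (\<lambda>i. \<Sum>l<n. c l * e l i)" using flagD(3)[OF f n] by (auto simp: spn_def)
      have "dot (\<phi> n) (T (e n)) = (\<Sum>l<n. dot (\<phi> n) (\<lambda>i. c l * e l i))"
        unfolding c by (rule dot_sum) (use n flagD(1,2)[OF f] in \<open>auto intro: l2_scale\<close>)
      also have "\<dots> = 0" by (rule sum.neutral) (use n flagD(4)[OF f] in \<open>auto simp: dot_scale\<close>)
      finally have "dot (\<phi> n) (T (e n)) = 0" .
      then show ?thesis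
        using dot_diff[OF flagD(2)[OF f n] l2_scale[OF flagD(1)[OF f n]] l2_T_flag[OF f n], of "\<mu> - 1"]
          flagD(4)[OF f n n] by (simp add: dot_scale)
    qed
    also have "dot (\<phi> n) ?x = (1 - \<mu>) * ?a + ?b"
    proof -
      have "?x = (\<lambda>i. (1 - \<mu>) * (G i * e n i) + G i * T (e n) i)" by (auto simp: fun_eq_iff algebra_simps)
      then show ?thesis
        using dot_add[OF flagD(2)[OF f n] l2_scale[OF l2_G[OF flagD(1)[OF f n]]] l2_G[OF l2_T_flag[OF f n]], of "1 - \<mu>"]
        by (simp only: dot_scale)
    qed
    finally show ?thesis .
  qed
  have "det2 (K \<mu>) = \<mu> ^ Suc n * exp ((\<alpha> + ?a + ?b) + (\<beta> - ?a) * \<mu>) * det2 (Q e \<phi> (Suc n) \<mu>)" for \<mu>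
  proof -
    have "exp (\<alpha> + \<beta> * \<mu>) * exp ((1 - \<mu>) * ?a + ?b) = exp ((\<alpha> + ?a + ?b) + (\<beta> - ?a) * \<mu>)"
      unfolding exp_add[symmetric] by (simp add: algebra_simps)
    from this[symmetric] show ?thesis unfolding IH step by (simp only: power_Suc mult_ac)
  qed
  then show ?case by blast
qed

section \<open>Finite order of the zero and bounded length of flags\<close>

lemma det2_Q_holomorphic:
  assumes f: "flag d e \<phi>" and n: "n \<le> d"
  shows "(\<lambda>\<mu>. det2 (Q e \<phi> n \<mu>)) holomorphic_on UNIV"
proof -
  let ?B0 = "\<lambda>i j. A i j + (\<Sum>l<n. (G i * (e l i + T (e l) i)) * \<phi> l j)"
  let ?B1 = "\<lambda>i j. (if i = j then G i else 0) - (\<Sum>l<n. (G i * e l i) * \<phi> l j)"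
  have "hs ?B0"
    by (intro hs_add hsA hs_sum hs_outer) (use n l2_correction[OF f, of _ 1] flagD(2)[OF f] in auto)
  moreover have "hs ?B1"
    by (intro hs_diff hs_diag_G hs_sum hs_outer l2_G) (use n flagD(1,2)[OF f] in auto)
  ultimately have "(\<lambda>\<mu>. det2 (\<lambda>i j. ?B0 i j + \<mu> * ?B1 i j)) holomorphic_on UNIV" by (rule det2_holomorphic)
  moreover have "(\<lambda>i j. ?B0 i j + \<mu> * ?B1 i j) = Q e \<phi> n \<mu>" for \<mu>
    by (auto simp: Q_def K_def fun_eq_iff algebra_simps sum_distrib_left sum.distrib sum_subtractf)
  ultimately show ?thesis by simp
qed

text \<open>1 + K(t) = (1 + t G)(1 + B) with B = A divided row by row by 1 + t g. A kernel is
  excluded once \<open>B\<close> has norm below 1. As the weights have no positive lower bound in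
  general, large t shrinks only the part in a finite section; the rest must already be small in
  \<open>A\<close>. Each part gets the share 1/2.\<close>

lemma det2_K_nonzero: "\<exists>\<mu>. det2 (K \<mu>) \<noteq> 0"
proof -
  have "eventually (\<lambda>n. hsn (htail n A) < 1/2) sequentially"
    by (rule order_tendstoD(2)[OF hsn_htail_lim[OF hsA]]) simp
  then obtain n where n: "hsn (htail n A) < 1/2" by (auto simp: eventually_sequentially)
  obtain m where m: "m > 0" "\<And>i. i \<in> S n \<Longrightarrow> m \<le> g i"
  proof (cases "S n = {}")
    case True then show ?thesis using that[of 1] by simp
  next
    case False then show ?thesis using that[of "Min (g ` S n)"] fin[of n] gpos by simp
  qed
  \<comment> \<open>Makes \<open>t * m\<close> equal to \<open>2 * hsn A\<close>, so the section
    part is at most \<open>hsn A / (1 + 2 * hsn A) < 1/2\<close>.\<close>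
  define t where "t = 2 * hsn A / m"
  have t: "t \<ge> 0" "hsn A / (1 + t * m) < 1/2"
  proof -
    show "t \<ge> 0" using m by (simp add: t_def)
    have "1 + t * m = 1 + 2 * hsn A" using m by (simp add: t_def)
    moreover have "0 < 1 + 2 * hsn A" using nrm_nonneg[of "\<lambda>(i,j). A i j"] by linarith
    ultimately show "hsn A / (1 + t * m) < 1/2" by (simp only: divide_less_eq if_True) simp
  qed
  have pos: "1 + t * g i \<ge> 1" for i using t gpos[of i] by simp
  define B1 where "B1 i j = (if i \<in> S n \<and> j \<in> S n then A i j / of_real (1 + t * g i) else 0)" for i j
  define B2 where "B2 i j = htail n A i j / of_real (1 + t * g i)" for i j
  have "cmod (case p of (i,j) \<Rightarrow> B1 i j) \<le> cmod (of_real (1 / (1 + t * m)) * (case p of (i,j) \<Rightarrow> A i j))" for p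
  proof (cases p)
    case (Pair i j)
    have "cmod (A i j / of_real (1 + t * g i)) \<le> cmod (A i j) / (1 + t * m)" if "i \<in> S n"
    proof -
      have "1 + t * m \<le> 1 + t * g i" using m(2)[OF that] t by (simp add: mult_left_mono)
      moreover have "1 + t * m > 0" using t m by (simp add: add_pos_nonneg)
      ultimately show ?thesis using pos[of i] unfolding norm_divide norm_of_real
        by (intro frac_le) auto
    qed
    moreover have "cmod (of_real (1 / (1 + t * m)) * A i j) = cmod (A i j) / (1 + t * m)"
      unfolding norm_mult norm_of_real using t m by (simp add: add_nonneg_nonneg)
    ultimately show ?thesis using Pair t m by (auto simp: B1_def simp del: of_real_divide)
  qed
  from l2_comparison[OF l2_scale[OF hsA] this]
  have B1: "hs B1" "hsn B1 \<le> hsn A / (1 + t * m)"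
    using t(1) m unfolding nrm_scale norm_of_real by (auto simp: add_nonneg_nonneg)
  have "cmod (case p of (i,j) \<Rightarrow> B2 i j) \<le> cmod (case p of (i,j) \<Rightarrow> htail n A i j)" for p
  proof (cases p)
    case (Pair i j)
    have "cmod (htail n A i j) / \<bar>1 + t * g i\<bar> \<le> cmod (htail n A i j) / 1" using pos[of i] by (intro divide_left_mono) auto
    then show ?thesis unfolding Pair B2_def by (simp only: norm_divide norm_of_real split_conv div_by_1)
  qed
  from l2_comparison[OF hs_htail[OF hsA] this] have B2: "hs B2" "hsn B2 < 1/2" using n by auto
  define B where "B i j = B1 i j + B2 i j" for i j
  have B: "hs B" "hsn B < 1"
    using hs_add[OF B1(1) B2(1)] hsn_add[OF B1(1) B2(1)] B1(2) B2(2) t(2) unfolding B_def by (simp, linarith)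
  have "det2 (K (of_real t)) \<noteq> 0"
  proof
    assume "det2 (K (of_real t)) = 0"
    then obtain u where u: "l2 u" "u \<noteq> (\<lambda>i. 0)" "\<And>i. u i + app (K (of_real t)) u i = 0"
      unfolding det2_eq_0_iff[OF hs_K] by blast
    have "app B u i = - u i" for i
    proof -
      have "B i = (\<lambda>j. inverse (of_real (1 + t * g i)) * A i j)"
        by (auto simp: fun_eq_iff B_def B1_def B2_def htail_def divide_inverse)
      then have "app B u i = inverse (of_real (1 + t * g i)) * app A u i"
        using dot_scale[of u "inverse (of_real (1 + t * g i))" "A i"] by (simp add: app_def dot_commute[of _ u] del: of_real_add)
      moreover have "app A u i = - (of_real (1 + t * g i) * u i)"
      proof -
        have 1: "G i * T u i = of_real t * G i * u i"
          using u(3)[of i] unfolding one_plus_K[OF u(1)] by simp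
        have "app A u i = (u i + app A u i) - u i" by simp
        also have "\<dots> = - (of_real t * G i * u i) - u i" unfolding one_plus_A 1 ..
        also have "\<dots> = - (of_real (1 + t * g i) * u i)" by (simp add: G_def algebra_simps)
        finally show ?thesis .
      qed
      moreover have "(of_real (1 + t * g i) :: complex) \<noteq> 0" using pos[of i] by (simp del: of_real_add)
      ultimately show ?thesis by (simp del: of_real_add)
    qed
    then have "nrm u = nrm (app B u)" by (simp add: nrm_def)
    also have "\<dots> \<le> hsn B * nrm u" by (rule nrm_app[OF B(1) u(1)])
    finally have "nrm u * (1 - hsn B) \<le> 0" by (simp add: algebra_simps)
    then have "nrm u = 0" using B(2) nrm_nonneg[of u] by (simp add: mult_le_0_iff)
    then show False using u(2) nrm_eq_0[OF u(1)] by auto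
  qed
  then show ?thesis by blast
qed

text \<open>Removing from \<open>u\<close> its components along the flag gives a new vector that the
  old functionals annihilate, and leaves its image under \<open>T\<close> in the old span.\<close>

lemma flag_extend:
  assumes f: "flag d e \<phi>" and u: "l2 u" "T u \<in> spn e d" "u \<notin> spn e d"
  shows "\<exists>e' \<phi>'. flag (Suc d) e' \<phi>'"
proof -
  define w where "w = (\<lambda>i. u i - (\<Sum>l<d. dot (\<phi> l) u * e l i))"
  have sl: "l2 (\<lambda>i. \<Sum>l<d. dot (\<phi> l) u * e l i)" by (intro l2_sum l2_scale) (use flagD(1)[OF f] in auto)
  have wl: "l2 w" unfolding w_def by (intro l2_diff u sl)
  have sp: "(\<lambda>i. \<Sum>l<d. dot (\<phi> l) u * e l i) \<in> spn e d" by (rule spnI[OF refl])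
  have "T w = (\<lambda>i. T u i - T (\<lambda>i. \<Sum>l<d. dot (\<phi> l) u * e l i) i)"
    unfolding w_def by (rule T_diff[OF u(1) sl])
  also have "\<dots> \<in> spn e d"
    using T_spn[OF f order_refl sp] spn_mono[of "d - 1" d e] by (intro spn_diff u) auto
  finally have Tw: "T w \<in> spn e d" .
  have "w \<noteq> (\<lambda>i. 0)"
  proof
    assume "w = (\<lambda>i. 0)"
    then have "u = (\<lambda>i. \<Sum>l<d. dot (\<phi> l) u * e l i)" by (auto simp: w_def fun_eq_iff)
    then show False using u(3) sp by simp
  qed
  then obtain a where a: "w a \<noteq> 0" by auto
  have dw: "dot (\<phi> k) w = 0" if "k < d" for k
  proof -
    have "dot (\<phi> k) w = dot (\<phi> k) u - dot (\<phi> k) (\<lambda>i. \<Sum>l<d. dot (\<phi> l) u * e l i)"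
      unfolding w_def by (rule dot_diff[OF flagD(2)[OF f that] u(1) sl])
    also have "dot (\<phi> k) (\<lambda>i. \<Sum>l<d. dot (\<phi> l) u * e l i) = (\<Sum>l<d. dot (\<phi> k) (\<lambda>i. dot (\<phi> l) u * e l i))"
      by (rule dot_sum) (use that flagD(1,2)[OF f] in \<open>auto intro: l2_scale\<close>)
    also have "\<dots> = (\<Sum>l<d. dot (\<phi> l) u * (if k = l then 1 else 0))"
      by (intro sum.cong refl) (use that flagD(4)[OF f, of k] in \<open>simp add: dot_scale\<close>)
    also have "\<dots> = dot (\<phi> k) u" using that by (simp add: if_distrib[of "\<lambda>x. _ * x"] cong: if_cong)
    finally show ?thesis by simp
  qed
  \<comment> \<open>The coordinate functional at \<open>a\<close>, where \<open>w\<close> is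
    nonzero, corrected to vanish on the old vectors and normalised to be 1 on
    \<open>w\<close>.\<close>
  define \<psi> where "\<psi> = (\<lambda>i. inverse (w a) * ((if i = a then 1 else 0) - (\<Sum>l<d. e l a * \<phi> l i)))"
  have dl: "l2 (\<lambda>i. if i = a then 1 else 0 :: complex)" by (intro l2_finite_support) simp
  have fl: "l2 (\<lambda>i. \<Sum>l<d. e l a * \<phi> l i)" by (intro l2_sum l2_scale) (use flagD(2)[OF f] in auto)
  have pl: "l2 \<psi>" unfolding \<psi>_def by (intro l2_scale l2_diff dl fl)
  have dpsi: "dot \<psi> v = inverse (w a) * (v a - (\<Sum>l<d. e l a * dot (\<phi> l) v))" if v: "l2 v" for v
  proof -
    have "dot v (\<lambda>i. \<Sum>l<d. e l a * \<phi> l i) = (\<Sum>l<d. dot v (\<lambda>i. e l a * \<phi> l i))"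
      by (rule dot_sum[OF v]) (use flagD(2)[OF f] in \<open>auto intro: l2_scale\<close>)
    then have "dot v (\<lambda>i. \<Sum>l<d. e l a * \<phi> l i) = (\<Sum>l<d. e l a * dot (\<phi> l) v)"
      by (simp only: dot_scale dot_commute[of v])
    moreover have "dot v (\<lambda>i. if i = a then 1 else 0) = v a"
      using dot_delta[of a 1 v] by (simp add: dot_commute[of v])
    ultimately show ?thesis
      unfolding dot_commute[of \<psi>] unfolding \<psi>_def dot_scale dot_diff[OF v dl fl] by simp
  qed
  have psi_w: "dot \<psi> w = 1" unfolding dpsi[OF wl] using dw a by simp
  have psi_e: "dot \<psi> (e k) = 0" if k: "k < d" for k
  proof -
    have "(\<Sum>l<d. e l a * dot (\<phi> l) (e k)) = (\<Sum>l<d. e l a * (if l = k then 1 else 0))"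
      by (intro sum.cong refl) (use k flagD(4)[OF f] in simp)
    also have "\<dots> = e k a" using k by (simp add: if_distrib[of "\<lambda>x. _ * x"] cong: if_cong)
    finally show ?thesis unfolding dpsi[OF flagD(1)[OF f k]] by simp
  qed
  let ?e = "e(d := w)" and ?\<phi> = "\<phi>(d := \<psi>)"
  have sc: "spn ?e k = spn e k" if "k \<le> d" for k by (rule spn_cong) (use that in auto)
  have "flag (Suc d) ?e ?\<phi>"
    unfolding flag_def
  proof (intro conjI allI impI)
    fix k assume k: "k < Suc d"
    show "l2 (?e k)" "l2 (?\<phi> k)" using k wl pl flagD(1,2)[OF f] by (auto simp: less_Suc_eq)
    show "T (?e k) \<in> spn ?e k" unfolding sc[OF less_Suc_eq_le[THEN iffD1, OF k]]
      using k Tw flagD(3)[OF f] by (auto simp: less_Suc_eq)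
    fix j assume j: "j < Suc d"
    show "dot (?\<phi> j) (?e k) = (if j = k then 1 else 0)"
      using j k psi_w psi_e dw flagD(4)[OF f] by (auto simp: less_Suc_eq)
  qed
  then show ?thesis by blast
qed

text \<open>A flag of length d produces a zero of order at least d at 0, while the determinant, not
  being identically zero, has finite order \<open>N\<close> there. The case of a nonzero value at 0
  is separate because the factorisation theorem starts from a zero.\<close>

lemma flag_bounded: "\<exists>N. \<forall>d e \<phi>. flag d e \<phi> \<longrightarrow> d \<le> N"
proof -
  let ?D = "\<lambda>\<mu>. det2 (K \<mu>)"
  have hol: "?D holomorphic_on UNIV"
    unfolding K_def by (rule det2_holomorphic[OF hsA hs_diag_G])
  show ?thesis
  proof (cases "?D 0 = 0")
    case False
    have "d = 0" if f: "flag d e \<phi>" for d e \<phi>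
    proof (rule ccontr)
      assume "d \<noteq> 0"
      with det2_K_factor[OF f order_refl] have "?D 0 = 0" by (auto simp: zero_power)
      with False show False by simp
    qed
    then show ?thesis by blast
  next
    case True
    obtain \<mu>0 where "?D \<mu>0 \<noteq> 0" using det2_K_nonzero by blast
    with True have "\<not> ?D constant_on UNIV" unfolding constant_on_def by (metis UNIV_I)
    from holomorphic_factor_zero_nonconstant[OF hol open_UNIV connected_UNIV UNIV_I True this]
    obtain q r N where r: "0 < r" and q: "q holomorphic_on ball 0 r" "\<And>w. w \<in> ball 0 r \<Longrightarrow> ?D w = (w - 0) ^ N * q w"
      and q0: "\<And>w. w \<in> ball 0 r \<Longrightarrow> q w \<noteq> 0" by metis
    have "d \<le> N" if f: "flag d e \<phi>" for d e \<phi>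
    proof (rule ccontr)
      assume "\<not> d \<le> N"
      then have d: "d = N + (d - N)" "d - N > 0" by auto
      obtain \<alpha> \<beta> where ab: "\<And>\<mu>. ?D \<mu> = \<mu> ^ d * exp (\<alpha> + \<beta> * \<mu>) * det2 (Q e \<phi> d \<mu>)"
        using det2_K_factor[OF f order_refl] by blast
      \<comment> \<open>Equal to \<open>q\<close> off 0, hence also at 0 by continuity; but for d >
        N it vanishes there and \<open>q\<close> does not.\<close>
      define h where "h \<mu> = \<mu> ^ (d - N) * (exp (\<alpha> + \<beta> * \<mu>) * det2 (Q e \<phi> d \<mu>))" for \<mu>
      have hh: "h holomorphic_on UNIV"
        unfolding h_def by (intro holomorphic_intros det2_Q_holomorphic[OF f order_refl])
      have eq: "q w = h w" if w: "w \<in> ball 0 r - {0}" for w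
      proof -
        have "w ^ N * q w = w ^ d * exp (\<alpha> + \<beta> * w) * det2 (Q e \<phi> d w)" using q(2)[of w] ab[of w] w by auto
        also have "w ^ d = w ^ N * w ^ (d - N)" by (subst d(1)) (rule power_add)
        finally show ?thesis using w by (simp add: h_def)
      qed
      have "isCont q 0" "isCont h 0"
        using continuous_on_interior[OF holomorphic_on_imp_continuous_on[OF q(1)], of 0]
          continuous_on_interior[OF holomorphic_on_imp_continuous_on[OF hh], of 0] r by auto
      then have "(q \<longlongrightarrow> q 0) (at 0)" "(h \<longlongrightarrow> h 0) (at 0)" by (auto simp: isCont_def)
      moreover have "eventually (\<lambda>w. q w = h w) (at 0)"
        unfolding eventually_at using r eq by (auto intro!: exI[of _ r] simp: dist_norm)
      ultimately have "q 0 = h 0" by (metis tendsto_cong tendsto_unique trivial_limit_at)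
      moreover have "h 0 = 0" using d(2) by (simp add: h_def zero_power)
      ultimately show False using q0[of 0] r by simp
    qed
    then show ?thesis by blast
  qed
qed

text \<open>Bounded length provides a flag of maximal length \<open>d\<close>. Its maximality is
  used twice: its span is the whole generalised kernel, and the cofactor of \<mu>^d does not vanish
  at 0.\<close>

theorem order_eq_dim_generalised_kernel:
  obtains d e h where
    "h holomorphic_on UNIV" "h 0 \<noteq> 0" "\<And>\<mu>. det2 (K \<mu>) = \<mu> ^ d * h \<mu>"
    "\<forall>c. (\<forall>i. (\<Sum>l<d. c l * e l i) = 0) \<longrightarrow> (\<forall>l<d. c l = 0)"
    "\<And>u. (\<exists>c. u = (\<lambda>i. \<Sum>l<d. c l * e l i)) \<longleftrightarrow> (\<exists>m. (\<forall>j<m. l2 ((T ^^ j) u)) \<and> (T ^^ m) u = (\<lambda>i. 0))"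
proof -
  obtain N where N: "\<And>d e \<phi>. flag d e \<phi> \<Longrightarrow> d \<le> N" using flag_bounded by blast
  define P where "P d \<longleftrightarrow> (\<exists>e \<phi>. flag d e \<phi>)" for d
  have P0: "P 0" by (simp add: P_def flag_def)
  have PN: "\<And>d. P d \<Longrightarrow> d \<le> N" using N unfolding P_def by blast
  define d where "d = Greatest P"
  have d: "P d" "\<And>d'. P d' \<Longrightarrow> d' \<le> d"
    unfolding d_def using GreatestI_nat[of P, OF P0 PN] Greatest_le_nat[of P, OF _ PN] by simp_all
  then obtain e \<phi> where f: "flag d e \<phi>" unfolding P_def by blast
  \<comment> \<open>The span absorbs every square summable preimage under \<open>T\<close>, since
    such a vector outside it would extend the flag.\<close>
  have maximal: "u \<in> spn e d" if "l2 u" "T u \<in> spn e d" for u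
    using flag_extend[OF f that] d(2)[of "Suc d"] unfolding P_def by (meson Suc_n_not_le_n)
  obtain \<alpha> \<beta> where ab: "\<And>\<mu>. det2 (K \<mu>) = \<mu> ^ d * exp (\<alpha> + \<beta> * \<mu>) * det2 (Q e \<phi> d \<mu>)"
    using det2_K_factor[OF f order_refl] by blast
  \<comment> \<open>At \<mu> = 0 a kernel vector \<open>u\<close> has \<open>T u\<close> in the
    span, hence lies in the span itself, where 1 + Q is multiplication by the nonvanishing
    G.\<close>
  have nz: "det2 (Q e \<phi> d 0) \<noteq> 0"
  proof
    assume "det2 (Q e \<phi> d 0) = 0"
    then obtain u where u: "l2 u" "u \<noteq> (\<lambda>i. 0)" "\<And>i. u i + app (Q e \<phi> d 0) u i = 0"
      unfolding det2_eq_0_iff[OF hs_Q[OF f order_refl]] by blast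
    have "T u = (\<lambda>i. \<Sum>l<d. dot (\<phi> l) u * (e l i + T (e l) i))"
    proof
      fix i
      have "G i * (- T u i + (\<Sum>l<d. dot (\<phi> l) u * (e l i + T (e l) i))) = 0"
        using u(3)[of i] one_plus_Q[OF f order_refl u(1), of i 0] by simp
      then have "- T u i + (\<Sum>l<d. dot (\<phi> l) u * (e l i + T (e l) i)) = 0" by (simp only: mult_eq_0_iff G_nonzero simp_thms)
      then show "T u i = (\<Sum>l<d. dot (\<phi> l) u * (e l i + T (e l) i))" by (simp add: neg_eq_iff_add_eq_0[symmetric])
    qed
    also have "\<dots> \<in> spn e d"
    proof (intro spn_sum spn_scale spn_add)
      fix l assume "l \<in> {..<d}"
      then have l: "l < d" by simp
      show "e l \<in> spn e d" using l by (rule spn_basis)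
      show "T (e l) \<in> spn e d" using flagD(3)[OF f l] spn_mono[of l d e] l by auto
    qed
    finally have "u \<in> spn e d" by (rule maximal[OF u(1)])
    then have "G i * u i = 0" for i using one_plus_Q_spn[OF f order_refl, of u i 0] u(3)[of i] by simp
    then have "u i = 0" for i by simp
    then show False using u(2) by auto
  qed
  show ?thesis
  proof (rule that[where h = "\<lambda>\<mu>. exp (\<alpha> + \<beta> * \<mu>) * det2 (Q e \<phi> d \<mu>)" and d = d and e = e])
    show "(\<lambda>\<mu>. exp (\<alpha> + \<beta> * \<mu>) * det2 (Q e \<phi> d \<mu>)) holomorphic_on UNIV"
      by (intro holomorphic_intros det2_Q_holomorphic[OF f order_refl])
    show "exp (\<alpha> + \<beta> * 0) * det2 (Q e \<phi> d 0) \<noteq> 0" using nz by simp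
    show "det2 (K \<mu>) = \<mu> ^ d * (exp (\<alpha> + \<beta> * \<mu>) * det2 (Q e \<phi> d \<mu>))" for \<mu> using ab[of \<mu>] by simp
    show "\<forall>c. (\<forall>i. (\<Sum>l<d. c l * e l i) = 0) \<longrightarrow> (\<forall>l<d. c l = 0)"
    proof (intro allI impI)
      fix c l assume z: "\<forall>i. (\<Sum>l<d. c l * e l i) = 0" and l: "l < d"
      have "0 = dot (\<phi> l) (\<lambda>i. \<Sum>k<d. c k * e k i)" using z by simp
      also have "\<dots> = (\<Sum>k<d. dot (\<phi> l) (\<lambda>i. c k * e k i))"
        by (rule dot_sum) (use l flagD(1,2)[OF f] in \<open>auto intro: l2_scale\<close>)
      also have "\<dots> = (\<Sum>k<d. c k * (if l = k then 1 else 0))"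
        by (intro sum.cong refl) (use l flagD(4)[OF f, of l] in \<open>simp add: dot_scale\<close>)
      also have "\<dots> = c l" using l by (simp add: if_distrib[of "\<lambda>x. _ * x"] cong: if_cong)
      finally show "c l = 0" by simp
    qed
    show "(\<exists>c. u = (\<lambda>i. \<Sum>l<d. c l * e l i)) \<longleftrightarrow> (\<exists>m. (\<forall>j<m. l2 ((T ^^ j) u)) \<and> (T ^^ m) u = (\<lambda>i. 0))" for u
    proof
      assume "\<exists>c. u = (\<lambda>i. \<Sum>l<d. c l * e l i)"
      then have "u \<in> spn e d" by (simp add: spn_def)
      \<comment> \<open>As \<open>T\<close> lowers the flag by one level, its n-th power annihilates
        the span of the first n vectors; the exponent m = d serves the whole span.\<close>
      moreover have "(\<forall>j<n. l2 ((T ^^ j) u)) \<and> (T ^^ n) u = (\<lambda>i. 0)" if "n \<le> d" "u \<in> spn e n" for n u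
        using that
      proof (induction n arbitrary: u)
        case 0
        then show ?case by (auto simp: spn_def)
      next
        case (Suc n)
        have ul: "l2 u" by (rule spn_l2[OF _ Suc.prems(2)]) (use Suc.prems flagD(1)[OF f] in auto)
        have Tu: "T u \<in> spn e n" using T_spn[OF f Suc.prems] by simp
        have "n \<le> d" using Suc.prems(1) by simp
        note IH = Suc.IH[OF this Tu]
        have "l2 ((T ^^ j) u)" if "j < Suc n" for j
        proof (cases j)
          case 0
          then show ?thesis using ul by simp
        next
          case (Suc k)
          then have "k < n" using that by simp
          then show ?thesis unfolding Suc funpow_Suc_right o_apply using IH by blast
        qed
        then show ?case unfolding funpow_Suc_right o_apply using IH by blast
      qed
      ultimately show "\<exists>m. (\<forall>j<m. l2 ((T ^^ j) u)) \<and> (T ^^ m) u = (\<lambda>i. 0)" by blast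
    next
      assume "\<exists>m. (\<forall>j<m. l2 ((T ^^ j) u)) \<and> (T ^^ m) u = (\<lambda>i. 0)"
      then obtain m where "\<forall>j<m. l2 ((T ^^ j) u)" "(T ^^ m) u = (\<lambda>i. 0)" by blast
      then have "u \<in> spn e d"
      proof (induction m arbitrary: u)
        case 0
        then show ?case by (simp add: spn_zero)
      next
        case (Suc m)
        have "l2 ((T ^^ j) (T u))" if "j < m" for j
          using Suc.prems(1)[rule_format, of "Suc j"] that unfolding funpow_Suc_right o_apply by simp
        then have "\<forall>j<m. l2 ((T ^^ j) (T u))" by blast
        moreover have "(T ^^ m) (T u) = (\<lambda>i. 0)" using Suc.prems(2) unfolding funpow_Suc_right o_apply .
        ultimately have Tu: "T u \<in> spn e d" by (rule Suc.IH)
        have "l2 u" using Suc.prems(1)[rule_format, of 0] by simp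
        then show ?case using Tu by (rule maximal)
      qed
      then show "\<exists>c. u = (\<lambda>i. \<Sum>l<d. c l * e l i)" by (simp add: spn_def)
    qed
  qed
qed

end

no_notation fps_nth (infixl "$" 75)

section \<open>Fourier coefficients of square integrable functions\<close>

lemma integral_fourier_mode:
  assumes "X > 0"
  shows "((\<lambda>x. exp (\<i> * complex_of_real (2 * pi * of_int m * x / X))) has_integral (if m = 0 then of_real X else 0)) {0..X}"
proof (cases "m = 0")
  case True
  have "((\<lambda>x. 1 :: complex) has_integral (X - 0) *\<^sub>R 1) {0..X}"
    using has_integral_const_real[of "1::complex" 0 X] assms by simp
  then show ?thesis using True by (simp add: scaleR_conv_of_real)
next
  case False
  define a where "a = 2 * pi * of_int m / X"
  have a: "a \<noteq> 0" using False assms by (simp add: a_def)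
  let ?F = "\<lambda>z. exp (\<i> * of_real a * z) / (\<i> * of_real a)"
  have "((\<lambda>x. exp (\<i> * of_real a * of_real x)) has_integral (?F (of_real X) - ?F (of_real 0))) {0..X}"
  proof (rule fundamental_theorem_of_calculus)
    fix x :: real
    have "(?F has_field_derivative exp (\<i> * of_real a * of_real x)) (at (of_real x))"
      using a by (auto intro!: derivative_eq_intros)
    then show "((\<lambda>x. ?F (of_real x)) has_vector_derivative exp (\<i> * of_real a * of_real x)) (at x within {0..X})"
      by (rule has_vector_derivative_real_field)
  qed (use assms in simp)
  also have "?F (of_real X) - ?F (of_real 0) = 0"
  proof -
    have "\<i> * of_real a * of_real X = (2 * of_int m * pi) * \<i>" using assms by (simp add: a_def)
    then have "exp (\<i> * of_real a * of_real X) = 1" by (simp only: exp_integer_2pi[OF Ints_of_int])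
    then show ?thesis by simp
  qed
  also have "(\<lambda>x. exp (\<i> * of_real a * complex_of_real x)) = (\<lambda>x. exp (\<i> * complex_of_real (2 * pi * of_int m * x / X)))"
    by (simp add: a_def fun_eq_iff mult.assoc)
  finally show ?thesis using False by simp
qed

text \<open>Existence of the integrals behind \<open>fcoef\<close>: on a bounded interval |g| is
  dominated by the integrable function 1 + |g|^2.\<close>

lemma square_integrable_mult_bounded:
  fixes g e :: "real \<Rightarrow> complex"
  assumes g: "g \<in> borel_measurable lebesgue" "(\<lambda>x. (cmod (g x))\<^sup>2) integrable_on {0..X}"
    and e: "continuous_on UNIV e" "\<And>x. cmod (e x) \<le> 1"
  shows "(\<lambda>x. e x * g x) integrable_on {0..X}"
proof (rule measurable_bounded_by_integrable_imp_integrable)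
  have "e \<in> borel_measurable lebesgue"
    using borel_measurable_continuous_onI[OF e(1)] by (intro measurable_completion) simp
  then have "(\<lambda>x. e x * g x) \<in> borel_measurable lebesgue" using g(1) by (rule borel_measurable_times)
  then show "(\<lambda>x. e x * g x) \<in> borel_measurable (lebesgue_on {0..X})" by (rule measurable_restrict_space1)
  show "(\<lambda>x. 1 + (cmod (g x))\<^sup>2) integrable_on {0..X}" by (intro integrable_add g integrable_const_ivl)
  show "cmod (e x * g x) \<le> 1 + (cmod (g x))\<^sup>2" for x
  proof -
    have "cmod (e x * g x) \<le> cmod (g x)" using e(2)[of x] by (simp add: norm_mult mult_left_le_one_le)
    also have "\<dots> \<le> 1 + (cmod (g x))\<^sup>2"
      using zero_le_power2[of "cmod (g x) - 1"] norm_ge_zero[of "g x"] unfolding power2_diff by (simp, linarith)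
    finally show ?thesis .
  qed
qed simp

text \<open>Bessel's inequality: the mean square distance between \<open>g\<close> and a finite
  Fourier sum is nonnegative, and by orthogonality of the modes it equals I - X (sum of
  |c_k|^2).\<close>

lemma bessel_fcoef:
  assumes X: "X > 0" and g: "g \<in> borel_measurable lebesgue" "(\<lambda>x. (cmod (g x))\<^sup>2) integrable_on {0..X}"
  shows "l2 (fcoef X g)"
proof (rule l2_bounded(1))
  define E where "E k x = exp (\<i> * complex_of_real (2 * pi * of_int k * x / X))" for k x
  have cE: "cnj (E k x) = exp (- \<i> * complex_of_real (2 * pi * of_int k * x / X))" for k x
    by (simp add: E_def exp_cnj)
  have EE: "E k x * cnj (E l x) = E (k - l) x" for k l x
    unfolding cE by (simp add: E_def exp_add[symmetric] algebra_simps diff_divide_distrib)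
  define c where "c = fcoef X g"
  define I where "I = integral {0..X} (\<lambda>x. (cmod (g x))\<^sup>2)"
  have gE: "((\<lambda>x. cnj (E k x) * g x) has_integral of_real X * c k) {0..X}" for k
  proof -
    have "(\<lambda>x. cnj (E k x) * g x) integrable_on {0..X}"
      by (rule square_integrable_mult_bounded[OF g])
         (use X in \<open>auto simp: E_def norm_exp_eq_Re intro!: continuous_intros\<close>)
    then have "((\<lambda>x. cnj (E k x) * g x) has_integral integral {0..X} (\<lambda>x. cnj (E k x) * g x)) {0..X}"
      by (rule integrable_integral)
    also have "integral {0..X} (\<lambda>x. cnj (E k x) * g x) = of_real X * c k"
      using X unfolding c_def fcoef_def cE by simp
    finally show ?thesis .
  qed
  fix F :: "int set" assume F: "finite F"
  let ?s = "\<lambda>x. \<Sum>k\<in>F. c k * E k x"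
  have hI: "((\<lambda>x. of_real ((cmod (g x))\<^sup>2) :: complex) has_integral of_real I) {0..X}"
    unfolding I_def using integrable_integral[OF g(2)] by (rule has_integral_of_real)
  have h1: "((\<lambda>x. \<Sum>k\<in>F. cnj (c k) * (cnj (E k x) * g x)) has_integral (\<Sum>k\<in>F. cnj (c k) * (of_real X * c k))) {0..X}"
    by (intro has_integral_sum F has_integral_mult_right gE)
  have h2: "((\<lambda>x. cnj (\<Sum>k\<in>F. cnj (c k) * (cnj (E k x) * g x))) has_integral cnj (\<Sum>k\<in>F. cnj (c k) * (of_real X * c k))) {0..X}"
    using has_integral_cnj[THEN iffD2, OF h1] by (simp only: o_def)
  have h3: "((\<lambda>x. \<Sum>k\<in>F. \<Sum>l\<in>F. (c k * cnj (c l)) * E (k - l) x) has_integral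
      (\<Sum>k\<in>F. \<Sum>l\<in>F. (c k * cnj (c l)) * (if k - l = 0 then of_real X else 0))) {0..X}"
    unfolding E_def by (intro has_integral_sum F has_integral_mult_right integral_fourier_mode[OF X])
  have sum3: "(\<Sum>k\<in>F. \<Sum>l\<in>F. (c k * cnj (c l)) * (if k - l = 0 then of_real X else 0)) = of_real (X * (\<Sum>k\<in>F. (cmod (c k))\<^sup>2))"
  proof -
    have "(\<Sum>l\<in>F. (c k * cnj (c l)) * (if k - l = 0 then of_real X else 0)) = of_real (X * (cmod (c k))\<^sup>2)" if "k \<in> F" for k
    proof -
      have "(\<Sum>l\<in>F. (c k * cnj (c l)) * (if k - l = 0 then of_real X else 0)) = (\<Sum>l\<in>F. if l = k then (c k * cnj (c k)) * of_real X else 0)"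
        by (intro sum.cong) auto
      then show ?thesis using that F by (simp add: complex_norm_square del: of_real_power)
    qed
    then show ?thesis by (simp add: sum_distrib_left)
  qed
  have sum1: "(\<Sum>k\<in>F. cnj (c k) * (of_real X * c k)) = of_real (X * (\<Sum>k\<in>F. (cmod (c k))\<^sup>2))"
    by (simp add: sum_distrib_left complex_norm_square mult_ac del: of_real_power)
  \<comment> \<open>The four terms are the expansion of |g - s|^2; the two mixed terms and the
    square of s all have the integral X (sum of |c_k|^2), so one copy survives with a minus
    sign.\<close>
  have "((\<lambda>x. of_real ((cmod (g x))\<^sup>2) - (\<Sum>k\<in>F. cnj (c k) * (cnj (E k x) * g x))
       - cnj (\<Sum>k\<in>F. cnj (c k) * (cnj (E k x) * g x)) + (\<Sum>k\<in>F. \<Sum>l\<in>F. (c k * cnj (c l)) * E (k - l) x))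
     has_integral (of_real I - of_real (X * (\<Sum>k\<in>F. (cmod (c k))\<^sup>2)) - cnj (of_real (X * (\<Sum>k\<in>F. (cmod (c k))\<^sup>2)))
       + of_real (X * (\<Sum>k\<in>F. (cmod (c k))\<^sup>2)))) {0..X}"
    by (intro has_integral_add has_integral_diff hI h1[unfolded sum1] h2[unfolded sum1] h3[unfolded sum3])
  moreover have "of_real ((cmod (g x))\<^sup>2) - (\<Sum>k\<in>F. cnj (c k) * (cnj (E k x) * g x))
       - cnj (\<Sum>k\<in>F. cnj (c k) * (cnj (E k x) * g x)) + (\<Sum>k\<in>F. \<Sum>l\<in>F. (c k * cnj (c l)) * E (k - l) x)
       = of_real ((cmod (g x - ?s x))\<^sup>2)" for x
  proof -
    have a: "(\<Sum>k\<in>F. cnj (c k) * (cnj (E k x) * g x)) = g x * cnj (?s x)"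
      by (simp add: sum_distrib_left cnj_sum mult_ac)
    have "(\<Sum>k\<in>F. \<Sum>l\<in>F. (c k * cnj (c l)) * E (k - l) x) = (\<Sum>k\<in>F. \<Sum>l\<in>F. (c k * E k x) * cnj (c l * E l x))"
      unfolding EE[symmetric] by (intro sum.cong refl) (simp add: mult_ac)
    then have b: "(\<Sum>k\<in>F. \<Sum>l\<in>F. (c k * cnj (c l)) * E (k - l) x) = ?s x * cnj (?s x)"
      by (simp add: sum_product cnj_sum)
    show ?thesis unfolding a b complex_norm_square by (simp add: algebra_simps)
  qed
  ultimately have "((\<lambda>x. of_real ((cmod (g x - ?s x))\<^sup>2)) has_integral complex_of_real (I - X * (\<Sum>k\<in>F. (cmod (c k))\<^sup>2))) {0..X}"
    by simp
  then have "((\<lambda>x. Re (of_real ((cmod (g x - ?s x))\<^sup>2))) has_integral Re (complex_of_real (I - X * (\<Sum>k\<in>F. (cmod (c k))\<^sup>2)))) {0..X}"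
    by (rule has_integral_Re)
  then have "0 \<le> I - X * (\<Sum>k\<in>F. (cmod (c k))\<^sup>2)"
    unfolding Re_complex_of_real by (rule has_integral_nonneg) simp
  then have "(\<Sum>k\<in>F. (cmod (c k))\<^sup>2) \<le> I / X" using X by (simp add: field_simps)
  then show "L2_set (\<lambda>i. cmod (fcoef X g i)) F \<le> sqrt (I / X)"
    unfolding L2_set_def c_def by (rule real_sqrt_le_mono)
qed

lemma l2_mfcoef:
  fixes a :: "real \<Rightarrow> complex^'n^'n"
  assumes X: "X > 0" and a: "L2per X a"
  shows "l2 (\<lambda>k. mfcoef X a k $ \<alpha> $ \<beta>)"
proof -
  let ?g = "\<lambda>x. a x $ \<alpha> $ \<beta>"
  have "(\<lambda>M :: complex^'n^'n. M $ \<alpha> $ \<beta>) \<in> borel_measurable borel"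
    by (intro borel_measurable_continuous_onI continuous_intros)
  then have m: "?g \<in> borel_measurable lebesgue"
    using a measurable_compose[of a lebesgue borel] unfolding L2per_def by blast
  have "(\<lambda>x. (cmod (?g x))\<^sup>2) integrable_on {0..X}"
  proof (rule measurable_bounded_by_integrable_imp_integrable)
    show "(\<lambda>x. (cmod (?g x))\<^sup>2) \<in> borel_measurable (lebesgue_on {0..X})"
      by (intro measurable_restrict_space1 borel_measurable_power borel_measurable_norm[THEN measurable_compose[OF m]])
    show "(\<lambda>x. (norm (a x))\<^sup>2) integrable_on {0..X}" using a by (simp add: L2per_def)
    show "norm ((cmod (?g x))\<^sup>2) \<le> (norm (a x))\<^sup>2" for x
    proof -
      have "cmod (?g x) \<le> norm (a x $ \<alpha>)" by (rule Finite_Cartesian_Product.norm_nth_le)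
      also have "\<dots> \<le> norm (a x)" by (rule Finite_Cartesian_Product.norm_nth_le)
      finally show ?thesis by (simp add: power_mono)
    qed
  qed simp
  then have "l2 (fcoef X ?g)" by (rule bessel_fcoef[OF X m])
  moreover have "fcoef X ?g = (\<lambda>k. mfcoef X a k $ \<alpha> $ \<beta>)" by (simp add: mfcoef_def fun_eq_iff)
  ultimately show ?thesis by simp
qed

text \<open>The multiplier of (1 - d^2/dx^2)^(-1), so the negative of the one in K; the sign is
  chosen to have positive weights.\<close>

definition wt :: "real \<Rightarrow> int \<Rightarrow> real" where
  "wt X k = 1 / (1 + (2 * pi * of_int k / X)\<^sup>2)"

lemma wt_pos: "wt X k > 0"
  by (simp add: wt_def add_pos_nonneg)

lemma summable_wt:
  assumes "X > 0"
  shows "wt X summable_on UNIV"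
proof -
  define b where "b = (2 * pi / X)\<^sup>2"
  have b: "b > 0" using assms by (simp add: b_def)
  have w: "wt X k = 1 / (1 + b * (of_int k)\<^sup>2)" for k by (simp add: wt_def b_def power_divide power_mult_distrib)
  have "summable (\<lambda>n. 1 / (1 + b * (real n)\<^sup>2))"
  proof (rule summable_comparison_test[of _ "\<lambda>n. (1 / b) * inverse (real n ^ 2)"])
    show "summable (\<lambda>n. (1 / b) * inverse (real n ^ 2))" by (intro summable_mult inverse_power_summable) simp
    have "norm (1 / (1 + b * (real n)\<^sup>2)) \<le> (1 / b) * inverse (real n ^ 2)" if "n \<ge> 1" for n
    proof -
      have "1 / (1 + b * (real n)\<^sup>2) \<le> 1 / (b * (real n)\<^sup>2)"
        using that b by (intro divide_left_mono mult_pos_pos add_pos_nonneg) auto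
      then show ?thesis using b by (simp add: divide_inverse)
    qed
    then show "\<exists>N. \<forall>n\<ge>N. norm (1 / (1 + b * (real n)\<^sup>2)) \<le> (1 / b) * inverse (real n ^ 2)" by blast
  qed
  then have "(\<lambda>n. 1 / (1 + b * (real n)\<^sup>2)) summable_on UNIV"
    using b by (intro norm_summable_imp_summable_on) (simp add: abs_of_nonneg)
  then have n: "(\<lambda>n. wt X (int n)) summable_on UNIV" "(\<lambda>n. wt X (- int n)) summable_on UNIV"
    by (simp_all add: w)
  have "wt X summable_on (range int)" "wt X summable_on (range (\<lambda>n. - int n))"
    using n by (auto simp: summable_on_reindex inj_on_def o_def)
  then have "wt X summable_on (range int \<union> range (\<lambda>n. - int n))" by (rule summable_on_union)
  also have "range int \<union> range (\<lambda>n. - int n) = UNIV"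
  proof -
    have "k \<in> range int \<union> range (\<lambda>n. - int n)" for k
      by (cases k rule: int_cases2) auto
    then show ?thesis by blast
  qed
  finally show ?thesis .
qed

text \<open>The second family decays like 1/k, which is square summable but not summable: it makes
  the derivative term Hilbert--Schmidt and in general not of trace class. With y the wave number,
  its square is estimated through y^2 <= 1 + y^2.\<close>

lemma l2_wt:
  assumes "X > 0"
  shows "l2 (\<lambda>k. complex_of_real (wt X k))" "l2 (\<lambda>k. complex_of_real (wt X k) * wnum X k)"
proof -
  have *: "l2 v" if "\<And>k. (cmod (v k))\<^sup>2 \<le> wt X k" for v :: "int \<Rightarrow> complex"
    unfolding l2_def by (rule summable_on_comparison_test[OF summable_wt[OF assms]]) (use that in auto)
  show "l2 (\<lambda>k. complex_of_real (wt X k))"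
  proof (rule *)
    fix k
    have "wt X k \<le> 1" by (simp add: wt_def divide_le_eq add_pos_nonneg)
    then show "(cmod (complex_of_real (wt X k)))\<^sup>2 \<le> wt X k"
      using wt_pos[of X k] by (simp add: power2_eq_square mult_left_le)
  qed
  show "l2 (\<lambda>k. complex_of_real (wt X k) * wnum X k)"
  proof (rule *)
    fix k
    define y where "y = 2 * pi * of_int k / X"
    have "(cmod (complex_of_real (wt X k) * wnum X k))\<^sup>2 = y\<^sup>2 / (1 + y\<^sup>2)\<^sup>2"
      unfolding wnum_def wt_def y_def[symmetric] norm_mult norm_of_real power_mult_distrib power2_abs
      by (simp add: power_divide)
    also have "\<dots> \<le> (1 + y\<^sup>2) / (1 + y\<^sup>2)\<^sup>2" by (intro divide_right_mono) auto
    also have "\<dots> = wt X k" unfolding wt_def y_def[symmetric] by (simp add: power2_eq_square)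
    finally show "(cmod (complex_of_real (wt X k) * wnum X k))\<^sup>2 \<le> wt X k" .
  qed
qed

text \<open>For fixed k, the sum of |c(k - m)|^2 over m is a translate of the sum for c, so the
  squared Hilbert--Schmidt norm is controlled by that of b times those of the entries of c. A square
  summable potential thus suffices.\<close>

lemma hs_convolution:
  fixes c :: "int \<Rightarrow> complex^'n^'n"
  assumes b: "l2 b" and c: "\<And>\<alpha> \<beta>. l2 (\<lambda>k. c k $ \<alpha> $ \<beta>)"
  shows "hs (\<lambda>(k, \<alpha>) (m, \<beta>). b k * c (k - m) $ \<alpha> $ \<beta>)"
proof (rule hs_bounded(1))
  define C where "C = (nrm b)\<^sup>2 * (\<Sum>\<alpha>\<in>UNIV. \<Sum>\<beta>\<in>UNIV. (nrm (\<lambda>k. c k $ \<alpha> $ \<beta>))\<^sup>2)"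
  fix F :: "(int \<times> 'n) set" assume F: "finite F"
  define I where "I = fst ` F"
  have I: "finite I" using F by (simp add: I_def)
  let ?A = "\<lambda>(k, \<alpha>) (m, \<beta>). b k * c (k - m) $ \<alpha> $ \<beta>"
  have sq: "(\<Sum>m\<in>I. (cmod (c (k - m) $ \<alpha> $ \<beta>))\<^sup>2) \<le> (nrm (\<lambda>k. c k $ \<alpha> $ \<beta>))\<^sup>2" for k \<alpha> \<beta>
  proof -
    have "(\<Sum>m\<in>I. (cmod (c (k - m) $ \<alpha> $ \<beta>))\<^sup>2) = (\<Sum>j\<in>(\<lambda>m. k - m) ` I. (cmod (c j $ \<alpha> $ \<beta>))\<^sup>2)"
      by (subst sum.reindex) (auto simp: inj_on_def)
    also have "\<dots> \<le> (nrm (\<lambda>k. c k $ \<alpha> $ \<beta>))\<^sup>2"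
      unfolding nrm_square by (rule finite_sum_le_infsum) (use c[of \<alpha> \<beta>] I in \<open>auto simp: l2_def\<close>)
    finally show ?thesis .
  qed
  have bb: "(\<Sum>k\<in>I. (cmod (b k))\<^sup>2) \<le> (nrm b)\<^sup>2"
    unfolding nrm_square by (rule finite_sum_le_infsum) (use b I in \<open>auto simp: l2_def\<close>)
  have "F \<subseteq> I \<times> UNIV" by (force simp: I_def)
  then have sub: "F \<times> F \<subseteq> (I \<times> UNIV) \<times> (I \<times> UNIV)" by blast
  have "(frob F ?A)\<^sup>2 \<le> (frob (I \<times> UNIV) ?A)\<^sup>2"
    unfolding frob_square sum.cartesian_product by (rule sum_mono2) (use sub I in auto)
  also have "\<dots> = (\<Sum>k\<in>I. \<Sum>\<alpha>\<in>UNIV. \<Sum>m\<in>I. \<Sum>\<beta>\<in>UNIV. (cmod (b k))\<^sup>2 * (cmod (c (k - m) $ \<alpha> $ \<beta>))\<^sup>2)"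
    unfolding frob_square sum.cartesian_product' by (simp add: norm_mult power_mult_distrib)
  also have "\<dots> = (\<Sum>k\<in>I. (cmod (b k))\<^sup>2 * (\<Sum>\<alpha>\<in>UNIV. \<Sum>\<beta>\<in>UNIV. \<Sum>m\<in>I. (cmod (c (k - m) $ \<alpha> $ \<beta>))\<^sup>2))"
    unfolding sum_distrib_left by (intro sum.cong refl sum.swap)
  also have "\<dots> \<le> (\<Sum>k\<in>I. (cmod (b k))\<^sup>2 * (\<Sum>\<alpha>\<in>UNIV. \<Sum>\<beta>\<in>UNIV. (nrm (\<lambda>k. c k $ \<alpha> $ \<beta>))\<^sup>2))"
    by (intro sum_mono mult_left_mono sq) auto
  also have "\<dots> = (\<Sum>k\<in>I. (cmod (b k))\<^sup>2) * (\<Sum>\<alpha>\<in>UNIV. \<Sum>\<beta>\<in>UNIV. (nrm (\<lambda>k. c k $ \<alpha> $ \<beta>))\<^sup>2)"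
    by (rule sum_distrib_right[symmetric])
  also have "\<dots> \<le> C"
    unfolding C_def by (intro mult_right_mono bb sum_nonneg) auto
  finally have "(frob F ?A)\<^sup>2 \<le> C" .
  then show "frob F ?A \<le> sqrt C" by (rule real_le_rsqrt)
qed

section \<open>The Bloch operator on Fourier coefficients\<close>

lemma exhaustion_box: "exhaustion (\<lambda>J. {- int J..int J} \<times> (UNIV :: 'n::finite set))"
proof
  fix i :: "int \<times> 'n"
  show "\<exists>n. i \<in> {- int n..int n} \<times> UNIV"
    by (rule exI[of _ "nat \<bar>fst i\<bar>"]) (cases i, auto)
qed auto

section \<open>Vector-valued sequences as scalar families over modes and components\<close>

lemma l2_product:
  fixes f :: "int \<times> 'n::finite \<Rightarrow> complex"
  assumes "(\<lambda>k. \<Sum>\<alpha>\<in>UNIV. (cmod (f (k, \<alpha>)))\<^sup>2) summable_on UNIV"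
  shows "l2 f"
proof -
  have "(\<lambda>p. (cmod (f p))\<^sup>2) summable_on Sigma UNIV (\<lambda>_. UNIV)"
    by (rule summable_on_SigmaI[OF _ assms]) (auto intro: has_sum_finite)
  then show ?thesis by (simp add: l2_def)
qed

lemma l2_fst:
  assumes "l2 b"
  shows "l2 (\<lambda>p :: int \<times> 'n::finite. b (fst p))"
  by (rule l2_product) (use assms in \<open>simp add: l2_def summable_on_cmult_right\<close>)

definition flat :: "(int \<Rightarrow> complex^'n) \<Rightarrow> int \<times> 'n \<Rightarrow> complex" where
  "flat U = (\<lambda>p. U (fst p) $ snd p)"

definition unflat :: "(int \<times> 'n \<Rightarrow> complex) \<Rightarrow> int \<Rightarrow> complex^'n" where
  "unflat u = (\<lambda>k. \<chi> \<alpha>. u (k, \<alpha>))"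

lemma flat_unflat [simp]: "flat (unflat u) = u" "unflat (flat U) = U"
  by (auto simp: flat_def unflat_def fun_eq_iff vec_eq_iff)

lemma flat_eq_iff: "flat U = flat V \<longleftrightarrow> U = V"
  using flat_unflat(2) by metis

lemma flat_zero: "flat 0 = (\<lambda>p. 0)"
  by (simp add: flat_def zero_fun_def)

lemma norm_square_vec: "(norm (v :: complex^'n))\<^sup>2 = (\<Sum>\<alpha>\<in>UNIV. (cmod (v $ \<alpha>))\<^sup>2)"
  by (simp add: norm_vec_def L2_set_def sum_nonneg)

lemma l2_flat: "l2 (flat U) \<longleftrightarrow> l2seq U"
proof
  assume "l2seq U"
  then show "l2 (flat U)" by (intro l2_product) (simp add: l2seq_def norm_square_vec flat_def)
next
  assume "l2 (flat U)"
  then have "(\<lambda>p. (cmod (flat U p))\<^sup>2) summable_on Sigma UNIV (\<lambda>_. UNIV)" by (simp add: l2_def)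
  then obtain s where s: "((\<lambda>p. (cmod (flat U p))\<^sup>2) has_sum s) (Sigma UNIV (\<lambda>_. UNIV))"
    by (auto simp: summable_on_def)
  have "((\<lambda>k. \<Sum>\<alpha>\<in>UNIV. (cmod (flat U (k, \<alpha>)))\<^sup>2) has_sum s) UNIV"
    by (rule has_sum_SigmaD[OF s]) (auto intro: has_sum_finite)
  then show "l2seq U" by (auto simp: l2seq_def norm_square_vec flat_def summable_on_def)
qed

lemma has_sum_vecI:
  fixes f :: "'a \<Rightarrow> complex^'n"
  assumes "\<And>\<alpha>. ((\<lambda>x. f x $ \<alpha>) has_sum s $ \<alpha>) A"
  shows "(f has_sum s) A"
  unfolding has_sum_def
proof (rule vec_tendstoI)
  fix \<alpha>
  show "((\<lambda>F. sum f F $ \<alpha>) \<longlongrightarrow> s $ \<alpha>) (finite_subsets_at_top A)"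
    using assms[of \<alpha>] by (simp add: has_sum_def)
qed

text \<open>A row of the matrix in \<open>hs_convolution\<close>, taken with the unit vector at k
  for the factor b.\<close>

lemma l2_convolution_row:
  fixes c :: "int \<Rightarrow> complex^'n^'n"
  assumes "\<And>\<alpha> \<beta>. l2 (\<lambda>k. c k $ \<alpha> $ \<beta>)"
  shows "l2 (\<lambda>(m, \<beta>). c (k - m) $ \<alpha> $ \<beta>)"
proof -
  have "l2 (\<lambda>j. if j = k then 1 else 0 :: complex)" by (rule l2_finite_support) simp
  from hs_row[OF hs_convolution[OF this assms], of "(k, \<alpha>)"] show ?thesis by simp
qed

text \<open>The double family over modes and components is summable by Cauchy--Schwarz, so summing
  over the components first gives the infinite sum in \<open>conv\<close>, which thereby is seen to
  converge.\<close>

lemma conv_component: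
  fixes c :: "int \<Rightarrow> complex^'n^'n"
  assumes c: "\<And>\<alpha> \<beta>. l2 (\<lambda>k. c k $ \<alpha> $ \<beta>)" and U: "l2seq U"
  shows "conv c U k $ \<alpha> = dot (\<lambda>(m, \<beta>). c (k - m) $ \<alpha> $ \<beta>) (flat U)"
proof -
  define s where "s \<alpha> = dot (\<lambda>(m, \<beta>). c (k - m) $ \<alpha> $ \<beta>) (flat U)" for \<alpha>
  have "((\<lambda>m. (c (k - m) *v U m) $ \<alpha>) has_sum s \<alpha>) UNIV" for \<alpha>
  proof -
    let ?f = "\<lambda>p. (case p of (m, \<beta>) \<Rightarrow> c (k - m) $ \<alpha> $ \<beta>) * flat U p"
    have "?f summable_on UNIV" by (intro l2_mult_summable l2_convolution_row c) (simp add: l2_flat U)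
    then have "(?f has_sum s \<alpha>) (Sigma UNIV (\<lambda>_. UNIV))" unfolding s_def dot_def by (simp add: has_sum_infsum)
    then have "((\<lambda>m. \<Sum>\<beta>\<in>UNIV. ?f (m, \<beta>)) has_sum s \<alpha>) UNIV"
      by (rule has_sum_SigmaD) (auto intro: has_sum_finite)
    then show ?thesis by (simp add: matrix_vector_mult_def flat_def)
  qed
  then have "((\<lambda>m. c (k - m) *v U m) has_sum (\<chi> \<alpha>. s \<alpha>)) UNIV" by (intro has_sum_vecI) simp
  then have "conv c U k = (\<chi> \<alpha>. s \<alpha>)" unfolding conv_def by (rule infsumI)
  then show ?thesis by (simp add: s_def)
qed

lemma vector_space_cscale: "vector_space (cscale :: complex \<Rightarrow> (int \<Rightarrow> complex^'n) \<Rightarrow> _)"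
  by unfold_locales
     (auto simp: cscale_def fun_eq_iff vec_eq_iff algebra_simps)

lemma wnum_wt: "of_real (wt X k) * (1 + (wnum X k)\<^sup>2) = 1"
proof -
  have "wt X k * (1 + (2 * pi * of_int k / X)\<^sup>2) = 1"
    using wt_pos[of X k] by (simp add: wt_def)
  then have "complex_of_real (wt X k * (1 + (2 * pi * of_int k / X)\<^sup>2)) = of_real 1" by (rule arg_cong)
  then show ?thesis unfolding wnum_def of_real_mult of_real_add of_real_power of_real_1 .
qed

section \<open>The operator K as a pencil of Hilbert--Schmidt matrices\<close>

locale bloch =
  fixes X :: real and a0 a1 :: "real \<Rightarrow> complex^'n^'n"
  assumes X: "X > 0" and a0: "L2per X a0" and a1: "L2per X a1"
begin

abbreviation KM :: "real \<Rightarrow> complex \<Rightarrow> int \<times> 'n \<Rightarrow> int \<times> 'n \<Rightarrow> complex" where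
  "KM \<sigma> z \<equiv> Kmat X a0 a1 \<sigma> z"

definition gw :: "int \<times> 'n \<Rightarrow> real" where "gw p = wt X (fst p)"

abbreviation DG :: "int \<times> 'n \<Rightarrow> int \<times> 'n \<Rightarrow> complex" where
  "DG \<equiv> \<lambda>p q. if p = q then complex_of_real (gw p) else 0"

definition DW :: "int \<times> 'n \<Rightarrow> int \<times> 'n \<Rightarrow> complex" where
  "DW = (\<lambda>p q. if p = q then complex_of_real (gw p) * wnum X (fst p) else 0)"

definition V :: "int \<times> 'n \<Rightarrow> int \<times> 'n \<Rightarrow> complex" where
  "V = (\<lambda>(k, \<alpha>) (m, \<beta>). complex_of_real (wt X k) * mfcoef X a1 (k - m) $ \<alpha> $ \<beta>)"

definition V0 :: "int \<times> 'n \<Rightarrow> int \<times> 'n \<Rightarrow> complex" where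
  "V0 = (\<lambda>(k, \<alpha>) (m, \<beta>). complex_of_real (wt X k) * mfcoef X a0 (k - m) $ \<alpha> $ \<beta>)"

definition V1 :: "int \<times> 'n \<Rightarrow> int \<times> 'n \<Rightarrow> complex" where
  "V1 = (\<lambda>(k, \<alpha>) (m, \<beta>). (complex_of_real (wt X k) * wnum X k) * mfcoef X a1 (k - m) $ \<alpha> $ \<beta>)"

lemma l2_gw: "l2 (\<lambda>p. complex_of_real (gw p))"
  unfolding gw_def using l2_fst[OF l2_wt(1)[OF X]] by simp

lemma hs_parts: "hs DG" "hs DW" "hs V" "hs V0" "hs V1"
proof -
  show "hs DG" by (rule hs_diag[OF l2_gw])
  show "hs DW" unfolding DW_def gw_def by (rule hs_diag) (use l2_fst[OF l2_wt(2)[OF X]] in simp)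
  show "hs V" unfolding V_def by (rule hs_convolution[OF l2_wt(1)[OF X] l2_mfcoef[OF X a1]])
  show "hs V0" unfolding V0_def by (rule hs_convolution[OF l2_wt(1)[OF X] l2_mfcoef[OF X a0]])
  show "hs V1" unfolding V1_def by (rule hs_convolution[OF l2_wt(2)[OF X] l2_mfcoef[OF X a1]])
qed

text \<open>The parameters enter only through scalar coefficients of five fixed Hilbert--Schmidt
  matrices: affinely in z, quadratically in \<sigma>. Holomorphy and continuity are read off from
  this.\<close>

lemma KM_decomp:
  "KM \<sigma> z p q = - \<i> * V1 p q + (- 1) * V0 p q + (- \<i> * of_real \<sigma>) * V p q + (2 * of_real \<sigma>) * DW p q
     + ((of_real \<sigma>)\<^sup>2 - 1 + z) * DG p q"
proof -
  obtain k \<alpha> m \<beta> where pq: "p = (k, \<alpha>)" "q = (m, \<beta>)" by (cases p, cases q)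
  have w0: "1 + (wnum X k)\<^sup>2 \<noteq> 0" using wnum_wt[of X k] by auto
  have w: "- 1 / (1 + (wnum X k)\<^sup>2) = - of_real (wt X k)"
    using wnum_wt[of X k] w0 by (simp add: field_simps)
  show ?thesis
    unfolding pq Kmat_def split_conv w A1hat_def A0hat_def V_def V0_def V1_def DW_def gw_def
    by (cases "k = m"; cases "\<alpha> = \<beta>") (simp_all add: Finite_Cartesian_Product.mat_def algebra_simps power2_eq_square)
qed

lemma hs_KM: "hs (KM \<sigma> z)"
proof -
  have "hs (\<lambda>p q. - \<i> * V1 p q + (- 1) * V0 p q + (- \<i> * of_real \<sigma>) * V p q + (2 * of_real \<sigma>) * DW p q
     + ((of_real \<sigma>)\<^sup>2 - 1 + z) * DG p q)" (is "hs ?M")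
    by (intro hs_add hs_scale hs_parts)
  moreover have "KM \<sigma> z = ?M" by (intro ext) (rule KM_decomp)
  ultimately show ?thesis by (simp only:)
qed

sublocale exhaustion "\<lambda>J. {- int J..int J} \<times> (UNIV :: 'n set)"
  by (rule exhaustion_box)

text \<open>Every pair (\<sigma>, z) serves as base point. By \<open>KM_shift\<close> the pencil at
  \<mu> is K(\<sigma>, z + \<mu>), so a zero at z becomes a zero at \<mu> = 0.\<close>

sublocale pencil "\<lambda>J. {- int J..int J} \<times> (UNIV :: 'n set)" "KM \<sigma> z" gw
  for \<sigma> z
  by unfold_locales (rule hs_KM, rule l2_gw, simp add: gw_def wt_pos)

lemma Dsig_eq_det2: "Dsig X a0 a1 \<sigma> z = det2 (KM \<sigma> z)"
  unfolding Dsig_def det2_def Dtrunc_def[abs_def] ..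

lemma KM_shift: "KM \<sigma> (z + \<mu>) p q = KM \<sigma> z p q + \<mu> * DG p q"
  unfolding KM_decomp by (simp add: algebra_simps)

lemma Dtrunc_lim: "Dtrunc X a0 a1 \<sigma> z \<longlonglongrightarrow> Dsig X a0 a1 \<sigma> z"
  unfolding Dsig_eq_det2 Dtrunc_def[abs_def] by (rule fdet2_lim[OF hs_KM])

lemma Dsig_holomorphic: "Dsig X a0 a1 \<sigma> holomorphic_on UNIV"
proof -
  have eq: "KM \<sigma> z = (\<lambda>p q. KM \<sigma> 0 p q + z * DG p q)" for z
    using KM_shift[of \<sigma> 0 z, unfolded add_0_left] by (intro ext)
  have "Dsig X a0 a1 \<sigma> = (\<lambda>z. det2 (\<lambda>p q. KM \<sigma> 0 p q + z * DG p q))"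
    unfolding Dsig_eq_det2[abs_def] by (rule ext) (rule arg_cong[OF eq])
  then show ?thesis by (simp only: det2_holomorphic[OF hs_KM hs_parts(1)])
qed

text \<open>\<open>V0\<close> and \<open>V1\<close> have coefficients free of \<sigma> and cancel in
  the difference.\<close>

lemma hsn_KM_diff:
  "hsn (\<lambda>p q. KM \<sigma> z p q - KM \<sigma>0 z p q)
    \<le> \<bar>\<sigma> - \<sigma>0\<bar> * hsn V + 2 * \<bar>\<sigma> - \<sigma>0\<bar> * hsn DW + \<bar>\<sigma>\<^sup>2 - \<sigma>0\<^sup>2\<bar> * hsn DG"
proof -
  define c where "c = (- \<i> * of_real (\<sigma> - \<sigma>0) :: complex)"
  define c' where "c' = (of_real (2 * (\<sigma> - \<sigma>0)) :: complex)"
  define c'' where "c'' = (of_real (\<sigma>\<^sup>2 - \<sigma>0\<^sup>2) :: complex)"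
  have n: "cmod c = \<bar>\<sigma> - \<sigma>0\<bar>" "cmod c' = 2 * \<bar>\<sigma> - \<sigma>0\<bar>" "cmod c'' = \<bar>\<sigma>\<^sup>2 - \<sigma>0\<^sup>2\<bar>"
    unfolding c_def c'_def c''_def norm_mult norm_of_real abs_mult by simp_all
  have a: "hs (\<lambda>p q. c * V p q)" "hs (\<lambda>p q. c' * DW p q)" "hs (\<lambda>p q. c'' * DG p q)"
    by (rule hs_scale[OF hs_parts(3)] hs_scale[OF hs_parts(2)] hs_scale[OF hs_parts(1)])+
  have eq: "KM \<sigma> z p q - KM \<sigma>0 z p q = (c * V p q + c' * DW p q) + c'' * DG p q" for p q
    unfolding KM_decomp[of \<sigma>] KM_decomp[of \<sigma>0] c_def c'_def c''_def
    by (simp add: algebra_simps)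
  have "hsn (\<lambda>p q. KM \<sigma> z p q - KM \<sigma>0 z p q) \<le> hsn (\<lambda>p q. c * V p q + c' * DW p q) + hsn (\<lambda>p q. c'' * DG p q)"
    unfolding eq by (rule hsn_add[OF hs_add[OF a(1,2)] a(3)])
  also have "\<dots> \<le> (hsn (\<lambda>p q. c * V p q) + hsn (\<lambda>p q. c' * DW p q)) + hsn (\<lambda>p q. c'' * DG p q)"
    by (rule add_right_mono[OF hsn_add[OF a(1,2)]])
  also have "\<dots> = cmod c * hsn V + cmod c' * hsn DW + cmod c'' * hsn DG"
    using hsn_scale[of c V] hsn_scale[of c' DW] hsn_scale[of c'' DG] by argo
  finally show ?thesis unfolding n .
qed

lemma Dsig_continuous: "((\<lambda>\<sigma>. Dsig X a0 a1 \<sigma> z) \<longlongrightarrow> Dsig X a0 a1 \<sigma>0 z) (at \<sigma>0 within A)"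
proof -
  define nV nW nG where "nV = hsn V" and "nW = hsn DW" and "nG = hsn DG"
  let ?d = "\<lambda>\<sigma>. \<bar>\<sigma> - \<sigma>0\<bar> * nV + 2 * \<bar>\<sigma> - \<sigma>0\<bar> * nW + \<bar>\<sigma>\<^sup>2 - \<sigma>0\<^sup>2\<bar> * nG"
  have "(?d \<longlongrightarrow> \<bar>\<sigma>0 - \<sigma>0\<bar> * nV + 2 * \<bar>\<sigma>0 - \<sigma>0\<bar> * nW + \<bar>\<sigma>0\<^sup>2 - \<sigma>0\<^sup>2\<bar> * nG) (at \<sigma>0 within A)"
    by (intro tendsto_intros)
  then have d0: "(?d \<longlongrightarrow> 0) (at \<sigma>0 within A)" by simp
  have le: "norm (hsn (\<lambda>p q. KM \<sigma> z p q - KM \<sigma>0 z p q)) \<le> ?d \<sigma>" for \<sigma>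
    unfolding real_norm_def abs_of_nonneg[OF nrm_nonneg] nV_def nW_def nG_def by (rule hsn_KM_diff)
  have "((\<lambda>\<sigma>. hsn (\<lambda>p q. KM \<sigma> z p q - KM \<sigma>0 z p q)) \<longlongrightarrow> 0) (at \<sigma>0 within A)"
    by (rule Lim_null_comparison[OF always_eventually d0]) (rule allI, rule le)
  then show ?thesis
    unfolding Dsig_eq_det2 by (rule det2_tendsto[of "\<lambda>\<sigma>. KM \<sigma> z" "KM \<sigma>0 z", OF hs_KM hs_KM])
qed

lemma l2_hats:
  "l2 (\<lambda>k. A1hat X a1 \<sigma> k $ \<alpha> $ \<beta>)" "l2 (\<lambda>k. A0hat X a0 a1 \<sigma> k $ \<alpha> $ \<beta>)"
proof -
  have d: "l2 (\<lambda>j :: int. if j = 0 then c else 0 :: complex)" for c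
    by (rule l2_finite_support) (rule finite_subset[of _ "{0}"], auto)
  have "(\<lambda>k. A1hat X a1 \<sigma> k $ \<alpha> $ \<beta>) = (\<lambda>k. mfcoef X a1 k $ \<alpha> $ \<beta> + (if k = 0 then Finite_Cartesian_Product.mat (2 * \<i> * complex_of_real \<sigma>) $ \<alpha> $ \<beta> else 0))"
    by (auto simp: A1hat_def fun_eq_iff)
  then show "l2 (\<lambda>k. A1hat X a1 \<sigma> k $ \<alpha> $ \<beta>)"
    by (simp only:) (intro l2_add l2_mfcoef[OF X a1] d)
  have "(\<lambda>k. A0hat X a0 a1 \<sigma> k $ \<alpha> $ \<beta>) = (\<lambda>k. mfcoef X a0 k $ \<alpha> $ \<beta> + (if k = 0 then Finite_Cartesian_Product.mat (- (complex_of_real \<sigma>)\<^sup>2) $ \<alpha> $ \<beta> else 0)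
      + (\<i> * complex_of_real \<sigma>) * mfcoef X a1 k $ \<alpha> $ \<beta>)"
    by (auto simp: A0hat_def fun_eq_iff)
  then show "l2 (\<lambda>k. A0hat X a0 a1 \<sigma> k $ \<alpha> $ \<beta>)"
    by (simp only:) (intro l2_add l2_scale l2_mfcoef[OF X a1] l2_mfcoef[OF X a0] d)
qed

lemma app_KM:
  assumes U: "l2seq U"
  shows "app (KM \<sigma> z) (flat U) (k, \<alpha>) = - of_real (wt X k) *
    (\<i> * wnum X k * conv (A1hat X a1 \<sigma>) U k $ \<alpha> + conv (A0hat X a0 a1 \<sigma>) U k $ \<alpha> + (1 - z) * U k $ \<alpha>)"
proof -
  let ?r1 = "\<lambda>(m, \<beta>). A1hat X a1 \<sigma> (k - m) $ \<alpha> $ \<beta>"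
  let ?r0 = "\<lambda>(m, \<beta>). A0hat X a0 a1 \<sigma> (k - m) $ \<alpha> $ \<beta>"
  let ?\<delta> = "\<lambda>q. if q = (k, \<alpha>) then 1 - z else 0"
  have fU: "l2 (flat U)" using U by (simp add: l2_flat)
  have r: "l2 ?r1" "l2 ?r0" by (intro l2_convolution_row l2_hats)+
  have d: "l2 ?\<delta>" by (rule l2_finite_support) (rule finite_subset[of _ "{(k, \<alpha>)}"], auto)
  have w0: "1 + (wnum X k)\<^sup>2 \<noteq> 0" using wnum_wt[of X k] by auto
  have w: "- 1 / (1 + (wnum X k)\<^sup>2) = - of_real (wt X k)"
    using wnum_wt[of X k] w0 by (simp add: field_simps)
  have "KM \<sigma> z (k, \<alpha>) = (\<lambda>q. - of_real (wt X k) * (((\<i> * wnum X k) * ?r1 q + ?r0 q) + ?\<delta> q))"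
  proof
    fix q :: "int \<times> 'n"
    obtain m \<beta> where q: "q = (m, \<beta>)" by (cases q)
    show "KM \<sigma> z (k, \<alpha>) q = - of_real (wt X k) * (((\<i> * wnum X k) * ?r1 q + ?r0 q) + ?\<delta> q)"
      unfolding q Kmat_def split_conv w by auto
  qed
  then have "app (KM \<sigma> z) (flat U) (k, \<alpha>) = dot (flat U) (\<lambda>q. - of_real (wt X k) * (((\<i> * wnum X k) * ?r1 q + ?r0 q) + ?\<delta> q))"
    by (simp only: app_def dot_commute[of _ "flat U"])
  also have "\<dots> = - of_real (wt X k) * ((\<i> * wnum X k) * dot (flat U) ?r1 + dot (flat U) ?r0 + dot (flat U) ?\<delta>)"
    by (simp only: dot_scale dot_add[OF fU l2_add[OF l2_scale[OF r(1)] r(2)] d] dot_add[OF fU l2_scale[OF r(1)] r(2)])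
  also have "dot (flat U) ?r1 = conv (A1hat X a1 \<sigma>) U k $ \<alpha>"
    unfolding conv_component[OF l2_hats(1) U] by (rule dot_commute)
  also have "dot (flat U) ?r0 = conv (A0hat X a0 a1 \<sigma>) U k $ \<alpha>"
    unfolding conv_component[OF l2_hats(2) U] by (rule dot_commute)
  also have "dot (flat U) ?\<delta> = (1 - z) * U k $ \<alpha>"
    unfolding dot_commute[of "flat U"] dot_delta by (simp add: flat_def)
  finally show ?thesis .
qed

text \<open>Writing U as the weight times (1 + wave number squared) times U puts the identity under
  the common weight; its 1 then cancels the 1 in 1 - z, and L - z remains.\<close>

lemma one_plus_KM:
  assumes U: "l2seq U"
  shows "flat U p + app (KM \<sigma> z) (flat U) p = - (of_real (gw p) * flat (shifted X a0 a1 \<sigma> z U) p)"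
proof -
  obtain k \<alpha> where p: "p = (k, \<alpha>)" by (cases p)
  let ?c1 = "conv (A1hat X a1 \<sigma>) U k $ \<alpha>" and ?c0 = "conv (A0hat X a0 a1 \<sigma>) U k $ \<alpha>"
  let ?g = "complex_of_real (wt X k)" and ?w = "wnum X k" and ?u = "U k $ \<alpha>"
  have "?u = ?g * (1 + ?w\<^sup>2) * ?u" by (simp add: wnum_wt)
  then have "?u + - ?g * (\<i> * ?w * ?c1 + ?c0 + (1 - z) * ?u)
      = ?g * (1 + ?w\<^sup>2) * ?u + - ?g * (\<i> * ?w * ?c1 + ?c0 + (1 - z) * ?u)" by simp
  also have "\<dots> = - (?g * (- ?w\<^sup>2 * ?u + \<i> * ?w * ?c1 + ?c0 - z * ?u))"
    by (simp add: algebra_simps)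
  finally show ?thesis
    unfolding p app_KM[OF U] by (simp add: flat_def shifted_def Lsig_def gw_def)
qed

section \<open>From kernels of 1 + K to eigenvectors and multiplicities\<close>

lemma T_flat:
  assumes "l2seq U"
  shows "T \<sigma> z (flat U) = flat (shifted X a0 a1 \<sigma> z U)"
  unfolding T_def one_plus_KM[OF assms] G_def using wt_pos[of X] by (auto simp: fun_eq_iff gw_def less_imp_neq[symmetric])

lemma l2seq_zero: "l2seq 0"
  using l2_flat[of 0] by (simp add: flat_zero)

lemma l2seq_Lsig_iff:
  assumes U: "l2seq U"
  shows "l2seq (Lsig X a0 a1 \<sigma> U) \<longleftrightarrow> l2seq (shifted X a0 a1 \<sigma> z U)"
proof -
  have 1: "flat (shifted X a0 a1 \<sigma> z U) = (\<lambda>p. flat (Lsig X a0 a1 \<sigma> U) p - z * flat U p)"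
    "flat (Lsig X a0 a1 \<sigma> U) = (\<lambda>p. flat (shifted X a0 a1 \<sigma> z U) p + z * flat U p)"
    by (auto simp: flat_def shifted_def fun_eq_iff)
  have fU: "l2 (\<lambda>p. z * flat U p)" using U by (intro l2_scale) (simp add: l2_flat)
  show ?thesis
    unfolding l2_flat[symmetric] using l2_diff[OF _ fU] l2_add[OF _ fU] 1 by metis
qed

lemma Dsig_zero_iff: "Dsig X a0 a1 \<sigma> z = 0 \<longleftrightarrow> is_eigenvalue X a0 a1 \<sigma> z"
proof -
  have sh: "shifted X a0 a1 \<sigma> z U = 0 \<longleftrightarrow> Lsig X a0 a1 \<sigma> U = (\<lambda>k. z *s U k)" for U
    by (auto simp: shifted_def fun_eq_iff)
  have g: "complex_of_real (gw p) \<noteq> 0" for p using wt_pos[of X] by (simp add: gw_def less_imp_neq[symmetric])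
  have ker: "(\<forall>p. flat U p + app (KM \<sigma> z) (flat U) p = 0) \<longleftrightarrow> shifted X a0 a1 \<sigma> z U = 0" if "l2seq U" for U
    unfolding one_plus_KM[OF that] using g by (simp add: flat_eq_iff[symmetric] flat_zero fun_eq_iff)
  have "Dsig X a0 a1 \<sigma> z = 0 \<longleftrightarrow> (\<exists>u. l2 u \<and> u \<noteq> (\<lambda>i. 0) \<and> (\<forall>i. u i + app (KM \<sigma> z) u i = 0))"
    unfolding Dsig_eq_det2 by (rule det2_eq_0_iff[OF hs_KM])
  also have "\<dots> \<longleftrightarrow> (\<exists>U. l2seq U \<and> U \<noteq> 0 \<and> (\<forall>p. flat U p + app (KM \<sigma> z) (flat U) p = 0))"
  proof (intro iffI; elim exE conjE)
    fix u :: "int \<times> 'n \<Rightarrow> complex" assume u: "l2 u" "u \<noteq> (\<lambda>i. 0)" "\<forall>i. u i + app (KM \<sigma> z) u i = 0"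
    have "unflat u \<noteq> 0" using u(2) flat_unflat(1)[of u] flat_zero by metis
    then show "\<exists>U. l2seq U \<and> U \<noteq> 0 \<and> (\<forall>p. flat U p + app (KM \<sigma> z) (flat U) p = 0)"
      using u by (intro exI[of _ "unflat u"]) (simp add: l2_flat[symmetric])
  next
    fix U assume "l2seq U" "U \<noteq> 0" "\<forall>p. flat U p + app (KM \<sigma> z) (flat U) p = 0"
    then show "\<exists>u. l2 u \<and> u \<noteq> (\<lambda>i. 0) \<and> (\<forall>i. u i + app (KM \<sigma> z) u i = 0)"
      by (intro exI[of _ "flat U"]) (simp add: l2_flat flat_zero[symmetric] flat_eq_iff)
  qed
  also have "\<dots> \<longleftrightarrow> (\<exists>U. l2seq U \<and> U \<noteq> 0 \<and> shifted X a0 a1 \<sigma> z U = 0)" using ker by blast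
  also have "\<dots> \<longleftrightarrow> is_eigenvalue X a0 a1 \<sigma> z"
  proof -
    \<comment> \<open>The domain condition is automatic for kernel vectors, because L U = z U is
      square summable along with U.\<close>
    have "l2seq (Lsig X a0 a1 \<sigma> U)" if "l2seq U" "shifted X a0 a1 \<sigma> z U = 0" for U
      unfolding l2seq_Lsig_iff[OF that(1), of \<sigma> z] that(2) by (rule l2seq_zero)
    then show ?thesis unfolding is_eigenvalue_def Ldom_def sh[symmetric] by blast
  qed
  finally show ?thesis .
qed

text \<open>Membership in \<open>Ldom\<close> also asks for a square summable image under L. Up to a
  multiple of the iterate this image is the next iterate, and the last one is 0, so square
  summability of the iterates alone is equivalent.\<close>

lemma gen_eigenspace_iff:
  "U \<in> gen_eigenspace X a0 a1 \<sigma> z \<longleftrightarrow>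
    (\<exists>m. (\<forall>j<m. l2 ((T \<sigma> z ^^ j) (flat U))) \<and> (T \<sigma> z ^^ m) (flat U) = (\<lambda>p. 0))"
proof -
  let ?s = "shifted X a0 a1 \<sigma> z" and ?T = "T \<sigma> z"
  \<comment> \<open>\<open>T\<close> and \<open>shifted\<close> agree only on square summable
    arguments, so the iterates are identified inductively, as long as all previous ones are square
    summable.\<close>
  have it: "flat ((?s ^^ j) U) = (?T ^^ j) (flat U)" if "\<forall>i<j. l2 ((?T ^^ i) (flat U))" for j
    using that
  proof (induction j)
    case (Suc j)
    then have IH: "flat ((?s ^^ j) U) = (?T ^^ j) (flat U)" by simp
    have "l2seq ((?s ^^ j) U)" using Suc.prems IH by (simp add: l2_flat[symmetric])
    from T_flat[OF this, of \<sigma> z] show ?case by (simp add: IH)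
  qed simp
  have it': "\<forall>i<j. l2 ((?T ^^ i) (flat U))" if "\<forall>i<j. l2seq ((?s ^^ i) U)" for j
    using that
  proof (induction j)
    case (Suc j)
    then have IH: "\<forall>i<j. l2 ((?T ^^ i) (flat U))" by simp
    have "l2 ((?T ^^ j) (flat U))" using Suc.prems it[OF IH] by (metis l2_flat lessI)
    with IH show ?case by (auto simp: less_Suc_eq)
  qed simp
  have "((\<forall>j<m. (?s ^^ j) U \<in> Ldom X a0 a1 \<sigma>) \<and> (?s ^^ m) U = 0) \<longleftrightarrow>
    ((\<forall>j<m. l2 ((?T ^^ j) (flat U))) \<and> (?T ^^ m) (flat U) = (\<lambda>p. 0))" (is "?L \<longleftrightarrow> ?R") for m
  proof
    assume L: ?L
    then have "\<forall>j<m. l2seq ((?s ^^ j) U)" by (simp add: Ldom_def)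
    from it'[OF this] have R: "\<forall>j<m. l2 ((?T ^^ j) (flat U))" .
    have "(?T ^^ m) (flat U) = flat ((?s ^^ m) U)" using it[OF R] by simp
    then show ?R using L R by (simp add: flat_zero)
  next
    assume R: ?R
    then have e: "flat ((?s ^^ j) U) = (?T ^^ j) (flat U)" if "j \<le> m" for j using that by (intro it) auto
    have z: "(?s ^^ m) U = 0" using e[of m] R by (simp add: flat_eq_iff[symmetric] flat_zero)
    have l: "l2seq ((?s ^^ j) U)" if "j \<le> m" for j
      using that R e[OF that] z l2seq_zero by (cases "j = m") (auto simp: l2_flat[symmetric])
    have "(?s ^^ j) U \<in> Ldom X a0 a1 \<sigma>" if "j < m" for j
    proof -
      have "l2seq (?s ((?s ^^ j) U))" using l[of "Suc j"] that by simp
      then show ?thesis using l[of j] that l2seq_Lsig_iff[of "(?s ^^ j) U" \<sigma> z] by (simp add: Ldom_def)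
    qed
    then show ?L using z by blast
  qed
  then show ?thesis unfolding gen_eigenspace_def by simp
qed

text \<open>The exponent d is at once the order of the zero and the size of a basis of the
  generalised eigenspace. It may be 0, in which case z is not a zero and both sides are 0.\<close>

lemma zorder_Dsig: "zorder (Dsig X a0 a1 \<sigma>) z = int (alg_mult X a0 a1 \<sigma> z)"
proof -
  obtain h d e where h: "h holomorphic_on UNIV" "h 0 \<noteq> 0" and D: "\<And>\<mu>. det2 (K \<sigma> z \<mu>) = \<mu> ^ d * h \<mu>"
    and ind: "\<forall>c. (\<forall>i. (\<Sum>l<d. c l * e l i) = 0) \<longrightarrow> (\<forall>l<d. c l = 0)"
    and ker: "\<And>u. (\<exists>c. u = (\<lambda>i. \<Sum>l<d. c l * e l i)) \<longleftrightarrow> (\<exists>m. (\<forall>j<m. l2 ((T \<sigma> z ^^ j) u)) \<and> (T \<sigma> z ^^ m) u = (\<lambda>i. 0))"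
    by (rule order_eq_dim_generalised_kernel[of \<sigma> z], rule that, assumption+)
  have Dz: "Dsig X a0 a1 \<sigma> w = h (w - z) * (w - z) powi int d" for w
  proof -
    have "K \<sigma> z (w - z) = KM \<sigma> w"
      using KM_shift[of \<sigma> z "w - z"] unfolding K_def G_def by (simp add: fun_eq_iff)
    then show ?thesis using D[of "w - z"] by (simp add: Dsig_eq_det2)
  qed
  have "(\<lambda>w. w - z) holomorphic_on UNIV" by (intro holomorphic_intros)
  from holomorphic_on_compose_gen[OF this h(1)] have "(\<lambda>w. h (w - z)) holomorphic_on UNIV"
    by (simp add: o_def)
  then have zo: "zorder (Dsig X a0 a1 \<sigma>) z = int d"
    by (intro zorder_eqI[OF open_UNIV UNIV_I, where g = "\<lambda>w. h (w - z)"]) (use h(2) Dz in auto)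
  interpret vs: vector_space "cscale :: complex \<Rightarrow> (int \<Rightarrow> complex^'n) \<Rightarrow> _" by (rule vector_space_cscale)
  define E where "E l = unflat (e l)" for l
  have flat_sum: "flat (\<Sum>l\<in>L. cscale (c l) (E l)) = (\<lambda>i. \<Sum>l\<in>L. c l * e l i)" for c and L :: "nat set"
    by (induction L rule: infinite_finite_induct)
       (auto simp: flat_def E_def unflat_def cscale_def fun_eq_iff)
  \<comment> \<open>Independence of the indexed family excludes repetitions, via the coefficients 1
    and -1 at two equal members; this permits the passage to a basis as a set of d elements.\<close>
  have inj: "inj_on E {..<d}"
  proof
    fix l l' assume l: "l \<in> {..<d}" "l' \<in> {..<d}" "E l = E l'"
    show "l = l'"
    proof (rule ccontr)
      assume ne: "l \<noteq> l'"
      have ee: "e l = e l'" using l(3) unfolding E_def by (metis flat_unflat(1))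
      let ?c = "\<lambda>k. if k = l then 1 else if k = l' then - 1 else 0 :: complex"
      have "(\<Sum>k<d. ?c k * e k i) = 0" for i
      proof -
        have "(\<Sum>k<d. ?c k * e k i) = (\<Sum>k\<in>{l, l'}. ?c k * e k i)"
          by (rule sum.mono_neutral_right) (use l in auto)
        then show ?thesis using ne ee by simp
      qed
      then have "\<forall>k<d. ?c k = 0" using ind[THEN spec, of ?c] by blast
      then show False using l(1) by auto
    qed
  qed
  have "vs.dim (gen_eigenspace X a0 a1 \<sigma> z) = d"
  proof (rule vs.dim_unique)
    have mem: "U \<in> gen_eigenspace X a0 a1 \<sigma> z \<longleftrightarrow> (\<exists>c. flat U = (\<lambda>i. \<Sum>l<d. c l * e l i))" for U
      unfolding gen_eigenspace_iff ker ..
    show "E ` {..<d} \<subseteq> gen_eigenspace X a0 a1 \<sigma> z"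
    proof safe
      fix l assume l: "l < d"
      have "flat (E l) = (\<lambda>i. \<Sum>k<d. (if k = l then 1 else 0) * e k i)"
        using l by (simp add: E_def if_distrib[of "\<lambda>x. x * _"] cong: if_cong)
      then show "E l \<in> gen_eigenspace X a0 a1 \<sigma> z" unfolding mem by (rule exI[of _ "\<lambda>k. if k = l then 1 else 0"])
    qed
    show "gen_eigenspace X a0 a1 \<sigma> z \<subseteq> vs.span (E ` {..<d})"
    proof
      fix U assume "U \<in> gen_eigenspace X a0 a1 \<sigma> z"
      then obtain c where "flat U = (\<lambda>i. \<Sum>l<d. c l * e l i)" unfolding mem by blast
      then have "U = (\<Sum>l<d. cscale (c l) (E l))" unfolding flat_sum[symmetric] flat_eq_iff .
      also have "\<dots> \<in> vs.span (E ` {..<d})"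
        by (intro vs.span_sum vs.span_scale vs.span_base) auto
      finally show "U \<in> vs.span (E ` {..<d})" .
    qed
    show "vs.independent (E ` {..<d})"
    proof (rule vs.independent_if_scalars_zero)
      fix f x assume s: "(\<Sum>x\<in>E ` {..<d}. cscale (f x) x) = 0" and x: "x \<in> E ` {..<d}"
      have "(\<Sum>l<d. cscale (f (E l)) (E l)) = 0" using s sum.reindex[OF inj, of "\<lambda>x. cscale (f x) x"] by (simp add: o_def)
      then have "(\<lambda>i. \<Sum>l<d. f (E l) * e l i) = (\<lambda>i. 0)" unfolding flat_sum[symmetric] by (simp add: flat_zero)
      then have "\<forall>l<d. f (E l) = 0" using ind[THEN spec, of "\<lambda>l. f (E l)"] unfolding fun_eq_iff by blast
      then show "f x = 0" using x by auto
    qed simp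
    show "card (E ` {..<d}) = d" using card_image[OF inj] by simp
  qed
  then show ?thesis unfolding zo alg_mult_def by simp
qed

end

text \<open>The convergence clause ensures that \<open>Dsig\<close>, which is defined through
  \<open>lim\<close>, is the actual limit of the truncated determinants.\<close>

theorem theorem3p4:
  fixes X :: real and a0 a1 :: "real \<Rightarrow> complex^'n^'n"
  assumes "X > 0" and "L2per X a0" and "L2per X a1"
  shows "(\<forall>\<sigma>\<in>{0..<2*pi}. \<forall>z. convergent (Dtrunc X a0 a1 \<sigma> z))
    \<and> (\<forall>\<sigma>\<in>{0..<2*pi}. Dsig X a0 a1 \<sigma> analytic_on UNIV)
    \<and> (\<forall>z. continuous_on {0..<2*pi} (\<lambda>\<sigma>. Dsig X a0 a1 \<sigma> z))
    \<and> (\<forall>\<sigma>\<in>{0..<2*pi}. \<forall>z.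
          (Dsig X a0 a1 \<sigma> z = 0 \<longleftrightarrow> is_eigenvalue X a0 a1 \<sigma> z)
        \<and> (Dsig X a0 a1 \<sigma> z = 0 \<longrightarrow> zorder (Dsig X a0 a1 \<sigma>) z = int (alg_mult X a0 a1 \<sigma> z)))"
proof -
  interpret bloch X a0 a1 using assms by unfold_locales
  show ?thesis
  proof (intro conjI ballI allI impI)
    show "convergent (Dtrunc X a0 a1 \<sigma> z)" for \<sigma> z using Dtrunc_lim by (rule convergentI)
    show "Dsig X a0 a1 \<sigma> analytic_on UNIV" for \<sigma> by (simp add: analytic_on_open Dsig_holomorphic)
    show "continuous_on {0..<2*pi} (\<lambda>\<sigma>. Dsig X a0 a1 \<sigma> z)" for z
      unfolding continuous_on_def using Dsig_continuous by blast
    show "Dsig X a0 a1 \<sigma> z = 0 \<longleftrightarrow> is_eigenvalue X a0 a1 \<sigma> z" for \<sigma> z by (rule Dsig_zero_iff)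
    show "zorder (Dsig X a0 a1 \<sigma>) z = int (alg_mult X a0 a1 \<sigma> z)" for \<sigma> z by (rule zorder_Dsig)
  qed
qed

end
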